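(* Let $k,n$ be positive integers with $k+2\le n$ and let $Z\in\mathrm{Mat}^{>0}_{n,k+2}$. Let $\overline{\mathcal T}$ be a bicolored subdivision of type $(k,n)$ and let $h\to j$ be a compatible arc, with $h<j$. Then: (1) $\mathrm{area}(h\to j)+1>x_{[h,j-1]}>\mathrm{area}(h\to j)$ for all $x\in\Gamma^\circ_{G(\mathcal T)}$; (2) $\mathrm{sgn}\langle Yhj\rangle=(-1)^{\mathrm{area}(h\to j)}$ for all $Y\in Z^\circ_{\hat G(\mathcal T)}$. Furthermore, for any bicolored triangulation $\mathcal T'$ represented by $\overline{\mathcal T}$, the inequalities (1) given by the arcs $h\to j$ ($h<j$) of $\mathcal T'$ (sides and diagonals) cut out $\Gamma^\circ_{G(\mathcal T)}$ inside the hyperplane $\{x\in\mathbb R^n: x_{[n]}=k+1\}$, and the sign conditions (2) given by the arcs of $\mathcal T'$ cut out $Z^\circ_{\hat G(\mathcal T)}$ inside $\mathrm{Gr}_{k,k+2}$.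
   Context: Grassmannians. $\mathrm{Gr}_{k,n}$ is the Grassmannian of $k$-planes in $\mathbb R^n$ (row spans of full-rank $k\times n$ matrices), $p_I$ are Plücker coordinates (maximal minors), $\mathrm{Gr}^{\ge0}_{k,n}$ is the set of points having a representative with all $p_I\ge0$. For $\mathcal M\subseteq\binom{[n]}{k}$ the positroid cell $S_{\mathcal M}$ is the set of points of $\mathrm{Gr}^{\ge0}_{k,n}$ with $p_I>0$ for $I\in\mathcal M$ and $p_I=0$ otherwise (if nonempty). Bicolored subdivisions. Let $\mathbf P_n$ be a convex $n$-gon with vertices $1,\dots,n$ clockwise. A bicolored triangulation $\mathcal T$ of type $(k,n)$ is a triangulation of $\mathbf P_n$ with $k$ black triangles and the rest white; erasing the diagonals separating triangles of the same color gives the bicolored subdivision $\overline{\mathcal T}$ of type $(k,n)$ representing $\mathcal T$. An arc $h\to j$ is compatible with $\overline{\mathcal T}$ if it does not cross any arc of $\overline{\mathcal T}$. Then $\mathrm{area}(h\to j)$ is the number of black triangles to the left of $h\to j$ (the side containing vertices $h,h+1,\dots,j$ cyclically) in any triangulation of $\overline{\mathcal T}$ using $h\to j$. Hypersimplex side. For $x\in\mathbb R^n$ and $I\subseteq[n]$, $x_I:=\sum_{i\in I}x_i$; $[h,j-1]=\{h,\dots,j-1\}$. $G(\mathcal T)$ is the planar dual tree of $\overline{\mathcal T}$: a black (white) vertex in each black (white) polygon of $\overline{\mathcal T}$, an edge between vertices of polygons sharing an edge, and, for each $i$, a boundary vertex $i$ joined to the polygon having the side between vertices $i$ and $i+1$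 of $\mathbf P_n$ (dualizing a triangulation instead gives the same cell). To define its positroid, insert a bivalent white vertex on each edge joining a boundary vertex to a black vertex; an almost perfect matching $M$ is a set of edges such that each internal vertex is in exactly one edge of $M$ and each boundary vertex in at most one; $\partial M$ is the set of boundary vertices covered by $M$. $S_{G(\mathcal T)}\subset\mathrm{Gr}^{\ge0}_{k+1,n}$ is the positroid cell $S_{\mathcal M}$ with $\mathcal M=\{\partial M\}\subseteq\binom{[n]}{k+1}$. The moment map is $\mu(A)=\sum_{I}|p_I(A)|^2e_I/\sum_I|p_I(A)|^2$ on $\mathrm{Gr}_{k+1,n}$, with $I\in\binom{[n]}{k+1}$ and $e_I=\sum_{i\in I}e_i\in\mathbb R^n$. $\Gamma^\circ_{G(\mathcal T)}:=\mu(S_{G(\mathcal T)})$. Amplituhedron side. $\mathrm{Mat}^{>0}_{n,k+2}$ is the set of real $n\times(k+2)$ matrices with all maximal minors positive; $Z$ has rows $Z_1,\dots,Z_n$ and $\tilde Z:\mathrm{Gr}^{\ge0}_{k,n}\to\mathrm{Gr}_{k,k+2}$, $C\mapsto CZ$. $S_{\hat G(\mathcal T)}\subset\mathrm{Gr}^{\ge0}_{k,n}$ (the T-dual cell) is $S_{\mathcal M}$ where $\mathcal M$ is the set of $I\in\binom{[n]}k$ admitting a bijection $\phi$ from $I$ to the black triangles of $\mathcal T$ with $i$ a vertex of $\phi(i)$; it depends only on $\overline{\mathcal T}$. $Z^\circ_{\hat G(\mathcal T)}:=\tilde Z(S_{\hat G(\mathcal T)})$. For $Y\in\mathrm{Gr}_{k,k+2}$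 with representative rows $y_1,\dots,y_k$, $\langle Yij\rangle=\det(y_1,\dots,y_k,Z_i,Z_j)$, defined up to a common nonzero scalar; a list of sign conditions on $Y$ holds if it holds for some representative of $Y$ (the same for all conditions). *)

theory Defs
  imports Complex_Main "Jordan_Normal_Form.DL_Rank" "Jordan_Normal_Form.DL_Submatrix"
begin

text \<open>
  Indices are shifted by one against the usual convention: the vertices of the \<open>n\<close>-gon, the
  coordinates of \<open>\<real>\<^sup>n\<close> and the columns of a \<open>k \<times> n\<close> matrix are \<open>0, \<dots>, n - 1\<close>.
\<close>

section \<open>Bicolored triangulations and subdivisions\<close>

text \<open>An arc (side or diagonal) is the two-element set of its endpoints, a convex polygon the set
  of its vertices.\<close>

definition arcs :: "nat \<Rightarrow> nat set set" where
  "arcs n = {{p, q} | p q. p < q \<and> q < n}"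

text \<open>Two vertices \<open>p < q\<close> of \<open>P\<close> are cyclically adjacent iff there is no vertex of \<open>P\<close> strictly
  between them, or none outside the range from \<open>p\<close> to \<open>q\<close>.\<close>

definition poly_edges :: "nat set \<Rightarrow> nat set set" where
  "poly_edges P =
     {{p, q} | p q. p \<in> P \<and> q \<in> P \<and> p < q \<and> (P \<inter> {p<..<q} = {} \<or> P \<subseteq> {p..q})}"

definition sides :: "nat \<Rightarrow> nat set set" where
  "sides n = poly_edges {0..<n}"

definition crosses :: "nat set \<Rightarrow> nat set \<Rightarrow> bool" where
  "crosses a b \<longleftrightarrow>
     (\<exists>p q r s. p < q \<and> q < r \<and> r < s \<and> (a = {p, r} \<and> b = {q, s} \<or> a = {q, s} \<and> b = {p, r}))"

definition noncrossing_diagonals :: "nat \<Rightarrow> nat set set \<Rightarrow> bool" where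
  "noncrossing_diagonals n D \<longleftrightarrow> D \<subseteq> arcs n - sides n \<and> (\<forall>a\<in>D. \<forall>b\<in>D. \<not> crosses a b)"

text \<open>The polygons into which the diagonals \<open>D\<close> cut the \<open>n\<close>-gon: those bounded by sides and members
  of \<open>D\<close> and having no member of \<open>D\<close> as a diagonal.\<close>

definition faces :: "nat \<Rightarrow> nat set set \<Rightarrow> nat set set" where
  "faces n D =
     {P. P \<subseteq> {0..<n} \<and> 3 \<le> card P \<and> poly_edges P \<subseteq> sides n \<union> D \<and>
         (\<forall>d\<in>D. d \<subseteq> P \<longrightarrow> d \<in> poly_edges P)}"

definition triangulation :: "nat \<Rightarrow> nat set set \<Rightarrow> bool" where
  "triangulation n D \<longleftrightarrow> noncrossing_diagonals n D \<and> (\<forall>P\<in>faces n D. card P = 3)"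

text \<open>The same record is used for bicolored triangulations and for bicolored subdivisions; faces that
  are not black are white.\<close>

record bicolored =
  diags :: "nat set set"
  blacks :: "nat set set"

definition bicolored_triangulation :: "nat \<Rightarrow> nat \<Rightarrow> bicolored \<Rightarrow> bool" where
  "bicolored_triangulation k n T \<longleftrightarrow>
     triangulation n (diags T) \<and> blacks T \<subseteq> faces n (diags T) \<and> card (blacks T) = k"

definition unicolored_diags :: "nat \<Rightarrow> bicolored \<Rightarrow> nat set set" where
  "unicolored_diags n T =
     {d \<in> diags T. \<exists>s\<in>faces n (diags T). \<exists>t\<in>faces n (diags T).
        s \<noteq> t \<and> d \<in> poly_edges s \<inter> poly_edges t \<and> (s \<in> blacks T \<longleftrightarrow> t \<in> blacks T)}"

definition subdivision_of :: "nat \<Rightarrow> bicolored \<Rightarrow> bicolored" where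
  "subdivision_of n T =
     (let D = diags T - unicolored_diags n T
      in \<lparr>diags = D, blacks = {P \<in> faces n D. \<exists>t\<in>blacks T. t \<subseteq> P}\<rparr>)"

definition represented_by :: "nat \<Rightarrow> bicolored \<Rightarrow> bicolored \<Rightarrow> bool" where
  "represented_by n S T \<longleftrightarrow>
     bicolored_triangulation (card (blacks T)) n T \<and> subdivision_of n T = S"

definition compatible :: "nat \<Rightarrow> bicolored \<Rightarrow> nat \<Rightarrow> nat \<Rightarrow> bool" where
  "compatible n S h j \<longleftrightarrow>
     h < n \<and> j < n \<and> h \<noteq> j \<and> (\<forall>d\<in>sides n \<union> diags S. \<not> crosses {h, j} d)"

definition cyclic_interval :: "nat \<Rightarrow> nat \<Rightarrow> nat \<Rightarrow> nat set" where
  "cyclic_interval n h j = (if h \<le> j then {h..j} else {h..<n} \<union> {0..j})"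

text \<open>The count is the same for all triangulations represented by \<open>S\<close> that use the arc; one exists iff
  the arc is compatible.\<close>

definition area :: "nat \<Rightarrow> bicolored \<Rightarrow> nat \<Rightarrow> nat \<Rightarrow> nat" where
  "area n S h j =
     (THE a. \<exists>T. represented_by n S T \<and> {h, j} \<in> sides n \<union> diags T \<and>
                 a = card {t \<in> blacks T. t \<subseteq> cyclic_interval n h j})"

section \<open>Grassmannians and positroid cells\<close>

text \<open>A point of the Grassmannian is a subspace of \<open>\<real>\<^sup>n\<close>; \<open>A\<close> represents \<open>V\<close> if \<open>A\<close> is a full-rank
  \<open>k \<times> n\<close> matrix with row span \<open>V\<close>.\<close>

definition represents :: "nat \<Rightarrow> nat \<Rightarrow> real mat \<Rightarrow> real vec set \<Rightarrow> bool" where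
  "represents k n A V \<longleftrightarrow>
     A \<in> carrier_mat k n \<and> vec_space.rank k A = k \<and> vec_space.row_space n A = V"

definition Gr :: "nat \<Rightarrow> nat \<Rightarrow> real vec set set" where
  "Gr k n = {V. \<exists>A. represents k n A V}"

definition ksubsets :: "nat \<Rightarrow> nat \<Rightarrow> nat set set" where
  "ksubsets k n = {I. I \<subseteq> {0..<n} \<and> card I = k}"

definition plucker :: "real mat \<Rightarrow> nat set \<Rightarrow> real" where
  "plucker A I = det (submatrix A UNIV I)"

definition Gr_nonneg :: "nat \<Rightarrow> nat \<Rightarrow> real vec set set" where
  "Gr_nonneg k n = {V. \<exists>A. represents k n A V \<and> (\<forall>I\<in>ksubsets k n. plucker A I \<ge> 0)}"

definition positroid_cell :: "nat \<Rightarrow> nat \<Rightarrow> nat set set \<Rightarrow> real vec set set" where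
  "positroid_cell k n M =
     {V \<in> Gr_nonneg k n. \<exists>A. represents k n A V \<and>
        (\<forall>I\<in>ksubsets k n. if I \<in> M then plucker A I > 0 else plucker A I = 0)}"

text \<open>A choice of representative; the maps below do not depend on it.\<close>

definition matrix_of :: "nat \<Rightarrow> nat \<Rightarrow> real vec set \<Rightarrow> real mat" where
  "matrix_of k n V = (SOME A. represents k n A V)"

section \<open>The hypersimplex side\<close>

definition coord_sum :: "real vec \<Rightarrow> nat set \<Rightarrow> real" where
  "coord_sum x I = (\<Sum>i\<in>I. x $ i)"

definition indicator_vec :: "nat \<Rightarrow> nat set \<Rightarrow> real vec" where
  "indicator_vec n I = vec n (\<lambda>i. of_bool (i \<in> I))"

definition moment_map :: "nat \<Rightarrow> nat \<Rightarrow> real vec set \<Rightarrow> real vec" where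
  "moment_map k n V =
     (let p = plucker (matrix_of k n V)
      in vec n (\<lambda>i. (\<Sum>I\<in>ksubsets k n. \<bar>p I\<bar>\<^sup>2 * indicator_vec n I $ i) /
                    (\<Sum>I\<in>ksubsets k n. \<bar>p I\<bar>\<^sup>2)))"

text \<open>\<open>Boundary i\<close> sits at the side joining the vertices \<open>i\<close> and \<open>i + 1\<close> of the \<open>n\<close>-gon,
  \<open>Bivalent i\<close> is the white vertex inserted on the edge at \<open>Boundary i\<close>.\<close>

datatype gvertex = Boundary nat | Region "nat set" | Bivalent nat

definition dual_tree_edges :: "nat \<Rightarrow> bicolored \<Rightarrow> gvertex set set" where
  "dual_tree_edges n S =
     {{Region P, Region Q} | P Q. P \<in> faces n (diags S) \<and> Q \<in> faces n (diags S) \<and> P \<noteq> Q \<and>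
                                  poly_edges P \<inter> poly_edges Q \<noteq> {}} \<union>
     {{Boundary i, Region P} | i P. i < n \<and> P \<in> faces n (diags S) \<and>
                                    {i, (i + 1) mod n} \<in> poly_edges P}"

definition black_boundary_edges :: "nat \<Rightarrow> bicolored \<Rightarrow> (nat \<times> nat set) set" where
  "black_boundary_edges n S =
     {(i, P). {Boundary i, Region P} \<in> dual_tree_edges n S \<and> P \<in> blacks S}"

definition plabic_edges :: "nat \<Rightarrow> bicolored \<Rightarrow> gvertex set set" where
  "plabic_edges n S =
     (dual_tree_edges n S - {{Boundary i, Region P} | i P. (i, P) \<in> black_boundary_edges n S}) \<union>
     (\<Union>(i, P)\<in>black_boundary_edges n S.
        {{Boundary i, Bivalent i}, {Bivalent i, Region P}})"

definition internal_vertices :: "nat \<Rightarrow> bicolored \<Rightarrow> gvertex set" where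
  "internal_vertices n S =
     Region ` faces n (diags S) \<union> (Bivalent \<circ> fst) ` black_boundary_edges n S"

definition almost_perfect_matching :: "nat \<Rightarrow> bicolored \<Rightarrow> gvertex set set \<Rightarrow> bool" where
  "almost_perfect_matching n S M \<longleftrightarrow>
     M \<subseteq> plabic_edges n S \<and>
     (\<forall>v\<in>internal_vertices n S. \<exists>!e. e \<in> M \<and> v \<in> e) \<and>
     (\<forall>i<n. \<forall>e\<in>M. \<forall>f\<in>M. Boundary i \<in> e \<and> Boundary i \<in> f \<longrightarrow> e = f)"

definition matching_boundary :: "nat \<Rightarrow> gvertex set set \<Rightarrow> nat set" where
  "matching_boundary n M = {i. i < n \<and> (\<exists>e\<in>M. Boundary i \<in> e)}"

definition matching_positroid :: "nat \<Rightarrow> bicolored \<Rightarrow> nat set set" where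
  "matching_positroid n S = {matching_boundary n M | M. almost_perfect_matching n S M}"

definition Gamma_open :: "nat \<Rightarrow> nat \<Rightarrow> bicolored \<Rightarrow> real vec set" where
  "Gamma_open k n S =
     moment_map (k + 1) n ` positroid_cell (k + 1) n (matching_positroid n S)"

section \<open>The amplituhedron side\<close>

definition Mat_pos :: "nat \<Rightarrow> nat \<Rightarrow> real mat set" where
  "Mat_pos n m = {Z \<in> carrier_mat n m. \<forall>J\<in>ksubsets m n. det (submatrix Z J UNIV) > 0}"

definition Z_tilde :: "nat \<Rightarrow> nat \<Rightarrow> real mat \<Rightarrow> real vec set \<Rightarrow> real vec set" where
  "Z_tilde k n Z V = vec_space.row_space (k + 2) (matrix_of k n V * Z)"

definition tdual_positroid :: "nat \<Rightarrow> nat \<Rightarrow> bicolored \<Rightarrow> nat set set" where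
  "tdual_positroid k n T =
     {I \<in> ksubsets k n. \<exists>\<phi>. bij_betw \<phi> I (blacks T) \<and> (\<forall>i\<in>I. i \<in> \<phi> i)}"

definition Z_open :: "nat \<Rightarrow> nat \<Rightarrow> real mat \<Rightarrow> bicolored \<Rightarrow> real vec set set" where
  "Z_open k n Z T = Z_tilde k n Z ` positroid_cell k n (tdual_positroid k n T)"

text \<open>\<open>\<langle>Y i j\<rangle>\<close> for a representing matrix \<open>A\<close> of \<open>Y\<close>.\<close>

definition twistor :: "real mat \<Rightarrow> real mat \<Rightarrow> nat \<Rightarrow> nat \<Rightarrow> real" where
  "twistor Z A i j = det (A @\<^sub>r mat_of_rows (dim_col Z) [row Z i, row Z j])"

end

theory Submission
  imports Defs "Jordan_Normal_Form.DL_Rank_Submatrix"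
begin

text \<open>
  Both halves rest on one recursion. A noncrossing set of arcs is nested: the arc from \<open>a\<close> to \<open>c\<close>
  that is not a side has exactly one triangle \<open>a < b < c\<close> below it, and the area on its left is the sum of the
  areas of \<open>(a, b)\<close> and \<open>(b, c)\<close>, plus one if the triangle is black (\<open>count_in_tri\<close>). A
  subdivision and the triangulations representing it are compared face by face: each triangle lies in one
  face of the subdivision, whose colour it has, and the erased diagonals are those inside faces.

  On the hypersimplex side, an almost perfect matching of the dual tree amounts to the selection of one
  edge from every face. Reading the selection from short arcs to long ones shows that the boundary sets
  \<open>I\<close> of matchings are the sets of size \<open>k + 1\<close> for which \<open>card (I \<inter> {h..<j})\<close> exceeds the area by \<open>0\<close>
  or \<open>1\<close>, for every arc of any one representing triangulation (\<open>matching_positroid_eq\<close>). A point of the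
  moment map image is a mean of the vectors \<open>e\<^sub>I\<close> of these sets with positive weights, and both values
  \<open>0\<close> and \<open>1\<close> occur at each arc, whence the strict inequalities. They also determine the area from the
  positroid alone, so the choice of the triangulation does not matter (\<open>area_eq_count\<close>). Conversely, let
  \<open>x\<close> satisfy the strict inequalities. Because the dual graph is a tree, there are weights \<open>\<tau> i > 0\<close> such
  that \<open>x\<close> is the mean of the \<open>e\<^sub>I\<close> weighted by the products of the \<open>\<tau> i\<close> with \<open>i \<in> I\<close> (\<open>realizable\<close>);
  and there is a matrix whose maximal minors are \<open>1\<close> on the positroid and \<open>0\<close> off it (\<open>states_matrix\<close>).
  Multiplying its columns by the square roots of the \<open>\<tau> i\<close> gives a point of the cell over \<open>x\<close>.

  On the amplituhedron side, the T-dual positroid consists of the systems of distinct representatives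
  of the black triangles. Any \<open>m - 2\<close> vertices of an \<open>m\<close>-gon represent the triangles of any of its
  triangulations (\<open>polygon_transversal\<close>), so the cell depends on the subdivision only. If \<open>I\<close> is such a
  system and avoids the ends of an arc, it has as many elements between them as there are black
  triangles on the left (\<open>transversal_between\<close>). Expanding a twistor coordinate of \<open>C * Z\<close> by the
  Cauchy-Binet formula, all terms therefore have the sign given by the area (\<open>twistor_signs\<close>).
  Conversely, if \<open>Y\<close> has these signs at the arcs of a triangulation, then every black triangle gives a
  vector of \<open>Y\<close> that combines three rows of \<open>Z\<close>, with twistor coordinates as coefficients. The matrix
  \<open>C\<close> of these coefficients has positive maximal minors exactly on the T-dual positroid: after sorting the
  triangles by their middle vertices, the inversions of a choice of corners are counted by the same
  areas as the signs of the coefficients, so that nothing cancels (\<open>crow_minor\<close>). Hence \<open>Y\<close> is the image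
  of a point of the cell (\<open>amplituhedron_converse\<close>).
\<close>

section \<open>Arcs and faces of a dissection\<close>

lemma doubleton_eq_less:
  fixes p q r s :: nat
  assumes "p < q" "r < s"
  shows "{p, q} = {r, s} \<longleftrightarrow> p = r \<and> q = s"
  using assms by (auto simp: doubleton_eq_iff)

lemma mem_poly_edges:
  assumes "p < q"
  shows "{p, q} \<in> poly_edges P \<longleftrightarrow> p \<in> P \<and> q \<in> P \<and> (P \<inter> {p<..<q} = {} \<or> P \<subseteq> {p..q})"
proof
  assume "{p, q} \<in> poly_edges P"
  then obtain p' q' where "{p, q} = {p', q'}" "p' < q'" "p' \<in> P" "q' \<in> P"
      "P \<inter> {p'<..<q'} = {} \<or> P \<subseteq> {p'..q'}"
    unfolding poly_edges_def by blast
  with assms show "p \<in> P \<and> q \<in> P \<and> (P \<inter> {p<..<q} = {} \<or> P \<subseteq> {p..q})"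
    by (simp add: doubleton_eq_less)
next
  assume "p \<in> P \<and> q \<in> P \<and> (P \<inter> {p<..<q} = {} \<or> P \<subseteq> {p..q})"
  with assms show "{p, q} \<in> poly_edges P" unfolding poly_edges_def by blast
qed

lemma poly_edgesE:
  assumes "e \<in> poly_edges P"
  obtains p q where "e = {p, q}" "p < q" "p \<in> P" "q \<in> P" "P \<inter> {p<..<q} = {} \<or> P \<subseteq> {p..q}"
  using assms unfolding poly_edges_def by blast

lemma mem_sides:
  assumes "p < q"
  shows "{p, q} \<in> sides n \<longleftrightarrow> q < n \<and> (q = p + 1 \<or> (p = 0 \<and> q = n - 1))"
proof -
  have "{0..<n} \<inter> {p<..<q} = {} \<longleftrightarrow> q = p + 1" if "q < n"
  proof
    assume e: "{0..<n} \<inter> {p<..<q} = {}"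
    have "p + 1 \<notin> {0..<n} \<inter> {p<..<q}" using e by blast
    then show "q = p + 1" using assms that by auto
  qed auto
  moreover have "{0..<n} \<subseteq> {p..q} \<longleftrightarrow> p = 0 \<and> q = n - 1" if "q < n"
  proof
    assume e: "{0..<n} \<subseteq> {p..q}"
    have "0 \<in> {0..<n}" "n - 1 \<in> {0..<n}" using that by auto
    then have "0 \<in> {p..q}" "n - 1 \<in> {p..q}" using e by blast+
    then show "p = 0 \<and> q = n - 1" using that by auto
  qed (use that in auto)
  ultimately show ?thesis using assms unfolding sides_def
    by (subst mem_poly_edges) auto
qed

lemma crosses_iff:
  assumes "p < r" "q < s"
  shows "crosses {p, r} {q, s} \<longleftrightarrow> (p < q \<and> q < r \<and> r < s) \<or> (q < p \<and> p < s \<and> s < r)"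
proof
  assume "crosses {p, r} {q, s}"
  then obtain a b c d where o: "a < b" "b < c" "c < d"
    and "{p, r} = {a, c} \<and> {q, s} = {b, d} \<or> {p, r} = {b, d} \<and> {q, s} = {a, c}"
    unfolding crosses_def by blast
  moreover have "a < c" "b < d" using o by auto
  ultimately show "(p < q \<and> q < r \<and> r < s) \<or> (q < p \<and> p < s \<and> s < r)"
    using assms o by (auto simp: doubleton_eq_less)
next
  assume "(p < q \<and> q < r \<and> r < s) \<or> (q < p \<and> p < s \<and> s < r)"
  then show "crosses {p, r} {q, s}" unfolding crosses_def by blast
qed

lemma crosses_sym: "crosses a b \<longleftrightarrow> crosses b a"
  unfolding crosses_def by blast

locale arc_system =
  fixes n :: nat and D :: "nat set set"
  assumes n3: "3 \<le> n" and noncrossing: "noncrossing_diagonals n D"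
begin

definition arc :: "nat \<Rightarrow> nat \<Rightarrow> bool" where
  "arc p q \<longleftrightarrow> p < q \<and> {p, q} \<in> sides n \<union> D"

lemma diagE:
  assumes "d \<in> D"
  obtains p q where "d = {p, q}" "arc p q" "p + 1 < q" "(p, q) \<noteq> (0, n - 1)"
proof -
  have "d \<in> arcs n" "d \<notin> sides n" using noncrossing assms
    unfolding noncrossing_diagonals_def by auto
  then obtain p q where pq: "d = {p, q}" "p < q" "q < n" unfolding arcs_def by blast
  with \<open>d \<notin> sides n\<close> have "p + 1 < q" "(p, q) \<noteq> (0, n - 1)" by (auto simp: mem_sides)
  with pq assms that show ?thesis by (auto simp: arc_def)
qed

lemma arc_less: "arc p q \<Longrightarrow> p < q"
  by (simp add: arc_def)

lemma arc_bound:
  assumes "arc p q" shows "q < n"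
proof (cases "{p, q} \<in> sides n")
  case True
  with assms show ?thesis by (auto simp: arc_def mem_sides)
next
  case False
  with assms have "{p, q} \<in> arcs n" "p < q"
    using noncrossing unfolding arc_def noncrossing_diagonals_def by auto
  then obtain p' q' where "{p, q} = {p', q'}" "p' < q'" "q' < n" unfolding arcs_def by blast
  with \<open>p < q\<close> show ?thesis by (auto simp: doubleton_eq_iff)
qed

lemma arc_Suc: "p + 1 < n \<Longrightarrow> arc p (p + 1)"
  by (simp add: arc_def mem_sides)

lemma arc_root: "arc 0 (n - 1)"
  using n3 by (simp add: arc_def mem_sides)

lemma arc_diag:
  assumes "arc p q" "p + 1 < q" "(p, q) \<noteq> (0, n - 1)"
  shows "{p, q} \<in> D"
  using assms unfolding arc_def by (auto simp: mem_sides)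

lemma arc_not_diag:
  assumes "arc p q" "{p, q} \<notin> D"
  shows "q = p + 1 \<or> p = 0 \<and> q = n - 1"
  using assms unfolding arc_def by (auto simp: mem_sides)

lemma arc_noncrossing:
  assumes "arc p r" "arc q s" "p < q" "q < r" "r < s"
  shows False
proof (cases "{p, r} \<in> D \<and> {q, s} \<in> D")
  case True
  then have "\<not> crosses {p, r} {q, s}" using noncrossing
    unfolding noncrossing_diagonals_def by blast
  with assms show False by (simp add: crosses_iff)
next
  case False
  then consider "{p, r} \<notin> D" | "{q, s} \<notin> D" by blast
  then show False
  proof cases
    case 1
    with arc_not_diag[OF assms(1)] assms arc_bound[OF assms(2)] show False by auto
  next
    case 2
    with arc_not_diag[OF assms(2)] assms show False by auto
  qed
qed

lemma arcs_nested:
  assumes "arc p r" "arc q s" "p < s" "q < r"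
  shows "p \<le> q \<and> s \<le> r \<or> q \<le> p \<and> r \<le> s"
proof (rule ccontr)
  assume "\<not> ?thesis"
  then have "p < q \<and> r < s \<or> q < p \<and> s < r" using assms(3,4) by linarith
  then show False
    using arc_noncrossing[OF assms(1,2)] arc_noncrossing[OF assms(2,1)] assms(3,4) by blast
qed

text \<open>The face just below an arc consists of the vertices that no other arc underneath it hides. Every
  face of a noncrossing set of diagonals arises so from exactly one arc, the one joining its smallest
  to its largest vertex; this turns the cyclic picture into a nested, hence recursive, one.\<close>

definition below :: "nat \<Rightarrow> nat \<Rightarrow> nat set" where
  "below a c = {v \<in> {a..c}. \<forall>p q. arc p q \<longrightarrow> a \<le> p \<longrightarrow> q \<le> c \<longrightarrow> (p, q) \<noteq> (a, c) \<longrightarrow> \<not> (p < v \<and> v < q)}"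

lemma below_subset: "below a c \<subseteq> {a..c}"
  by (auto simp: below_def)

lemma finite_below: "finite (below a c)"
  using below_subset finite_subset by blast

lemma below_hidden:
  assumes "v \<in> below a c" "arc p q" "a \<le> p" "q \<le> c" "(p, q) \<noteq> (a, c)" "p < v" "v < q"
  shows False
  using assms unfolding below_def by blast

lemma below_ends: "a \<le> c \<Longrightarrow> a \<in> below a c \<and> c \<in> below a c"
  by (auto simp: below_def)

text \<open>The successor of \<open>p\<close> on the face is the far end of the longest arc that starts at \<open>p\<close> and stays
  under \<open>(a, c)\<close>: an arc hiding it would cross that arc, be longer, or hide \<open>p\<close>.\<close>

lemma below_next:
  assumes ac: "arc a c" "a + 1 < c" and p: "p \<in> below a c" "p < c"
  obtains r where "r \<in> below a c" "p < r" "arc p r" "(p, r) \<noteq> (a, c)" "below a c \<inter> {p<..<r} = {}"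
proof -
  define X where "X = {r. arc p r \<and> r \<le> c \<and> (p, r) \<noteq> (a, c)}"
  have ap: "a \<le> p" using p below_subset by fastforce
  have "c < n" using ac arc_bound by blast
  then have "arc p (p + 1)" using p arc_Suc by auto
  then have "p + 1 \<in> X" using p ac unfolding X_def by auto
  moreover have fin: "finite X" unfolding X_def by (rule finite_subset[of _ "{..c}"]) auto
  ultimately have M: "Max X \<in> X" by (metis Max_in empty_iff)
  define r where "r = Max X"
  have r: "arc p r" "r \<le> c" "(p, r) \<noteq> (a, c)" using M unfolding r_def X_def by auto
  have max: "t \<le> r" if "arc p t" "t \<le> c" "(p, t) \<noteq> (a, c)" for t
    using fin that unfolding r_def X_def by auto
  have pr: "p < r" using r arc_less by blast
  have "r \<in> below a c"
  proof (rule ccontr)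
    assume "r \<notin> below a c"
    then obtain s w where sw: "arc s w" "a \<le> s" "w \<le> c" "(s, w) \<noteq> (a, c)" "s < r" "r < w"
      unfolding below_def using ap pr r(2) by auto
    consider "s < p" | "s = p" | "p < s" by linarith
    then show False
    proof cases
      case 1 then show False using below_hidden[OF p(1) sw(1-4)] pr sw by linarith
    next
      case 2 then show False using max[of w] sw by auto
    next
      case 3 then show False using arc_noncrossing[OF r(1) sw(1)] sw by auto
    qed
  qed
  moreover have "below a c \<inter> {p<..<r} = {}"
    using below_hidden[OF _ r(1) ap r(2,3)] by auto
  ultimately show ?thesis using that r pr by blast
qed

lemma below_edges:
  assumes ac: "arc a c" "a + 1 < c"
  shows "poly_edges (below a c) \<subseteq> sides n \<union> D"
proof
  fix e assume "e \<in> poly_edges (below a c)"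
  then obtain p q where e: "e = {p, q}" "p < q" "p \<in> below a c" "q \<in> below a c"
     "below a c \<inter> {p<..<q} = {} \<or> below a c \<subseteq> {p..q}" by (rule poly_edgesE)
  from e(5) show "e \<in> sides n \<union> D"
  proof
    assume emp: "below a c \<inter> {p<..<q} = {}"
    have "p < c" using e below_subset by fastforce
    from below_next[OF ac e(3) this] obtain r where
      r: "r \<in> below a c" "p < r" "arc p r" "below a c \<inter> {p<..<r} = {}" by blast
    have "r = q"
    proof (rule linorder_cases[of r q])
      assume "r < q" then have "r \<in> below a c \<inter> {p<..<q}" using r by auto
      with emp show ?thesis by blast
    next
      assume "q < r" then have "q \<in> below a c \<inter> {p<..<r}" using e by auto
      with r(4) show ?thesis by blast
    qed
    with r e show ?thesis by (auto simp: arc_def)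
  next
    assume "below a c \<subseteq> {p..q}"
    with below_ends[of a c] ac have "p \<le> a" "c \<le> q" by auto
    moreover have "a \<le> p" "q \<le> c" using e below_subset by fastforce+
    ultimately show ?thesis using ac(1) e by (auto simp: arc_def)
  qed
qed

lemma below_face:
  assumes ac: "arc a c" "a + 1 < c"
  shows "below a c \<in> faces n D"
proof -
  have "c < n" using ac arc_bound by blast
  have ends: "a \<in> below a c" "c \<in> below a c" using below_ends ac by auto
  obtain r where r: "r \<in> below a c" "a < r" "(a, r) \<noteq> (a, c)"
    using below_next[OF ac ends(1)] ac by (metis add_lessD1)
  have "card {a, r, c} = 3" using r ac by (auto simp: card_insert_if)
  moreover have "{a, r, c} \<subseteq> below a c" using ends r by auto
  ultimately have "3 \<le> card (below a c)" using card_mono[OF finite_below] by metis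
  moreover have "d \<in> poly_edges (below a c)" if "d \<in> D" "d \<subseteq> below a c" for d
  proof -
    obtain p q where pq: "d = {p, q}" "arc p q" using diagE \<open>d \<in> D\<close> by metis
    with that have m: "p \<in> below a c" "q \<in> below a c" by auto
    then have b: "a \<le> p" "q \<le> c" using below_subset by fastforce+
    have "below a c \<inter> {p<..<q} = {} \<or> below a c \<subseteq> {p..q}"
      using below_hidden[OF _ pq(2) b] below_subset[of a c] by (cases "(p, q) = (a, c)") auto
    then show ?thesis using pq m arc_less mem_poly_edges by metis
  qed
  ultimately show ?thesis unfolding faces_def
    using below_subset[of a c] \<open>c < n\<close> below_edges[OF ac] by auto
qed

text \<open>Unlike a face, a polygon may have diagonals in its interior, and it may degenerate to the two
  ends of an arc; so polygons can be cut along arcs.\<close>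

definition polygon :: "nat set \<Rightarrow> bool" where
  "polygon Q \<longleftrightarrow> finite Q \<and> 2 \<le> card Q \<and> poly_edges Q \<subseteq> sides n \<union> D"

lemma polygon_arc:
  assumes "polygon Q" "p < q" "{p, q} \<in> poly_edges Q" shows "arc p q"
  using assms by (auto simp: polygon_def arc_def)

lemma polygon_ends:
  assumes "polygon Q"
  shows "Min Q \<in> Q" "Max Q \<in> Q" "Min Q < Max Q" "Q \<subseteq> {Min Q..Max Q}" "arc (Min Q) (Max Q)"
proof -
  have fin: "finite Q" and c: "2 \<le> card Q" using assms by (auto simp: polygon_def)
  then have ne: "Q \<noteq> {}" by auto
  show m: "Min Q \<in> Q" "Max Q \<in> Q" using fin ne by auto
  show s: "Q \<subseteq> {Min Q..Max Q}" using fin by auto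
  show l: "Min Q < Max Q"
  proof (rule ccontr)
    assume "\<not> ?thesis"
    then have "Q \<subseteq> {Min Q}" using s by auto
    then have "card Q \<le> 1" using card_mono[of "{Min Q}" Q] by auto
    with c show False by auto
  qed
  show "arc (Min Q) (Max Q)" using polygon_arc[OF assms l] l m s by (simp add: mem_poly_edges)
qed

lemma poly_gap:
  assumes Q: "polygon Q" and v: "v \<notin> Q" "h \<in> Q" "j \<in> Q" "h < v" "v < j"
  obtains p q where "p \<in> Q" "q \<in> Q" "p < v" "v < q" "arc p q" "Q \<inter> {p<..<q} = {}" "h \<le> p" "q \<le> j"
proof -
  have fin: "finite Q" using Q by (auto simp: polygon_def)
  define p q where "p = Max {x \<in> Q. x < v}" and "q = Min {x \<in> Q. v < x}"
  have "p \<in> {x \<in> Q. x < v}" unfolding p_def using fin v by (intro Max_in) auto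
  moreover have "q \<in> {x \<in> Q. v < x}" unfolding q_def using fin v by (intro Min_in) auto
  moreover have le: "x \<le> p" if "x \<in> Q" "x < v" for x
    unfolding p_def using fin that by (intro Max_ge) auto
  moreover have ge: "q \<le> x" if "x \<in> Q" "v < x" for x
    unfolding q_def using fin that by (intro Min_le) auto
  ultimately have pq: "p \<in> Q" "q \<in> Q" "p < v" "v < q" and e: "Q \<inter> {p<..<q} = {}" "h \<le> p" "q \<le> j"
    using v by (auto, metis linorder_cases not_le)
  have "arc p q" using polygon_arc[OF Q] pq e by (simp add: mem_poly_edges)
  with pq e that show ?thesis by blast
qed

lemma face_polygon: "P \<in> faces n D \<Longrightarrow> polygon P"
  unfolding faces_def polygon_def using finite_subset by fastforce

lemma below_polygon: "arc a c \<Longrightarrow> a + 1 < c \<Longrightarrow> polygon (below a c)"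
  using below_face face_polygon by blast

lemma Min_below: "a \<le> c \<Longrightarrow> Min (below a c) = a"
  using below_ends[of a c] below_subset[of a c] finite_below by (intro Min_eqI) auto

lemma Max_below: "a \<le> c \<Longrightarrow> Max (below a c) = c"
  using below_ends[of a c] below_subset[of a c] finite_below by (intro Max_eqI) auto

text \<open>The polygon \<open>P\<close> and the face below its longest edge hide each other's missing vertices: a vertex
  of \<open>P\<close> under an arc would force a diagonal of \<open>P\<close> or a crossing, and a vertex skipped by \<open>P\<close> lies under
  an edge of \<open>P\<close>.\<close>

lemma face_eq_below:
  assumes P: "P \<in> faces n D"
  shows "P = below (Min P) (Max P)" "Min P + 1 < Max P"
proof -
  have Q: "polygon P" using face_polygon P .
  let ?a = "Min P" and ?c = "Max P"
  note e = polygon_ends[OF Q]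
  have c3: "3 \<le> card P" and diag: "\<And>d. d \<in> D \<Longrightarrow> d \<subseteq> P \<Longrightarrow> d \<in> poly_edges P"
    using P by (auto simp: faces_def)
  have "card P \<le> card {?a..?c}" using e(4) by (intro card_mono) auto
  with c3 show ac: "?a + 1 < ?c" by auto
  have card2: "\<not> P \<subseteq> {?a, ?c}"
    using c3 card_mono[of "{?a, ?c}" P] card_insert_le_m1[of 2 "{?c}" ?a] by fastforce
  show "P = below ?a ?c"
  proof
    show "P \<subseteq> below ?a ?c"
    proof
      fix v assume v: "v \<in> P"
      show "v \<in> below ?a ?c"
      proof (rule ccontr)
        assume "v \<notin> below ?a ?c"
        then obtain p q where pq: "arc p q" "?a \<le> p" "q \<le> ?c" "(p, q) \<noteq> (?a, ?c)" "p < v" "v < q"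
          unfolding below_def using v e(4) by blast
        have "p \<in> P"
        proof (rule ccontr)
          assume n: "p \<notin> P"
          then have "?a < p" using pq e by (metis le_neq_implies_less)
          from poly_gap[OF Q n e(1) v this pq(5)] obtain r s where
            "r < p" "p < s" "arc r s" "s \<le> v" by metis
          then show False using arc_noncrossing[of r s p q] pq by linarith
        qed
        moreover have "q \<in> P"
        proof (rule ccontr)
          assume n: "q \<notin> P"
          then have "q < ?c" using pq e by (metis le_neq_implies_less)
          from poly_gap[OF Q n v e(2) pq(6) this] obtain r s where
            "r < q" "q < s" "arc r s" "v \<le> r" by metis
          then show False using arc_noncrossing[of p q r s] pq by linarith
        qed
        moreover have "{p, q} \<in> D" using pq e arc_bound[OF e(5)] by (intro arc_diag) auto
        ultimately have "{p, q} \<in> poly_edges P" using diag by blast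
        then have "P \<inter> {p<..<q} = {} \<or> P \<subseteq> {p..q}" using pq(5,6) by (simp add: mem_poly_edges)
        then show False
        proof
          assume "P \<inter> {p<..<q} = {}" then show False using v pq by auto
        next
          assume "P \<subseteq> {p..q}"
          with e(1,2) have "p \<le> ?a" "?c \<le> q" by auto
          with pq show False by auto
        qed
      qed
    qed
    show "below ?a ?c \<subseteq> P"
    proof
      fix v assume v: "v \<in> below ?a ?c"
      show "v \<in> P"
      proof (rule ccontr)
        assume n: "v \<notin> P"
        have "v \<in> {?a..?c}" using v below_subset by blast
        with n e(1,2) have "?a < v" "v < ?c" by (metis atLeastAtMost_iff le_neq_implies_less)+
        from poly_gap[OF Q n e(1,2) this] obtain p q where
          pq: "p \<in> P" "q \<in> P" "p < v" "v < q" "arc p q" "P \<inter> {p<..<q} = {}" "?a \<le> p" "q \<le> ?c" .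
        have "(p, q) \<noteq> (?a, ?c)"
        proof
          assume "(p, q) = (?a, ?c)"
          then have gap: "P \<inter> {?a<..<?c} = {}" using pq(6) by simp
          have "P \<subseteq> {?a, ?c}"
          proof
            fix x assume x: "x \<in> P"
            then have "?a \<le> x" "x \<le> ?c" using e(4) by auto
            moreover have "\<not> (?a < x \<and> x < ?c)" using gap x by auto
            ultimately show "x \<in> {?a, ?c}" by auto
          qed
          with card2 show False by simp
        qed
        then show False using below_hidden[OF v pq(5,7,8)] pq by blast
      qed
    qed
  qed
qed

lemma faceE:
  assumes "P \<in> faces n D"
  obtains a c where "arc a c" "a + 1 < c" "P = below a c"
  using face_eq_below[OF assms] polygon_ends[OF face_polygon[OF assms]] by blast

lemma below_inj:
  assumes "below a c = below a' c'" "a \<le> c" "a' \<le> c'"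
  shows "a = a' \<and> c = c'"
  using assms Min_below Max_below by metis

text \<open>Of two nested arcs the inner one hides the middle one of three common vertices from the outer
  face.\<close>

lemma below_unique:
  assumes "arc a c" "arc a' c'" "x \<in> below a c" "y \<in> below a c" "z \<in> below a c"
    "x \<in> below a' c'" "y \<in> below a' c'" "z \<in> below a' c'" "x < y" "y < z"
  shows "a = a' \<and> c = c'"
proof -
  have b: "a \<le> x" "z \<le> c" "a' \<le> x" "z \<le> c'" using assms below_subset by fastforce+
  have y: "a < y" "y < c" "a' < y" "y < c'" using b assms(9,10) by auto
  then have "a \<le> a' \<and> c' \<le> c \<or> a' \<le> a \<and> c \<le> c'" using arcs_nested[OF assms(1,2)] by linarith
  then show ?thesis
    using below_hidden[OF assms(4,2)] below_hidden[OF assms(7,1)] y by auto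
qed

lemma face_unique:
  assumes "P \<in> faces n D" "Q \<in> faces n D" "t \<subseteq> P" "t \<subseteq> Q" "3 \<le> card t"
  shows "P = Q"
proof -
  obtain x y z where xyz: "x \<in> t" "y \<in> t" "z \<in> t" "x < y" "y < z"
  proof -
    have fin: "finite t" using assms(5) card.infinite by fastforce
    have "Min t \<in> t" "Max t \<in> t" using fin assms(5) by (auto intro!: Min_in Max_in)
    moreover have "\<not> t \<subseteq> {Min t, Max t}"
      using assms(5) card_mono[of "{Min t, Max t}" t] card_insert_le_m1[of 2 "{Max t}" "Min t"] by fastforce
    then obtain y where "y \<in> t" "y \<noteq> Min t" "y \<noteq> Max t" by blast
    moreover from this have "Min t < y" "y < Max t"
      using fin by (metis Min_le le_neq_implies_less, metis Max_ge le_neq_implies_less)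
    ultimately show ?thesis using that by blast
  qed
  obtain a c where ac: "arc a c" "P = below a c" by (rule faceE[OF assms(1)])
  obtain a' c' where ac': "arc a' c'" "Q = below a' c'" by (rule faceE[OF assms(2)])
  have "a = a' \<and> c = c'"
    using below_unique[OF ac(1) ac'(1), of x y z] xyz assms(3,4) ac(2) ac'(2) by auto
  then show ?thesis using ac ac' by simp
qed

end

section \<open>Triangulations and systems of distinct representatives\<close>

context arc_system
begin

lemma below_interior:
  assumes "arc a c" "a + 1 < c"
  obtains b where "b \<in> below a c" "a < b" "b < c"
proof -
  have "a \<in> below a c" "a < c" using below_ends assms by auto
  from below_next[OF assms this] obtain r where r: "r \<in> below a c" "a < r" "(a, r) \<noteq> (a, c)" by blast
  moreover have "r \<le> c" using r below_subset by fastforce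
  ultimately show ?thesis using that[of r] by auto
qed

text \<open>The edges of the face below \<open>(a, c)\<close> other than \<open>(a, c)\<close> itself. An arc is the top edge of one face
  and a lower edge of at most one.\<close>

definition lower_edge :: "nat \<Rightarrow> nat \<Rightarrow> nat \<Rightarrow> nat \<Rightarrow> bool" where
  "lower_edge a c h j \<longleftrightarrow> arc a c \<and> a + 1 < c \<and> h < j \<and> h \<in> below a c \<and> j \<in> below a c \<and>
     (h, j) \<noteq> (a, c) \<and> below a c \<inter> {h<..<j} = {}"

lemma poly_edges_below:
  assumes "arc a c" "a + 1 < c" "p < q"
  shows "{p, q} \<in> poly_edges (below a c) \<longleftrightarrow> (p, q) = (a, c) \<or> lower_edge a c p q"
proof -
  have e: "a \<in> below a c" "c \<in> below a c" "below a c \<subseteq> {a..c}"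
    using below_ends[of a c] below_subset assms by auto
  then have "(p, q) = (a, c)" if "p \<in> below a c" "q \<in> below a c" "below a c \<subseteq> {p..q}"
    using that by fastforce
  then show ?thesis using assms e unfolding lower_edge_def mem_poly_edges[OF assms(3)] by blast
qed

lemma lower_edgeD:
  assumes "lower_edge a c h j"
  shows "arc a c" "a + 1 < c" "arc h j" "a \<le> h" "j \<le> c" "h < j" "(h, j) \<noteq> (a, c)"
    "h \<in> below a c" "j \<in> below a c"
proof -
  show d: "arc a c" "a + 1 < c" "h < j" "(h, j) \<noteq> (a, c)" "h \<in> below a c" "j \<in> below a c"
    using assms unfolding lower_edge_def by blast+
  have "{h, j} \<in> poly_edges (below a c)" using assms d by (simp add: poly_edges_below)
  then show "arc h j" using polygon_arc[OF below_polygon] d by blast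
  show "a \<le> h" "j \<le> c" using d below_subset by fastforce+
qed

lemma lower_edge_unique:
  assumes "lower_edge a c h j" "lower_edge a' c' h j"
  shows "a = a' \<and> c = c'"
proof -
  note d = lower_edgeD[OF assms(1)] and d' = lower_edgeD[OF assms(2)]
  have "a \<le> a' \<and> c' \<le> c \<or> a' \<le> a \<and> c \<le> c'"
    using arcs_nested[OF d(1) d'(1)] d d' by linarith
  moreover have "a = a' \<and> c = c'" if "a \<le> a'" "c' \<le> c" "arc a c" "arc a' c'" "a' \<le> h" "j \<le> c'" "h < j"
      "(h, j) \<noteq> (a', c')" "h \<in> below a c" "j \<in> below a c" for a a' c c'
    using below_hidden[OF that(9) that(4) that(1,2)] below_hidden[OF that(10) that(4) that(1,2)] that
    by (metis Pair_inject le_neq_implies_less order_less_le_trans order.strict_trans1)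
  ultimately show ?thesis using d d' by metis
qed

text \<open>The face above an arc is the face below the shortest arc that encloses it.\<close>

lemma lower_edge_exists:
  assumes hj: "arc h j" "(h, j) \<noteq> (0, n - 1)"
  obtains a c where "lower_edge a c h j"
proof -
  define X where "X = {(a, c). arc a c \<and> a \<le> h \<and> j \<le> c \<and> (a, c) \<noteq> (h, j)}"
  have j: "h < j" "j < n" using hj arc_less arc_bound by auto
  then have "(0, n - 1) \<in> X" unfolding X_def using hj arc_root by auto
  then obtain x where x: "x \<in> X" and min: "\<And>y. y \<in> X \<Longrightarrow> snd x - fst x \<le> snd y - fst y"
    using arg_min_nat_lemma[of "\<lambda>x. x \<in> X" _ "\<lambda>x. snd x - fst x"] by (metis (no_types, lifting))
  obtain a c where xac: "x = (a, c)" by fastforce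
  have ac: "arc a c" "a \<le> h" "j \<le> c" "(a, c) \<noteq> (h, j)" using x xac unfolding X_def by auto
  have min': "c - a \<le> c' - a'" if "arc a' c'" "a' \<le> h" "j \<le> c'" "(a', c') \<noteq> (h, j)" for a' c'
    using min[of "(a', c')"] that xac unfolding X_def by auto
  have small: "(p, q) = (a, c)" if "arc p q" "a \<le> p" "q \<le> c" "p \<le> h" "j \<le> q" "(p, q) \<noteq> (h, j)" for p q
    using min'[OF that(1,4-6)] that ac j by auto
  have "h \<in> below a c"
  proof -
    have False if pq: "arc p q" "a \<le> p" "q \<le> c" "(p, q) \<noteq> (a, c)" "p < h" "h < q" for p q
      using arcs_nested[OF pq(1) hj(1)] pq small[OF pq(1-3)] j ac by auto
    then show ?thesis unfolding below_def using ac j by auto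
  qed
  moreover have "j \<in> below a c"
  proof -
    have False if pq: "arc p q" "a \<le> p" "q \<le> c" "(p, q) \<noteq> (a, c)" "p < j" "j < q" for p q
      using arcs_nested[OF pq(1) hj(1)] pq small[OF pq(1-3)] j ac by auto
    then show ?thesis unfolding below_def using ac j by auto
  qed
  moreover have "below a c \<inter> {h<..<j} = {}"
    using below_hidden[OF _ hj(1) ac(2,3)] ac by auto
  moreover have "a + 1 < c" using ac j by auto
  ultimately have "lower_edge a c h j" unfolding lower_edge_def using ac j by auto
  with that show ?thesis .
qed

lemma polygon_cut:
  assumes Q: "polygon Q" and h: "h \<in> Q" "j \<in> Q" "arc h j"
  shows "polygon (Q \<inter> {h..j})"
proof -
  have hj: "h < j" using h arc_less by blast
  have fin: "finite (Q \<inter> {h..j})" by auto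
  have "card {h, j} \<le> card (Q \<inter> {h..j})" using h hj by (intro card_mono) auto
  moreover have "card {h, j} = 2" using hj by auto
  moreover have "poly_edges (Q \<inter> {h..j}) \<subseteq> sides n \<union> D"
  proof
    fix e assume "e \<in> poly_edges (Q \<inter> {h..j})"
    then obtain p q where e: "e = {p, q}" "p < q" "p \<in> Q \<inter> {h..j}" "q \<in> Q \<inter> {h..j}"
     "Q \<inter> {h..j} \<inter> {p<..<q} = {} \<or> Q \<inter> {h..j} \<subseteq> {p..q}" by (rule poly_edgesE)
    from e(5) show "e \<in> sides n \<union> D"
    proof
      assume "Q \<inter> {h..j} \<inter> {p<..<q} = {}"
      moreover have "{p<..<q} \<subseteq> {h..j}" using e by auto
      ultimately have "Q \<inter> {p<..<q} = {}" by blast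
      then have "{p, q} \<in> poly_edges Q" using e by (simp add: mem_poly_edges)
      then show ?thesis using Q e by (auto simp: polygon_def)
    next
      assume "Q \<inter> {h..j} \<subseteq> {p..q}"
      then have "h \<in> {p..q}" "j \<in> {p..q}" using h hj by auto
      then have "p = h" "q = j" using e by auto
      then show ?thesis using h e by (auto simp: arc_def)
    qed
  qed
  ultimately show ?thesis using fin unfolding polygon_def by auto
qed

text \<open>Otherwise \<open>b\<close> lies under an edge of \<open>Q\<close>, and one of the arcs at \<open>b\<close> crosses that edge.\<close>

lemma polygon_meets_apex:
  assumes Q: "polygon Q" and h: "h \<in> Q" "j \<in> Q" and b: "h < b" "b < j" "arc h b" "arc b j"
    and ne: "Q \<inter> {h<..<j} \<noteq> {}"
  shows "b \<in> Q"
proof (rule ccontr)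
  assume n: "b \<notin> Q"
  from poly_gap[OF Q n h b(1,2)] obtain p q where
    pq: "p < b" "b < q" "arc p q" "Q \<inter> {p<..<q} = {}" "h \<le> p" "q \<le> j" by metis
  have "\<not> h < p" using arc_noncrossing[OF b(3) pq(3)] pq by blast
  moreover have "\<not> q < j" using arc_noncrossing[OF pq(3) b(4)] pq by blast
  ultimately have "p = h" "q = j" using pq by auto
  then show False using ne pq by simp
qed

lemma finite_faces: "finite (faces n D)"
  by (rule finite_subset[of _ "Pow {0..<n}"]) (auto simp: faces_def)

end

text \<open>A system of distinct representatives of the members of \<open>X\<close>.\<close>

definition transversal :: "'a set \<Rightarrow> 'a set set \<Rightarrow> bool" where
  "transversal I X \<longleftrightarrow> (\<exists>\<phi>. bij_betw \<phi> I X \<and> (\<forall>i\<in>I. i \<in> \<phi> i))"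

lemma transversal_card: "transversal I X \<Longrightarrow> card I = card X"
  unfolding transversal_def using bij_betw_same_card by blast

lemma transversal_empty: "transversal {} {}"
  unfolding transversal_def by (auto simp: bij_betw_def)

lemma transversal_single: "w \<in> t \<Longrightarrow> transversal {w} {t}"
  unfolding transversal_def by (intro exI[of _ "\<lambda>_. t"]) (auto simp: bij_betw_def)

lemma transversal_Un:
  assumes "transversal I X" "transversal J Y" "I \<inter> J = {}" "X \<inter> Y = {}"
  shows "transversal (I \<union> J) (X \<union> Y)"
proof -
  obtain f g where f: "bij_betw f I X" "\<forall>i\<in>I. i \<in> f i" and g: "bij_betw g J Y" "\<forall>i\<in>J. i \<in> g i"
    using assms unfolding transversal_def by blast
  define k where "k = (\<lambda>i. if i \<in> I then f i else g i)"
  have "bij_betw k I X" using f(1) by (rule bij_betw_cong[THEN iffD1, rotated]) (auto simp: k_def)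
  moreover have "bij_betw k J Y"
    using g(1) by (rule bij_betw_cong[THEN iffD1, rotated]) (use assms(3) in \<open>auto simp: k_def\<close>)
  ultimately have "bij_betw k (I \<union> J) (X \<union> Y)" using assms(4) by (rule bij_betw_combine)
  moreover have "\<forall>i\<in>I \<union> J. i \<in> k i" using f g by (auto simp: k_def)
  ultimately show ?thesis unfolding transversal_def by blast
qed

lemma transversal_UN:
  assumes "finite F" "\<And>P. P \<in> F \<Longrightarrow> transversal (I P) (X P)"
    and "\<And>P Q. P \<in> F \<Longrightarrow> Q \<in> F \<Longrightarrow> P \<noteq> Q \<Longrightarrow> I P \<inter> I Q = {}"
    and "\<And>P Q. P \<in> F \<Longrightarrow> Q \<in> F \<Longrightarrow> P \<noteq> Q \<Longrightarrow> X P \<inter> X Q = {}"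
  shows "transversal (\<Union>P\<in>F. I P) (\<Union>P\<in>F. X P)"
  using assms
proof (induction F rule: finite_induct)
  case empty
  then show ?case by (simp add: transversal_empty)
next
  case (insert P F)
  have "transversal (I P \<union> (\<Union>P\<in>F. I P)) (X P \<union> (\<Union>P\<in>F. X P))"
  proof (rule transversal_Un)
    show "transversal (I P) (X P)" using insert.prems by auto
    show "transversal (\<Union>P\<in>F. I P) (\<Union>P\<in>F. X P)" using insert.prems by (intro insert.IH) auto
    show "I P \<inter> (\<Union>P\<in>F. I P) = {}" using insert.prems(2)[of P] insert.hyps by blast
    show "X P \<inter> (\<Union>P\<in>F. X P) = {}" using insert.prems(3)[of P] insert.hyps by blast
  qed
  then show ?case by simp
qed

definition count_in :: "nat set set \<Rightarrow> nat \<Rightarrow> nat \<Rightarrow> nat" where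
  "count_in B h j = card {t \<in> B. t \<subseteq> {h..j}}"

locale triangulated = arc_system +
  assumes faces3: "\<And>P. P \<in> faces n D \<Longrightarrow> card P = 3"
begin

definition tri :: "nat \<Rightarrow> nat \<Rightarrow> nat \<Rightarrow> bool" where
  "tri a b c \<longleftrightarrow> arc a c \<and> a < b \<and> b < c \<and> below a c = {a, b, c}"

lemma triE:
  assumes "arc a c" "a + 1 < c"
  obtains b where "tri a b c"
proof -
  obtain b where b: "b \<in> below a c" "a < b" "b < c" using below_interior[OF assms] .
  have "{a, b, c} \<subseteq> below a c" using b below_ends[of a c] by auto
  moreover have "card {a, b, c} = 3" using b by auto
  moreover have "card (below a c) = 3" using faces3 below_face assms by blast
  ultimately have "below a c = {a, b, c}" using card_subset_eq[OF finite_below] by metis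
  with b assms that show ?thesis unfolding tri_def by blast
qed

lemma tri_face: "tri a b c \<Longrightarrow> {a, b, c} \<in> faces n D"
  using below_face[of a c] unfolding tri_def by auto

lemma faceE_tri:
  assumes "P \<in> faces n D"
  obtains a b c where "tri a b c" "P = {a, b, c}"
proof -
  obtain a c where ac: "arc a c" "a + 1 < c" "P = below a c" by (rule faceE[OF assms])
  then obtain b where "tri a b c" using triE by blast
  with ac that show ?thesis unfolding tri_def by auto
qed

lemma tri_lower_edge:
  assumes "tri a b c"
  shows "lower_edge a c h j \<longleftrightarrow> h = a \<and> j = b \<or> h = b \<and> j = c"
  using assms unfolding tri_def lower_edge_def by auto

lemma triD:
  assumes "tri a b c"
  shows "a < b" "b < c" "arc a c" "arc a b" "arc b c" "below a c = {a, b, c}" "c < n"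
  using assms lower_edgeD(3)[of a c a b] lower_edgeD(3)[of a c b c] arc_bound[of a c]
  by (auto simp: tri_lower_edge) (auto simp: tri_def)

lemma tri_unique: "tri a b c \<Longrightarrow> tri a b' c \<Longrightarrow> b = b'"
  unfolding tri_def by auto

lemma tri_eq:
  assumes "tri a b c" "tri a' b' c'" "{a, b, c} = {a', b', c'}"
  shows "a = a'" "b = b'" "c = c'"
proof -
  have "Min {a, b, c} = a" "Min {a', b', c'} = a'" "Max {a, b, c} = c" "Max {a', b', c'} = c'"
    using triD(1,2)[OF assms(1)] triD(1,2)[OF assms(2)] by (auto simp: min_def max_def)
  then show "a = a'" "c = c'" using assms(3) by auto
  then show "b = b'" using assms tri_unique by blast
qed

lemma tri_hidden:
  assumes "tri a b c" "arc p q" "a \<le> p" "q \<le> c" "(p, q) \<noteq> (a, c)"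
  shows "q \<le> b \<or> b \<le> p"
  using below_hidden[of b a c p q] triD[OF assms(1)] assms by (metis insertI1 insertI2 not_le)

text \<open>Black triangles can thus be indexed by their middle vertices. Of two triangles with the same middle
  vertex one top edge would lie under the other and hide that vertex.\<close>

lemma tri_mid_unique:
  assumes "tri a b c" "tri a' b c'"
  shows "a = a' \<and> c = c'"
proof -
  note d = triD[OF assms(1)] and d' = triD[OF assms(2)]
  have "a \<le> a' \<and> c' \<le> c \<or> a' \<le> a \<and> c \<le> c'"
    using arcs_nested[OF d(3) d'(3)] d d' by linarith
  then show ?thesis
    using tri_hidden[OF assms(1) d'(3)] tri_hidden[OF assms(2) d(3)] d d' by force
qed

lemma count_in_Suc:
  assumes "B \<subseteq> faces n D"
  shows "count_in B i (i + 1) = 0"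
proof -
  have "\<not> t \<subseteq> {i..i + 1}" if "t \<in> B" for t
  proof
    assume "t \<subseteq> {i..i + 1}"
    then have "card t \<le> card {i..i + 1}" by (intro card_mono) auto
    moreover have "card t = 3" using that assms faces3 by blast
    ultimately show False by simp
  qed
  then have "{t \<in> B. t \<subseteq> {i..i + 1}} = {}" by blast
  then show ?thesis unfolding count_in_def by simp
qed

lemma count_in_root:
  assumes "B \<subseteq> faces n D"
  shows "count_in B 0 (n - 1) = card B"
proof -
  have "{t \<in> B. t \<subseteq> {0..n - 1}} = B" using assms unfolding faces_def by fastforce
  then show ?thesis unfolding count_in_def by simp
qed

lemma faces_split:
  assumes t: "tri h x j" and s: "s \<in> faces n D" "s \<subseteq> {h..j}" "s \<noteq> {h, x, j}"
  shows "s \<subseteq> {h..x} \<or> s \<subseteq> {x..j}"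
proof -
  obtain a b c where abc: "tri a b c" "s = {a, b, c}" by (rule faceE_tri[OF s(1)])
  note d = triD[OF abc(1)]
  have "(a, c) \<noteq> (h, j)" using abc s(3) t tri_unique by blast
  moreover have "h \<le> a" "c \<le> j" using s(2) abc(2) by auto
  ultimately have "c \<le> x \<or> x \<le> a" using tri_hidden[OF t d(3)] by blast
  then show ?thesis unfolding abc(2) using \<open>h \<le> a\<close> \<open>c \<le> j\<close> d(1,2) by auto
qed

text \<open>The recursion for the area, along which both images are described by induction.\<close>

lemma count_in_tri:
  assumes B: "B \<subseteq> faces n D" and t: "tri h x j"
  shows "count_in B h j = count_in B h x + count_in B x j + of_bool ({h, x, j} \<in> B)"
proof -
  note d = triD[OF t]
  have fin: "finite B" using B finite_faces finite_subset by blast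
  let ?L = "{t \<in> B. t \<subseteq> {h..x}}" and ?R = "{t \<in> B. t \<subseteq> {x..j}}" and ?M = "{t \<in> B. t = {h, x, j}}"
  have "{t \<in> B. t \<subseteq> {h..j}} = ?L \<union> ?R \<union> ?M"
  proof
    show "{t \<in> B. t \<subseteq> {h..j}} \<subseteq> ?L \<union> ?R \<union> ?M" using faces_split[OF t] B by blast
    have "{h..x} \<subseteq> {h..j}" "{x..j} \<subseteq> {h..j}" "{h, x, j} \<subseteq> {h..j}" using d by auto
    then show "?L \<union> ?R \<union> ?M \<subseteq> {t \<in> B. t \<subseteq> {h..j}}" by auto
  qed
  moreover have "?L \<inter> ?R = {}"
  proof -
    have False if "t \<in> B" "t \<subseteq> {h..x}" "t \<subseteq> {x..j}" for t
    proof -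
      have "t \<subseteq> {x}" using that by fastforce
      then have "card t \<le> 1" using card_mono[of "{x}" t] by auto
      moreover have "card t = 3" using that B faces3 by blast
      ultimately show False by simp
    qed
    then show ?thesis by blast
  qed
  moreover have "(?L \<union> ?R) \<inter> ?M = {}"
  proof -
    have "\<not> {h, x, j} \<subseteq> {h..x}" "\<not> {h, x, j} \<subseteq> {x..j}" using d by auto
    then show ?thesis by blast
  qed
  moreover have "card ?M = of_bool ({h, x, j} \<in> B)"
  proof (cases "{h, x, j} \<in> B")
    case True then have "?M = {{h, x, j}}" by blast
    then show ?thesis using True by simp
  next
    case False
    then have M: "?M = {}" by blast
    show ?thesis unfolding M using False by simp
  qed
  ultimately show ?thesis unfolding count_in_def using fin by (simp add: card_Un_disjoint)
qed

text \<open>Cut \<open>Q\<close> along the triangle below its longest edge \<open>(a, c)\<close>, with apex \<open>b\<close>. Each half has to leave out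
  two of its vertices as well; they are chosen so that exactly one corner of the triangle remains to
  represent it: \<open>c\<close> if both omitted vertices are left of \<open>b\<close>, \<open>a\<close> if both are right of it, \<open>b\<close> otherwise.\<close>

lemma polygon_transversal_less:
  assumes "polygon Q" "u \<in> Q" "v \<in> Q" "u < v"
  shows "transversal (Q - {u, v}) {t \<in> faces n D. t \<subseteq> Q}"
  using assms
proof (induction "card Q" arbitrary: Q u v rule: less_induct)
  case less
  note Q = less.prems(1)
  obtain a c where e: "a \<in> Q" "c \<in> Q" "a < c" "Q \<subseteq> {a..c}" "arc a c"
    using polygon_ends[OF Q] by blast
  have fin: "finite Q" using Q by (auto simp: polygon_def)
  show ?case
  proof (cases "Q \<inter> {a<..<c} = {}")
    case True
    have Q2: "Q \<subseteq> {a, c}"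
    proof
      fix x assume x: "x \<in> Q"
      then have "a \<le> x" "x \<le> c" using e(4) by auto
      moreover have "\<not> (a < x \<and> x < c)" using True x by auto
      ultimately show "x \<in> {a, c}" by auto
    qed
    have "\<not> t \<subseteq> Q" if "t \<in> faces n D" for t
    proof
      assume "t \<subseteq> Q"
      then have "card t \<le> card {a, c}" using Q2 by (intro card_mono) auto
      also have "\<dots> \<le> 2" by (simp add: card_insert_if)
      finally show False using faces3[OF that] by simp
    qed
    then have "{t \<in> faces n D. t \<subseteq> Q} = {}" by blast
    moreover have "Q - {u, v} = {}" using Q2 less.prems(2-4) by auto
    ultimately show ?thesis by (metis transversal_empty)
  next
    case False
    have "a + 1 < c" using False by auto
    then obtain b where t: "tri a b c" using triE e by blast
    note d = triD[OF t]
    have bQ: "b \<in> Q" using polygon_meets_apex[OF Q e(1,2) d(1,2,4,5) False] .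
    define Q1 Q2 where "Q1 = Q \<inter> {a..b}" and "Q2 = Q \<inter> {b..c}"
    have p: "polygon Q1" "polygon Q2" unfolding Q1_def Q2_def
      using polygon_cut[OF Q e(1) bQ d(4)] polygon_cut[OF Q bQ e(2) d(5)] by auto
    have "c \<notin> Q1" "a \<notin> Q2" using d unfolding Q1_def Q2_def by auto
    then have "Q1 \<subset> Q" "Q2 \<subset> Q" using e(1,2) unfolding Q1_def Q2_def by blast+
    then have c: "card Q1 < card Q" "card Q2 < card Q" using fin by (simp_all add: psubset_card_mono)
    have QU: "Q = Q1 \<union> Q2" "Q1 \<inter> Q2 = {b}" using e(4) bQ d unfolding Q1_def Q2_def by auto
    have in12: "a \<in> Q1" "b \<in> Q1" "b \<in> Q2" "c \<in> Q2" using e d bQ unfolding Q1_def Q2_def by auto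
    have tT: "{a, b, c} \<in> faces n D" using tri_face t .
    let ?A = "{s \<in> faces n D. s \<subseteq> Q}" and ?M = "{{a, b, c}}"
      and ?L = "{s \<in> faces n D. s \<subseteq> Q1}" and ?R = "{s \<in> faces n D. s \<subseteq> Q2}"
    have sub: "Q1 \<subseteq> Q" "Q2 \<subseteq> Q" "{a, b, c} \<subseteq> Q" using QU e(1,2) bQ by auto
    have FF: "?A = ?M \<union> (?L \<union> ?R)"
    proof
      show "?A \<subseteq> ?M \<union> (?L \<union> ?R)"
      proof
        fix s assume "s \<in> ?A"
        then have s: "s \<in> faces n D" "s \<subseteq> Q" by auto
        then have "s \<subseteq> {a..c}" using e(4) by blast
        then have "s = {a, b, c} \<or> s \<subseteq> {a..b} \<or> s \<subseteq> {b..c}" using faces_split[OF t s(1)] by blast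
        then show "s \<in> ?M \<union> (?L \<union> ?R)" using s unfolding Q1_def Q2_def by auto
      qed
      show "?M \<union> (?L \<union> ?R) \<subseteq> ?A" using tT sub by auto
    qed
    have D12: "?L \<inter> ?R = {}"
    proof -
      have False if "t \<in> faces n D" "t \<subseteq> Q1" "t \<subseteq> Q2" for t
      proof -
        have "t \<subseteq> {b}" using that QU by blast
        then have "card t \<le> 1" using card_mono[of "{b}" t] by auto
        then show False using faces3[OF that(1)] by simp
      qed
      then show ?thesis by blast
    qed
    have D0: "?M \<inter> (?L \<union> ?R) = {}" using \<open>c \<notin> Q1\<close> \<open>a \<notin> Q2\<close> by auto
    have glue: ?thesis if w: "w \<in> {a, b, c}" "u1 \<in> Q1" "v1 \<in> Q1" "u1 < v1" "u2 \<in> Q2" "v2 \<in> Q2" "u2 < v2"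
      and eq: "Q - {u, v} = {w} \<union> ((Q1 - {u1, v1}) \<union> (Q2 - {u2, v2}))"
      and dj: "w \<notin> Q1 - {u1, v1}" "w \<notin> Q2 - {u2, v2}" "b \<notin> (Q1 - {u1, v1}) \<inter> (Q2 - {u2, v2})"
    for w u1 v1 u2 v2
    proof -
      have "transversal ({w} \<union> ((Q1 - {u1, v1}) \<union> (Q2 - {u2, v2}))) (?M \<union> (?L \<union> ?R))"
      proof (rule transversal_Un[OF transversal_single[OF w(1)] transversal_Un])
        show "transversal (Q1 - {u1, v1}) ?L" using less.hyps[OF c(1) p(1)] w by blast
        show "transversal (Q2 - {u2, v2}) ?R" using less.hyps[OF c(2) p(2)] w by blast
      qed (use D12 D0 dj QU in blast)+
      then show ?thesis by (simp only: eq FF)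
    qed
    have ab: "a < b" "b < c" using d by auto
    have mem1: "x \<in> Q1" if "x \<in> Q" "x \<le> b" for x using that e(4) unfolding Q1_def by auto
    have mem2: "x \<in> Q2" if "x \<in> Q" "b \<le> x" for x using that e(4) unfolding Q2_def by auto
    have le1: "x \<le> b" if "x \<in> Q1" for x using that unfolding Q1_def by auto
    have le2: "b \<le> x" if "x \<in> Q2" for x using that unfolding Q2_def by auto
    consider "v \<le> b" | "b \<le> u" | "u < b" "b < v" by linarith
    then show ?thesis
    proof cases
      case 1
      have u: "u \<in> Q1" "v \<in> Q1" "u \<notin> Q2" using mem1[of u] mem1[of v] le2[of u] 1 less.prems by auto
      have v: "v = b" if "v \<in> Q2" using le2[OF that] 1 by simp
      have "Q - {u, v} = {c} \<union> ((Q1 - {u, v}) \<union> (Q2 - {b, c}))"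
        using QU in12 u v \<open>c \<notin> Q1\<close> by blast
      then show ?thesis using glue[of c u v b c] ab in12 less.prems(4) u \<open>c \<notin> Q1\<close> by blast
    next
      case 2
      have u: "u \<in> Q2" "v \<in> Q2" "v \<notin> Q1" using mem2[of u] mem2[of v] le1[of v] 2 less.prems by auto
      have v: "u = b" if "u \<in> Q1" using le1[OF that] 2 by simp
      have "Q - {u, v} = {a} \<union> ((Q1 - {a, b}) \<union> (Q2 - {u, v}))"
        using QU in12 u v \<open>a \<notin> Q2\<close> by blast
      then show ?thesis using glue[of a a b u v] ab in12 less.prems(4) u \<open>a \<notin> Q2\<close> by blast
    next
      case 3
      have u: "u \<in> Q1" "v \<in> Q2" "v \<notin> Q1" "u \<notin> Q2"
        using 3 less.prems mem1[of u] mem2[of v] le1[of v] le2[of u] by auto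
      have "Q - {u, v} = {b} \<union> ((Q1 - {u, b}) \<union> (Q2 - {b, v}))"
        using QU in12 u 3 by blast
      then show ?thesis using glue[of b u b b v] 3 in12 u by blast
    qed
  qed
qed

lemma polygon_transversal:
  assumes "polygon Q" "u \<in> Q" "v \<in> Q" "u \<noteq> v"
  shows "transversal (Q - {u, v}) {t \<in> faces n D. t \<subseteq> Q}"
  using polygon_transversal_less[OF assms(1), of u v] polygon_transversal_less[OF assms(1), of v u] assms
  by (cases "u < v") (auto simp: insert_commute)

end

section \<open>Coarsening a bicolored triangulation\<close>

context arc_system
begin

lemma edge_faces:
  assumes "P \<in> faces n D" "{h, j} \<in> poly_edges P" "h < j"
  obtains "P = below h j" "h + 1 < j" "arc h j" | a c where "P = below a c" "lower_edge a c h j"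
proof -
  obtain a c where ac: "arc a c" "a + 1 < c" "P = below a c" by (rule faceE[OF assms(1)])
  then have "(h, j) = (a, c) \<or> lower_edge a c h j" using assms poly_edges_below by blast
  then show ?thesis using that ac by auto
qed

lemma face_diag: "P \<in> faces n D \<Longrightarrow> d \<in> D \<Longrightarrow> d \<subseteq> P \<Longrightarrow> d \<in> poly_edges P"
  by (simp add: faces_def)

lemma below_edge_top: "arc a c \<Longrightarrow> a + 1 < c \<Longrightarrow> {a, c} \<in> poly_edges (below a c)"
  using arc_less by (simp add: poly_edges_below)

lemma lower_edge_poly_edge: "lower_edge a c h j \<Longrightarrow> {h, j} \<in> poly_edges (below a c)"
  using lower_edgeD(1,2,6) by (simp add: poly_edges_below)

lemma below_neq_lower_edge:
  assumes "lower_edge a c h j"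
  shows "below h j \<noteq> below a c"
proof
  assume "below h j = below a c"
  then have "h = a \<and> j = c" using lower_edgeD[OF assms] by (intro below_inj) auto
  with lower_edgeD(7)[OF assms] show False by simp
qed

text \<open>A diagonal lies on exactly two faces, the one below it and the one of which it is a lower edge.\<close>

lemma unicolored_iff:
  assumes d: "h + 1 < j" "lower_edge a c h j"
  shows "{h, j} \<in> unicolored_diags n \<lparr>diags = D, blacks = B\<rparr> \<longleftrightarrow> (below h j \<in> B \<longleftrightarrow> below a c \<in> B)"
proof -
  note l = lower_edgeD[OF d(2)]
  have "(h, j) \<noteq> (0, n - 1)" using l arc_bound[OF l(1)] by auto
  then have D: "{h, j} \<in> D" using arc_diag l d by blast
  have f: "below h j \<in> faces n D" "below a c \<in> faces n D" using below_face l d by auto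
  have e: "{h, j} \<in> poly_edges (below h j)" "{h, j} \<in> poly_edges (below a c)"
    using below_edge_top lower_edge_poly_edge l d by auto
  have only: "s = below h j \<or> s = below a c" if "s \<in> faces n D" "{h, j} \<in> poly_edges s" for s
    using edge_faces[OF that l(6)] lower_edge_unique[OF d(2)] by metis
  show ?thesis
  proof
    assume "{h, j} \<in> unicolored_diags n \<lparr>diags = D, blacks = B\<rparr>"
    then obtain s t where st: "s \<in> faces n D" "t \<in> faces n D" "s \<noteq> t"
      "{h, j} \<in> poly_edges s" "{h, j} \<in> poly_edges t" "s \<in> B \<longleftrightarrow> t \<in> B"
      unfolding unicolored_diags_def by auto
    then show "below h j \<in> B \<longleftrightarrow> below a c \<in> B" using only[of s] only[of t] by auto
  next
    assume "below h j \<in> B \<longleftrightarrow> below a c \<in> B"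
    then show "{h, j} \<in> unicolored_diags n \<lparr>diags = D, blacks = B\<rparr>"
      unfolding unicolored_diags_def using D f e below_neq_lower_edge[OF d(2)] by auto
  qed
qed

text \<open>In a face with two vertices \<open>b < b'\<close> strictly between the ends \<open>a\<close>, \<open>c\<close> of its longest edge, the arc
  from \<open>a\<close> to \<open>b'\<close> could be added.\<close>

lemma maximal_triangulated:
  assumes max: "\<And>d. noncrossing_diagonals n (insert d D) \<Longrightarrow> d \<in> D"
  shows "triangulated n D"
proof
  fix P assume P: "P \<in> faces n D"
  obtain a c where ac: "arc a c" "a + 1 < c" "P = below a c" by (rule faceE[OF P])
  show "card P = 3"
  proof (rule ccontr)
    assume "card P \<noteq> 3"
    then have c4: "4 \<le> card P" using P unfolding faces_def by auto
    have "card P \<le> card (P - {a, c}) + 2"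
      using diff_card_le_card_Diff[of "{a, c}" P] ac(2) by auto
    then have c2: "2 \<le> card (P - {a, c})" using c4 by auto
    then obtain X where X: "X \<subseteq> P - {a, c}" "card X = 2" by (rule obtain_subset_with_card_n)
    then obtain u v where "X = {u, v}" "u \<noteq> v" by (auto simp: card_2_iff)
    then obtain b b' where "X = {b, b'}" "b < b'" by (metis insert_commute linorder_neqE_nat)
    then have b: "b \<in> P - {a, c}" "b' \<in> P - {a, c}" "b < b'" using X by auto
    have r: "a < b" "b' < c" using b ac below_subset by fastforce+
    have hid: False if "arc p q" "a \<le> p" "q \<le> c" "(p, q) \<noteq> (a, c)" "p < v" "v < q" "v \<in> P" for p q v
      using below_hidden that ac by blast
    have nodiag: "\<not> arc a b'" using hid[of a b' b] b r ac(2) by auto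
    have noncr: "\<not> crosses {a, b'} d" if d: "d \<in> D" for d
    proof
      assume cr: "crosses {a, b'} d"
      obtain p q where pq: "d = {p, q}" "arc p q" by (rule diagE[OF d])
      have "p < q" using pq arc_less by blast
      then have "a < p \<and> p < b' \<and> b' < q \<or> p < a \<and> a < q \<and> q < b'"
        using cr pq b r by (auto simp: crosses_iff)
      then show False
      proof
        assume x: "a < p \<and> p < b' \<and> b' < q"
        then have "q \<le> c" using arcs_nested[OF ac(1) pq(2)] r by auto
        then show False using hid[OF pq(2), of b'] x b by auto
      next
        assume "p < a \<and> a < q \<and> q < b'"
        then show False using arc_noncrossing[OF pq(2) ac(1)] r by auto
      qed
    qed
    have ns: "\<not> crosses {a, b'} {a, b'}" using b r by (simp add: crosses_iff)
    have ab: "a < b'" "b' < n" using b r arc_bound[OF ac(1)] by auto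
    then have "{a, b'} \<in> arcs n" unfolding arcs_def by blast
    moreover have "{a, b'} \<notin> sides n" using nodiag ab unfolding arc_def by auto
    ultimately have "{a, b'} \<in> arcs n - sides n" by blast
    then have "noncrossing_diagonals n (insert {a, b'} D)"
      using noncrossing noncr ns crosses_sym unfolding noncrossing_diagonals_def by blast
    then have "{a, b'} \<in> D" using max by blast
    then show False using nodiag b r unfolding arc_def by auto
  qed
qed

end

lemma noncrossing_extends_to_triangulation:
  assumes "3 \<le> n" "noncrossing_diagonals n D"
  obtains D' where "D \<subseteq> D'" "triangulated n D'"
proof -
  have fin: "finite (arcs n)"
    by (rule finite_subset[of _ "Pow {0..<n}"]) (auto simp: arcs_def)
  let ?X = "{E. D \<subseteq> E \<and> noncrossing_diagonals n E}"
  have sub: "E \<subseteq> arcs n" if "E \<in> ?X" for E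
    using that unfolding noncrossing_diagonals_def by auto
  then have "finite ?X" using fin by (meson finite_Pow_iff finite_subset Pow_iff subsetI)
  moreover have "D \<in> ?X" using assms by auto
  ultimately obtain E where E: "E \<in> ?X" "\<forall>F\<in>?X. E \<subseteq> F \<longrightarrow> E = F"
    using finite_has_maximal[of ?X] by blast
  interpret arc_system n E using E assms by unfold_locales auto
  have "triangulated n E"
  proof (rule maximal_triangulated)
    fix d assume d: "noncrossing_diagonals n (insert d E)"
    then have "insert d E \<in> ?X" using E by auto
    then show "d \<in> E" using E(2) by blast
  qed
  then show ?thesis using that E by auto
qed

text \<open>A triangulation with diagonals \<open>D\<close> that refines the dissection \<open>D0\<close>; notions of the latter carry
  the prefix \<open>S\<close>.\<close>

locale refined = triangulated +
  fixes D0 :: "nat set set"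
  assumes D0_sub: "D0 \<subseteq> D"
begin

sublocale S: arc_system n D0
  using n3 noncrossing D0_sub unfolding noncrossing_diagonals_def
  by unfold_locales (auto simp: noncrossing_diagonals_def)

lemma S_arc: "S.arc p q \<Longrightarrow> arc p q"
  using D0_sub unfolding S.arc_def arc_def by auto

lemma S_polygon: "S.polygon P \<Longrightarrow> polygon P"
  using D0_sub unfolding S.polygon_def polygon_def by auto

lemma S_face_polygon: "P \<in> faces n D0 \<Longrightarrow> polygon P"
  using S.face_polygon S_polygon by blast

text \<open>The face below the shortest arc of \<open>D0\<close> that spans the triangle: an arc of \<open>D0\<close> hiding one of its
  vertices would span it as well or cut through it.\<close>

lemma parent_face:
  assumes "t \<in> faces n D"
  obtains P where "P \<in> faces n D0" "t \<subseteq> P"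
proof -
  obtain a b c where t: "tri a b c" "t = {a, b, c}" by (rule faceE_tri[OF assms])
  note d = triD[OF t(1)]
  define X where "X = {(x, z). S.arc x z \<and> x \<le> a \<and> c \<le> z}"
  have "(0, n - 1) \<in> X" using S.arc_root d unfolding X_def by auto
  then obtain y where y: "y \<in> X" and min: "\<And>w. w \<in> X \<Longrightarrow> snd y - fst y \<le> snd w - fst w"
    using arg_min_nat_lemma[of "\<lambda>x. x \<in> X" _ "\<lambda>x. snd x - fst x"] by (metis (no_types, lifting))
  obtain x z where "y = (x, z)" by fastforce
  then have xz: "S.arc x z" "x \<le> a" "c \<le> z"
    and min': "\<And>p q. S.arc p q \<Longrightarrow> p \<le> a \<Longrightarrow> c \<le> q \<Longrightarrow> z - x \<le> q - p"
    using y min unfolding X_def by fastforce+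
  have hid: False if pq: "S.arc p q" "x \<le> p" "q \<le> z" "(p, q) \<noteq> (x, z)" "p < v" "v < q"
    and v: "v \<in> {a, b, c}" for p q v
  proof -
    have v': "a \<le> v" "v \<le> c" using v d by auto
    have "p \<le> a \<and> c \<le> q \<or> a \<le> p \<and> q \<le> c"
      using arcs_nested[OF S_arc[OF pq(1)] d(3)] v' pq by linarith
    moreover have "\<not> (p \<le> a \<and> c \<le> q)" using min'[OF pq(1)] pq by auto
    ultimately have pq': "a \<le> p" "q \<le> c" "(p, q) \<noteq> (a, c)" by auto
    then have "v = b" using v pq by auto
    moreover have "q \<le> b \<or> b \<le> p" using tri_hidden[OF t(1) S_arc[OF pq(1)]] pq' by blast
    ultimately show False using pq by auto
  qed
  have "{a, b, c} \<subseteq> S.below x z"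
  proof
    fix v assume v: "v \<in> {a, b, c}"
    then have "v \<in> {x..z}" using xz d by auto
    then show "v \<in> S.below x z" unfolding S.below_def using hid[OF _ _ _ _ _ _ v] by blast
  qed
  moreover have "S.below x z \<in> faces n D0" using S.below_face xz d by auto
  ultimately show ?thesis using that t by blast
qed

lemma parent_unique:
  assumes "t \<in> faces n D" "P \<in> faces n D0" "Q \<in> faces n D0" "t \<subseteq> P" "t \<subseteq> Q"
  shows "P = Q"
  using S.face_unique[OF assms(2-5)] faces3[OF assms(1)] by simp

lemma apex_in_face:
  assumes P: "P \<in> faces n D0" and t: "tri h b j" and h: "h \<in> P" "j \<in> P" "P \<inter> {h<..<j} \<noteq> {}"
  shows "{h, b, j} \<subseteq> P"
  using polygon_meets_apex[OF S_face_polygon[OF P] h(1,2), of b] triD[OF t] h by auto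

text \<open>An end of the upper triangle outside \<open>P\<close> would be cut off by an edge of \<open>P\<close>, which a side of that
  triangle would have to cross. Hence colours spread through a face across its inner diagonals.\<close>

lemma neighbour_in_face:
  assumes P: "P \<in> faces n D0" and h: "h \<in> P" "j \<in> P" "(h, j) \<noteq> (Min P, Max P)"
    and up: "lower_edge a c h j" and ne: "P \<inter> {h<..<j} \<noteq> {}"
  shows "a \<in> P \<and> c \<in> P"
proof -
  have Q: "polygon P" using P S_face_polygon by blast
  obtain a0 c0 where e: "a0 = Min P" "c0 = Max P" by blast
  note pe = polygon_ends[OF Q, folded e]
  note l = lower_edgeD[OF up]
  obtain x where x: "tri a x c" using triE l by blast
  note d = triD[OF x]
  have "h \<in> {a0..c0}" "j \<in> {a0..c0}" using pe(4) h(1,2) by blast+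
  then have hj: "a0 \<le> h" "j \<le> c0" "h < j" "(h, j) \<noteq> (a0, c0)" using h(3) l(6) e by auto
  consider "h = a" "j = x" | "h = x" "j = c" using up tri_lower_edge[OF x, of h j] by auto
  then show ?thesis
  proof cases
    case 1
    have "c \<le> c0"
    proof (rule ccontr)
      assume n: "\<not> c \<le> c0"
      have "h = a0" using arc_noncrossing[OF pe(5) d(3)] n hj 1 by (metis le_neq_implies_less not_le order_less_le_trans)
      then show False using arc_noncrossing[OF pe(5) d(5)] n hj 1 by auto
    qed
    have "c \<in> P"
    proof (rule ccontr)
      assume n: "c \<notin> P"
      then have "c < c0" using \<open>c \<le> c0\<close> pe by (metis le_neq_implies_less)
      from poly_gap[OF Q n h(2) pe(2) _ this] obtain p q where
        "p < c" "c < q" "arc p q" "j \<le> p" using d 1 by metis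
      then show False using arc_noncrossing[OF d(3), of p q] hj 1 by auto
    qed
    then show ?thesis using h 1 by auto
  next
    case 2
    have "a0 \<le> a"
    proof (rule ccontr)
      assume n: "\<not> a0 \<le> a"
      have "j = c0" using arc_noncrossing[OF d(3) pe(5)] n hj 2 by (metis le_neq_implies_less not_le order_le_less_trans)
      then show False using arc_noncrossing[OF d(4) pe(5)] n hj 2 by auto
    qed
    have "a \<in> P"
    proof (rule ccontr)
      assume n: "a \<notin> P"
      then have "a0 < a" using \<open>a0 \<le> a\<close> pe by (metis le_neq_implies_less)
      from poly_gap[OF Q n pe(1) h(1) this] obtain p q where
        "p < a" "a < q" "arc p q" "q \<le> h" using d 2 by metis
      then show False using arc_noncrossing[OF _ d(3), of p q] hj 2 by auto
    qed
    then show ?thesis using h 2 by auto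
  qed
qed

text \<open>The two triangles at a diagonal of \<open>D0\<close> lie in the two faces at that diagonal.\<close>

lemma parents_across_diagonal:
  assumes S: "S.lower_edge a c h j" and hj: "h + 1 < j" and up: "lower_edge a' c' h j"
  shows "below h j \<subseteq> S.below h j" "below a' c' \<subseteq> S.below a c"
proof -
  note s = S.lower_edgeD[OF S] and l = lower_edgeD[OF up]
  have "(h, j) \<noteq> (0, n - 1)" using s S.arc_bound[OF s(1)] by auto
  then have D0: "{h, j} \<in> D0" using S.arc_diag s hj by blast
  obtain b where b: "tri h b j" using triE l hj by blast
  have "S.below h j \<inter> {h<..<j} \<noteq> {}" using S.below_interior[OF s(3) hj] by (metis IntI empty_iff greaterThanLessThan_iff)
  then have "{h, b, j} \<subseteq> S.below h j"
    using apex_in_face[OF S.below_face[OF s(3) hj] b] S.below_ends[of h j] s by auto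
  then show "below h j \<subseteq> S.below h j" using triD[OF b] by simp
  have "below a' c' \<in> faces n D" using below_face l by blast
  then obtain P where P: "P \<in> faces n D0" "below a' c' \<subseteq> P" by (rule parent_face)
  moreover have "{h, j} \<subseteq> below a' c'" using l by auto
  ultimately have "{h, j} \<in> poly_edges P" using S.face_diag[OF P(1) D0] by blast
  then show "below a' c' \<subseteq> S.below a c"
  proof (cases rule: S.edge_faces[OF P(1) _ s(6), case_names ok top low])
    case top
    have "a' \<in> P" "c' \<in> P" using P below_ends[of a' c'] l by auto
    then have "h \<le> a'" "c' \<le> j" using top S.below_subset by fastforce+
    then show ?thesis using l by auto
  next
    case (low x z)
    then show ?thesis using S.lower_edge_unique[OF S, of x z] P by auto
  qed
qed

text \<open>Colour each triangle like the face around it. A diagonal inside a face then separates equal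
  colours, and a diagonal of \<open>D0\<close> separates different ones, so erasing the former gives back \<open>D0\<close>.\<close>

lemma noncrossing_refinement_subdivision:
  assumes B0: "B0 \<subseteq> faces n D0"
    and opp: "\<And>a c h j. S.lower_edge a c h j \<Longrightarrow> h + 1 < j \<Longrightarrow> (S.below a c \<in> B0) \<noteq> (S.below h j \<in> B0)"
  defines "B \<equiv> {t \<in> faces n D. \<exists>P\<in>B0. t \<subseteq> P}"
  shows "subdivision_of n \<lparr>diags = D, blacks = B\<rparr> = \<lparr>diags = D0, blacks = B0\<rparr>"
proof -
  have col: "t \<in> B \<longleftrightarrow> P \<in> B0" if "t \<in> faces n D" "P \<in> faces n D0" "t \<subseteq> P" for t P
    using that parent_unique[OF that(1) that(2) _ that(3)] B0 unfolding B_def by blast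
  have uni: "d \<in> unicolored_diags n \<lparr>diags = D, blacks = B\<rparr> \<longleftrightarrow> d \<notin> D0" if dD: "d \<in> D" for d
  proof -
    obtain h j where hj: "d = {h, j}" "arc h j" "h + 1 < j" "(h, j) \<noteq> (0, n - 1)" by (rule diagE[OF dD])
    obtain a c where up: "lower_edge a c h j" using lower_edge_exists hj by blast
    note l = lower_edgeD[OF up]
    have f: "below h j \<in> faces n D" "below a c \<in> faces n D" using below_face l hj by auto
    show ?thesis
    proof (cases "d \<in> D0")
      case True
      then have "S.arc h j" using hj l unfolding S.arc_def by auto
      then obtain x z where S: "S.lower_edge x z h j" using S.lower_edge_exists hj by blast
      note s = S.lower_edgeD[OF S]
      have "below h j \<in> B \<longleftrightarrow> S.below h j \<in> B0" "below a c \<in> B \<longleftrightarrow> S.below x z \<in> B0"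
        using col[OF f(1) S.below_face] col[OF f(2) S.below_face] s hj
          parents_across_diagonal[OF S hj(3) up] by auto
      then show ?thesis using opp[OF S hj(3)] unicolored_iff[OF hj(3) up, of B] True hj by blast
    next
      case False
      obtain P where P: "P \<in> faces n D0" "below h j \<subseteq> P" by (rule parent_face[OF f(1)])
      note e = S.polygon_ends[OF S.face_polygon[OF P(1)]]
      have "(h, j) \<noteq> (Min P, Max P)"
      proof
        assume "(h, j) = (Min P, Max P)"
        then have "S.arc h j" using e by simp
        then show False using False hj S.arc_diag by blast
      qed
      moreover obtain b where b: "tri h b j" using triE hj by blast
      have bj: "{h, b, j} \<subseteq> P" using P triD[OF b] by auto
      moreover have "P \<inter> {h<..<j} \<noteq> {}" using bj triD[OF b] by auto
      ultimately have "a \<in> P \<and> c \<in> P" using neighbour_in_face[OF P(1) _ _ _ up] by auto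
      moreover obtain x where x: "tri a x c" using triE l by blast
      ultimately have "below a c \<subseteq> P"
        using tri_lower_edge[OF x] up bj triD[OF x] by auto
      then have "below h j \<in> B \<longleftrightarrow> below a c \<in> B" using col P f by blast
      then show ?thesis using unicolored_iff[OF hj(3) up, of B] hj False by blast
    qed
  qed
  have "unicolored_diags n \<lparr>diags = D, blacks = B\<rparr> \<subseteq> D" unfolding unicolored_diags_def by auto
  then have D: "D - unicolored_diags n \<lparr>diags = D, blacks = B\<rparr> = D0" using uni D0_sub by blast
  have "{P \<in> faces n D0. \<exists>t\<in>B. t \<subseteq> P} = B0"
  proof
    show "{P \<in> faces n D0. \<exists>t\<in>B. t \<subseteq> P} \<subseteq> B0" using col unfolding B_def by blast
    show "B0 \<subseteq> {P \<in> faces n D0. \<exists>t\<in>B. t \<subseteq> P}"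
    proof
      fix P assume P: "P \<in> B0"
      then have PF: "P \<in> faces n D0" using B0 by blast
      obtain a c where ac: "S.arc a c" "a + 1 < c" "P = S.below a c" by (rule S.faceE[OF PF])
      obtain b where b: "tri a b c" using triE S_arc ac by blast
      have "P \<inter> {a<..<c} \<noteq> {}" using S.below_interior[OF ac(1,2)] ac(3) by (metis IntI empty_iff greaterThanLessThan_iff)
      then have "{a, b, c} \<subseteq> P" using apex_in_face[OF PF b] S.below_ends[of a c] ac by auto
      moreover have "{a, b, c} \<in> faces n D" using tri_face b by blast
      ultimately show "P \<in> {P \<in> faces n D0. \<exists>t\<in>B. t \<subseteq> P}" using P PF unfolding B_def by auto
    qed
  qed
  then show ?thesis unfolding subdivision_of_def using D by (simp add: Let_def)
qed

end

locale colored = refined +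
  fixes B :: "nat set set"
  assumes B_faces: "B \<subseteq> faces n D"
    and D0_eq: "D0 = D - unicolored_diags n \<lparr>diags = D, blacks = B\<rparr>"
begin

definition black :: "nat set \<Rightarrow> bool" where
  "black P \<longleftrightarrow> (\<exists>t\<in>B. t \<subseteq> P)"

text \<open>Climb from triangle to triangle towards the longest edge of the face: the diagonals crossed are not
  in \<open>D0\<close>, so they separate equal colours.\<close>

lemma color_root:
  assumes P: "P \<in> faces n D0" and h: "h \<in> P" "j \<in> P" "arc h j" and ne: "P \<inter> {h<..<j} \<noteq> {}"
  shows "below h j \<in> B \<longleftrightarrow> below (Min P) (Max P) \<in> B"
  using h ne
proof (induction "n - (j - h)" arbitrary: h j rule: less_induct)
  case less
  have PP: "S.polygon P" using P S.face_polygon by blast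
  note e = S.polygon_ends[OF PP]
  show ?case
  proof (cases "(h, j) = (Min P, Max P)")
    case False
    have hj: "h < j" "h + 1 < j" "Min P \<le> h" "j \<le> Max P" using less.prems e arc_less by auto
    have b: "Max P < n" using e S.arc_bound by blast
    have root: "(h, j) \<noteq> (0, n - 1)" using False hj b by auto
    obtain a c where up: "lower_edge a c h j" using lower_edge_exists[OF less.prems(3) root] .
    note l = lower_edgeD[OF up]
    have nD0: "{h, j} \<notin> D0"
    proof
      assume "{h, j} \<in> D0"
      then have "{h, j} \<in> poly_edges P" using S.face_diag[OF P] less.prems by auto
      then have "P \<subseteq> {h..j}" using less.prems hj by (simp add: mem_poly_edges)
      then have "h \<le> Min P" "Max P \<le> j" using e(1,2) by auto
      then show False using False hj by auto
    qed
    have ac: "a \<in> P" "c \<in> P" using neighbour_in_face[OF P less.prems(1,2) False up less.prems(4)] by auto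
    have "P \<inter> {a<..<c} \<noteq> {}"
    proof -
      have "P \<inter> {h<..<j} \<subseteq> P \<inter> {a<..<c}" using l by auto
      then show ?thesis using less.prems(4) by blast
    qed
    moreover have "c < n" using l arc_bound by blast
    then have "n - (c - a) < n - (j - h)" using l by auto
    ultimately have "below a c \<in> B \<longleftrightarrow> below (Min P) (Max P) \<in> B"
      using less.hyps ac l by blast
    moreover have "{h, j} \<in> D" using arc_diag less.prems(3) hj root by blast
    then have "below h j \<in> B \<longleftrightarrow> below a c \<in> B"
      using unicolored_iff[OF hj(2) up] nD0 D0_eq by blast
    ultimately show ?thesis by simp
  qed simp
qed

lemma color_parent:
  assumes P: "P \<in> faces n D0" and t: "t \<in> faces n D" "t \<subseteq> P"
  shows "t \<in> B \<longleftrightarrow> black P"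
proof -
  have c: "s \<in> B \<longleftrightarrow> below (Min P) (Max P) \<in> B" if s: "s \<in> faces n D" "s \<subseteq> P" for s
  proof -
    obtain a b c where x: "tri a b c" "s = {a, b, c}" by (rule faceE_tri[OF s(1)])
    have "P \<inter> {a<..<c} \<noteq> {}" using s x triD[OF x(1)] by auto
    then show ?thesis using color_root[OF P, of a c] s x triD[OF x(1)] by auto
  qed
  then show ?thesis using t B_faces unfolding black_def by blast
qed

lemma color_tri:
  assumes "P \<in> faces n D0" "tri h b j" "h \<in> P" "j \<in> P" "P \<inter> {h<..<j} \<noteq> {}"
  shows "{h, b, j} \<in> B \<longleftrightarrow> black P"
  using color_parent[OF assms(1)] apex_in_face[OF assms] tri_face[OF assms(2)] by blast

lemma opposite_colors:
  assumes S: "S.lower_edge a c h j" and hj: "h + 1 < j"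
  shows "black (S.below a c) \<longleftrightarrow> \<not> black (S.below h j)"
proof -
  note s = S.lower_edgeD[OF S]
  have r: "(h, j) \<noteq> (0, n - 1)" using s S.arc_bound[OF s(1)] by auto
  then have D0: "{h, j} \<in> D0" using S.arc_diag s hj by blast
  obtain a' c' where up: "lower_edge a' c' h j" using lower_edge_exists S_arc s r by blast
  note l = lower_edgeD[OF up] and p = parents_across_diagonal[OF S hj up]
  have "below h j \<in> B \<longleftrightarrow> black (S.below h j)" "below a' c' \<in> B \<longleftrightarrow> black (S.below a c)"
    using color_parent S.below_face below_face l s p hj by auto
  then show ?thesis using unicolored_iff[OF hj up, of B] D0 D0_eq by blast
qed

end

lemma colored_of_bicolored:
  assumes T: "bicolored_triangulation k n T" and "3 \<le> n" and S: "S = subdivision_of n T"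
  shows "colored n (diags T) (diags S) (blacks T)"
proof -
  have "diags S = diags T - unicolored_diags n \<lparr>diags = diags T, blacks = blacks T\<rparr>"
    using S by (simp add: subdivision_of_def Let_def unicolored_diags_def)
  then show ?thesis
    using assms unfolding bicolored_triangulation_def triangulation_def by unfold_locales auto
qed

text \<open>Add the arc to the diagonals of the subdivision, complete them to a maximal noncrossing set, and
  give every triangle the colour of the face around it.\<close>

lemma compatible_in_triangulation:
  assumes T: "bicolored_triangulation k n T" and n: "3 \<le> n" and S: "S = subdivision_of n T"
    and c: "compatible n S h j" and hj: "h < j"
  obtains T' where "represented_by n S T'" "{h, j} \<in> sides n \<union> diags T'"
proof -
  interpret C: colored n "diags T" "diags S" "blacks T" by (rule colored_of_bicolored[OF T n S])
  have "blacks S = {P \<in> faces n (diags S). C.black P}"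
    unfolding S by (simp add: subdivision_of_def Let_def C.black_def)
  then have Seq: "S = \<lparr>diags = diags S, blacks = {P \<in> faces n (diags S). C.black P}\<rparr>" by simp
  define D1 where "D1 = (if {h, j} \<in> sides n then diags S else insert {h, j} (diags S))"
  have c': "h < n" "j < n" "\<And>d. d \<in> sides n \<union> diags S \<Longrightarrow> \<not> crosses {h, j} d"
    using c unfolding compatible_def by auto
  have "\<not> crosses {h, j} {h, j}" using hj by (simp add: crosses_iff)
  then have "noncrossing_diagonals n D1"
    using C.S.noncrossing c' hj crosses_sym unfolding D1_def noncrossing_diagonals_def arcs_def by auto
  then obtain D' where D': "D1 \<subseteq> D'" "triangulated n D'"
    using noncrossing_extends_to_triangulation n by blast
  interpret T': triangulated n D' by fact
  interpret R: refined n D' "diags S" using D' by unfold_locales (auto simp: D1_def split: if_splits)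
  define B where "B = {t \<in> faces n D'. \<exists>P\<in>{P \<in> faces n (diags S). C.black P}. t \<subseteq> P}"
  define T' where "T' = \<lparr>diags = D', blacks = B\<rparr>"
  have "subdivision_of n T' = S" unfolding T'_def B_def
    by (subst Seq, rule R.noncrossing_refinement_subdivision)
      (use C.opposite_colors C.S.below_face C.S.lower_edgeD in auto)
  moreover have "bicolored_triangulation (card (blacks T')) n T'"
    using T'.noncrossing T'.faces3 unfolding bicolored_triangulation_def triangulation_def T'_def B_def by auto
  ultimately have "represented_by n S T'" unfolding represented_by_def by blast
  moreover have "{h, j} \<in> sides n \<union> diags T'" using D' unfolding T'_def D1_def by (auto split: if_splits)
  ultimately show ?thesis using that by blast
qed

text \<open>\<open>J\<close> distributes \<open>I\<close> over the polygons in \<open>F\<close>, giving each as many of its own vertices as it has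
  triangles.\<close>

definition distributed :: "nat set set \<Rightarrow> nat set \<Rightarrow> (nat set \<Rightarrow> nat set) \<Rightarrow> bool" where
  "distributed F I J \<longleftrightarrow> I = (\<Union>P\<in>F. J P) \<and> (\<forall>P\<in>F. J P \<subseteq> P) \<and> (\<forall>P\<in>F. card (J P) = card P - 2) \<and>
     (\<forall>P\<in>F. \<forall>Q\<in>F. P \<noteq> Q \<longrightarrow> J P \<inter> J Q = {})"

context colored
begin

lemma blacks_partition: "B = (\<Union>P\<in>{P \<in> faces n D0. black P}. {t \<in> faces n D. t \<subseteq> P})"
proof
  show "B \<subseteq> (\<Union>P\<in>{P \<in> faces n D0. black P}. {t \<in> faces n D. t \<subseteq> P})"
  proof
    fix t assume t: "t \<in> B"
    then have tf: "t \<in> faces n D" using B_faces by blast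
    then obtain P where "P \<in> faces n D0" "t \<subseteq> P" by (rule parent_face)
    then show "t \<in> (\<Union>P\<in>{P \<in> faces n D0. black P}. {t \<in> faces n D. t \<subseteq> P})"
      using t tf unfolding black_def by auto
  qed
  show "(\<Union>P\<in>{P \<in> faces n D0. black P}. {t \<in> faces n D. t \<subseteq> P}) \<subseteq> B"
    using color_parent by auto
qed

lemma card_faces_in_polygon:
  assumes "polygon P"
  shows "card {t \<in> faces n D. t \<subseteq> P} = card P - 2"
proof -
  note e = polygon_ends[OF assms]
  have "transversal (P - {Min P, Max P}) {t \<in> faces n D. t \<subseteq> P}"
    using polygon_transversal[OF assms] e by auto
  then have "card {t \<in> faces n D. t \<subseteq> P} = card (P - {Min P, Max P})" by (simp add: transversal_card)
  also have "\<dots> = card P - 2" using e by (simp add: card_Diff_subset)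
  finally show ?thesis .
qed

text \<open>A polygon with \<open>m\<close> vertices has \<open>m - 2\<close> triangles, and any \<open>m - 2\<close> of its vertices represent them,
  whatever the triangulation. So the right-hand side only mentions the faces of the subdivision.\<close>

lemma transversal_blacks_iff:
  "transversal I B \<longleftrightarrow> (\<exists>J. distributed {P \<in> faces n D0. black P} I J)"
proof
  let ?F = "{P \<in> faces n D0. black P}" and ?X = "\<lambda>P. {t \<in> faces n D. t \<subseteq> P}"
  assume "transversal I B"
  then obtain \<phi> where \<phi>: "bij_betw \<phi> I B" "\<And>i. i \<in> I \<Longrightarrow> i \<in> \<phi> i" unfolding transversal_def by blast
  define J where "J = (\<lambda>P. {i \<in> I. \<phi> i \<subseteq> P})"
  have im: "\<phi> ` J P = ?X P" if P: "P \<in> ?F" for P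
  proof -
    have "?X P \<subseteq> B" using P blacks_partition by blast
    then show ?thesis using \<phi>(1) B_faces unfolding J_def bij_betw_def by blast
  qed
  have "I = (\<Union>P\<in>?F. J P)"
  proof
    show "I \<subseteq> (\<Union>P\<in>?F. J P)"
    proof
      fix i assume i: "i \<in> I"
      then have "\<phi> i \<in> B" using \<phi> bij_betwE by blast
      then obtain P where "P \<in> ?F" "\<phi> i \<in> ?X P" using blacks_partition by blast
      then show "i \<in> (\<Union>P\<in>?F. J P)" using i unfolding J_def by blast
    qed
  qed (auto simp: J_def)
  moreover have "J P \<subseteq> P" for P using \<phi>(2) unfolding J_def by blast
  moreover have "card (J P) = card P - 2" if P: "P \<in> ?F" for P
  proof -
    have "inj_on \<phi> (J P)" using \<phi>(1) unfolding J_def bij_betw_def by (auto intro: inj_on_subset)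
    then have "card (J P) = card (?X P)" using im[OF P] card_image by metis
    then show ?thesis using card_faces_in_polygon S_face_polygon P by auto
  qed
  moreover have "J P \<inter> J Q = {}" if "P \<in> ?F" "Q \<in> ?F" "P \<noteq> Q" for P Q
  proof -
    have False if i: "i \<in> I" "\<phi> i \<subseteq> P" "\<phi> i \<subseteq> Q" for i
    proof -
      have "\<phi> i \<in> faces n D" using \<phi> i bij_betwE B_faces by blast
      then show False using parent_unique[of "\<phi> i" P Q] i \<open>P \<in> ?F\<close> \<open>Q \<in> ?F\<close> \<open>P \<noteq> Q\<close> by auto
    qed
    then show ?thesis unfolding J_def by blast
  qed
  ultimately have "distributed ?F I J" unfolding distributed_def by blast
  then show "\<exists>J. distributed ?F I J" by blast
next
  let ?F = "{P \<in> faces n D0. black P}" and ?X = "\<lambda>P. {t \<in> faces n D. t \<subseteq> P}"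
  assume "\<exists>J. distributed ?F I J"
  then obtain J where dJ: "distributed ?F I J" by blast
  have J: "I = (\<Union>P\<in>?F. J P)"
    and J': "\<And>P. P \<in> ?F \<Longrightarrow> J P \<subseteq> P" "\<And>P. P \<in> ?F \<Longrightarrow> card (J P) = card P - 2"
      "\<And>P Q. P \<in> ?F \<Longrightarrow> Q \<in> ?F \<Longrightarrow> P \<noteq> Q \<Longrightarrow> J P \<inter> J Q = {}"
    using dJ unfolding distributed_def by blast+
  have "transversal (\<Union>P\<in>?F. J P) (\<Union>P\<in>?F. ?X P)"
  proof (rule transversal_UN)
    show "finite ?F" using S.finite_faces by simp
    show "transversal (J P) (?X P)" if P: "P \<in> ?F" for P
    proof -
      have Q: "polygon P" using P S_face_polygon by blast
      have fin: "finite P" "2 \<le> card P" using Q unfolding polygon_def by auto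
      have "card (P - J P) = card P - card (J P)"
        using J'(1)[OF P] fin by (intro card_Diff_subset) (auto intro: finite_subset)
      then have "card (P - J P) = 2" using J'(2)[OF P] fin by simp
      then obtain u v where uv: "P - J P = {u, v}" "u \<noteq> v" by (auto simp: card_2_iff)
      then have "J P = P - {u, v}" using J'(1)[OF P] by blast
      then show ?thesis using polygon_transversal[OF Q, of u v] uv by auto
    qed
    show "J P \<inter> J Q = {}" if "P \<in> ?F" "Q \<in> ?F" "P \<noteq> Q" for P Q using J'(3) that by blast
    show "?X P \<inter> ?X Q = {}" if "P \<in> ?F" "Q \<in> ?F" "P \<noteq> Q" for P Q
      using parent_unique that by blast
  qed
  then show "transversal I B" using J blacks_partition by simp
qed

end

lemma tdual_positroid_invariant:
  assumes "bicolored_triangulation k n T" "bicolored_triangulation k' n T'" "3 \<le> n"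
    "subdivision_of n T = subdivision_of n T'"
  shows "transversal I (blacks T) \<longleftrightarrow> transversal I (blacks T')"
proof -
  let ?S = "subdivision_of n T"
  interpret A: colored n "diags T" "diags ?S" "blacks T" by (rule colored_of_bicolored[OF assms(1,3)]) simp
  interpret A': colored n "diags T'" "diags ?S" "blacks T'" by (rule colored_of_bicolored[OF assms(2,3)]) (simp add: assms(4))
  have "blacks ?S = {P \<in> faces n (diags ?S). A.black P}" 
    by (simp add: subdivision_of_def Let_def A.black_def)
  moreover have "blacks ?S = {P \<in> faces n (diags ?S). A'.black P}"
    unfolding assms(4) by (simp add: subdivision_of_def Let_def A'.black_def)
  ultimately show ?thesis unfolding A.transversal_blacks_iff A'.transversal_blacks_iff by metis
qed

section \<open>Minors by Laplace expansion\<close>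

text \<open>The minor on the columns \<open>I\<close> of a matrix given by its list of rows, expanded along the first row. It
  vanishes unless \<open>card I\<close> is the number of rows, and columns need not be bounded, so rows can be added
  and column sets split without dimension bookkeeping.\<close>

fun minor :: "(nat \<Rightarrow> real) list \<Rightarrow> nat set \<Rightarrow> real" where
  "minor [] I = of_bool (I = {})"
| "minor (w # R) I = (\<Sum>i\<in>I. (-1) ^ card {j \<in> I. j < i} * w i * minor R (I - {i}))"

lemma minor_card:
  assumes "finite I" "card I \<noteq> length R"
  shows "minor R I = 0"
  using assms
proof (induction R arbitrary: I)
  case (Cons w R)
  have "minor R (I - {i}) = 0" if "i \<in> I" for i
  proof (rule Cons.IH)
    show "card (I - {i}) \<noteq> length R"
      using Cons.prems card_Suc_Diff1[OF Cons.prems(1) that] by auto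
  qed (use Cons.prems in simp)
  then show ?case by (simp add: sum.neutral)
qed auto

lemma minor_linear:
  "minor ((\<lambda>i. a * u i + b * v i) # R) I = a * minor (u # R) I + b * minor (v # R) I"
  unfolding minor.simps sum_distrib_left sum.distrib[symmetric]
  by (rule sum.cong) (simp_all add: algebra_simps)

lemma minor_zero_column:
  assumes "i \<in> I" "\<And>w. w \<in> set R \<Longrightarrow> w i = 0"
  shows "minor R I = 0"
  using assms
proof (induction R arbitrary: I)
  case (Cons w R)
  have "w j * minor R (I - {j}) = 0" if "j \<in> I" for j
    using Cons.IH[of "I - {j}"] Cons.prems by (cases "j = i") auto
  then show ?case by (simp add: sum.neutral)
qed auto

text \<open>Rows living on consecutive blocks of columns make a block diagonal minor.\<close>

lemma minor_append:
  assumes "finite I" "I \<subseteq> {a..<c}" "a \<le> b" "b \<le> c"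
    and "\<And>w i. w \<in> set R1 \<Longrightarrow> i \<notin> {a..<b} \<Longrightarrow> w i = 0"
    and "\<And>w i. w \<in> set R2 \<Longrightarrow> i \<notin> {b..<c} \<Longrightarrow> w i = 0"
  shows "minor (R1 @ R2) I = minor R1 (I \<inter> {a..<b}) * minor R2 (I \<inter> {b..<c})"
  using assms(1,2,5)
proof (induction R1 arbitrary: I)
  case Nil
  show ?case
  proof (cases "I \<inter> {a..<b} = {}")
    case True
    then have "I \<inter> {b..<c} = I" using Nil by fastforce
    then show ?thesis using True by simp
  next
    case False
    then obtain i where "i \<in> I" "i \<in> {a..<b}" by blast
    then have "minor R2 I = 0" using assms(6) by (intro minor_zero_column[of i]) auto
    then show ?thesis using False by simp
  qed
next
  case (Cons w R1)
  let ?L = "I \<inter> {a..<b}"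
  have "minor ((w # R1) @ R2) I = (\<Sum>i\<in>I. (-1) ^ card {j \<in> I. j < i} * w i * minor (R1 @ R2) (I - {i}))"
    by simp
  also have "\<dots> = (\<Sum>i\<in>?L. (-1) ^ card {j \<in> I. j < i} * w i * minor (R1 @ R2) (I - {i}))"
    using Cons.prems by (intro sum.mono_neutral_right) auto
  also have "\<dots> = (\<Sum>i\<in>?L. ((-1) ^ card {j \<in> ?L. j < i} * w i * minor R1 (?L - {i})) * minor R2 (I \<inter> {b..<c}))"
  proof (rule sum.cong)
    fix i assume i: "i \<in> ?L"
    have "minor (R1 @ R2) (I - {i}) = minor R1 ((I - {i}) \<inter> {a..<b}) * minor R2 ((I - {i}) \<inter> {b..<c})"
      using Cons.prems by (intro Cons.IH) auto
    moreover have "(I - {i}) \<inter> {a..<b} = ?L - {i}" "(I - {i}) \<inter> {b..<c} = I \<inter> {b..<c}" using i by auto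
    moreover have "{j \<in> I. j < i} = {j \<in> ?L. j < i}" using i Cons.prems by fastforce
    ultimately show "(-1) ^ card {j \<in> I. j < i} * w i * minor (R1 @ R2) (I - {i}) =
      ((-1) ^ card {j \<in> ?L. j < i} * w i * minor R1 (?L - {i})) * minor R2 (I \<inter> {b..<c})"
      by (simp add: mult.assoc)
  qed simp
  finally show ?case by (simp add: sum_distrib_right)
qed

lemma card_less_remove:
  assumes "finite I" "i \<in> I" "i \<noteq> (j::nat)"
  shows "card {x \<in> I. x < j} = card {x \<in> I - {i}. x < j} + of_bool (i < j)"
proof (cases "i < j")
  case True
  then have "{x \<in> I. x < j} = insert i {x \<in> I - {i}. x < j}" using assms by auto
  then show ?thesis using assms True by simp
next
  case False
  then have "{x \<in> I. x < j} = {x \<in> I - {i}. x < j}" by auto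
  then show ?thesis using False by simp
qed

lemma minor_swap:
  assumes "finite I"
  shows "minor (u # v # R) I = - minor (v # u # R) I"
proof -
  define g where "g = (\<lambda>u v i j. (-1) ^ card {x \<in> I. x < i} * u i *
      ((-1) ^ card {x \<in> I - {i}. x < j} * v j * minor R (I - {i} - {j})))"
  have exp: "minor (u # v # R) I = (\<Sum>i\<in>I. \<Sum>j\<in>{j \<in> I. i \<noteq> j}. g u v i j)" for u v
  proof -
    have "I - {i} = {j \<in> I. i \<noteq> j}" for i by auto
    then show ?thesis unfolding g_def by (simp add: sum_distrib_left)
  qed
  have anti: "g u v i j = - g v u j i" if "i \<in> I" "j \<in> I" "i \<noteq> j" for i j
  proof -
    have e: "card {x \<in> I. x < j} = card {x \<in> I - {i}. x < j} + of_bool (i < j)"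
      "card {x \<in> I. x < i} = card {x \<in> I - {j}. x < i} + of_bool (j < i)"
      using card_less_remove[OF assms] that by auto
    have "I - {i} - {j} = I - {j} - {i}" by blast
    then show ?thesis unfolding g_def e using that(3)
      by (cases "i < j") (auto simp: power_add)
  qed
  have "minor (u # v # R) I = (\<Sum>j\<in>I. \<Sum>i\<in>{i \<in> I. i \<noteq> j}. g u v i j)"
    unfolding exp by (rule sum.swap_restrict) (use assms in auto)
  also have "\<dots> = (\<Sum>j\<in>I. \<Sum>i\<in>{i \<in> I. j \<noteq> i}. - g v u j i)"
    by (intro sum.cong) (auto simp: anti)
  also have "\<dots> = - minor (v # u # R) I" unfolding exp by (simp add: sum_negf)
  finally show ?thesis .
qed

lemma minor_repeated: "finite I \<Longrightarrow> minor (v # v # R) I = 0"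
  using minor_swap[of I v v R] by simp

lemma minor_scale_columns:
  assumes "finite I"
  shows "minor (map (\<lambda>w i. w i * d i) R) I = (\<Prod>i\<in>I. d i) * minor R I"
  using assms
proof (induction R arbitrary: I)
  case (Cons w R)
  have "minor (map (\<lambda>w i. w i * d i) R) (I - {i}) * d i = (\<Prod>i\<in>I. d i) * minor R (I - {i})" if "i \<in> I" for i
    using Cons.IH[of "I - {i}"] Cons.prems that by (simp add: prod.remove[of I i])
  then show ?case
    by (auto simp: sum_distrib_left algebra_simps intro!: sum.cong)
qed auto

text \<open>A further row is moved to its place by transpositions of neighbours.\<close>

lemma minor_insort:
  fixes Z :: "nat \<Rightarrow> nat \<Rightarrow> real"
  assumes "sorted xs" "distinct xs" "finite K"
  shows "minor (Z i # map Z xs) K = (if i \<in> set xs then 0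
     else (-1) ^ card {x \<in> set xs. x < i} * minor (map Z (insort i xs)) K)"
  using assms
proof (induction xs arbitrary: K)
  case (Cons x xs)
  have fin: "finite (K - {\<kappa>})" for \<kappa> using Cons.prems by simp
  consider "i = x" | "i < x" | "x < i" by linarith
  then show ?case
  proof cases
    case 1 then show ?thesis using minor_repeated[OF Cons.prems(3)] by simp
  next
    case 2
    then have m: "i \<notin> set (x # xs)" and e: "{y \<in> set (x # xs). y < i} = {}" using Cons.prems by auto
    have l: "map Z (insort i (x # xs)) = Z i # map Z (x # xs)" using 2 by simp
    show ?thesis unfolding l e if_not_P[OF m] by simp
  next
    case 3
    have "minor (Z i # map Z (x # xs)) K = - minor (Z x # Z i # map Z xs) K"
      unfolding list.map by (rule minor_swap[OF Cons.prems(3)])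
    also have "\<dots> = - (\<Sum>\<kappa>\<in>K. (-1) ^ card {j \<in> K. j < \<kappa>} * Z x \<kappa> * minor (Z i # map Z xs) (K - {\<kappa>}))"
      by (simp only: minor.simps)
    also have "\<dots> = (if i \<in> set xs then 0 else - ((-1) ^ card {y \<in> set xs. y < i} *
        (\<Sum>\<kappa>\<in>K. (-1) ^ card {j \<in> K. j < \<kappa>} * Z x \<kappa> * minor (map Z (insort i xs)) (K - {\<kappa>}))))"
    proof -
      have IH: "minor (Z i # map Z xs) (K - {\<kappa>}) = (if i \<in> set xs then 0
        else (-1) ^ card {y \<in> set xs. y < i} * minor (map Z (insort i xs)) (K - {\<kappa>}))" for \<kappa>
        using Cons.prems by (intro Cons.IH) auto
      show ?thesis
      proof (cases "i \<in> set xs")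
        case True
        then show ?thesis unfolding IH by simp
      next
        case False
        show ?thesis unfolding IH if_not_P[OF False] sum_distrib_left sum_negf[symmetric]
          by (rule sum.cong) (simp_all only: mult_ac mult_minus_left mult_minus_right)
      qed
    qed
    also have "\<dots> = (if i \<in> set (x # xs) then 0
       else (-1) ^ card {y \<in> set (x # xs). y < i} * minor (map Z (insort i (x # xs))) K)"
    proof -
      have "{y \<in> set (x # xs). y < i} = insert x {y \<in> set xs. y < i}" using 3 by auto
      then have "card {y \<in> set (x # xs). y < i} = Suc (card {y \<in> set xs. y < i})" using Cons.prems by simp
      then show ?thesis using 3 by simp
    qed
    finally show ?thesis .
  qed
qed simp

lemma finite_ksubsets: "finite (ksubsets m n)"
  by (rule finite_subset[of _ "Pow {0..<n}"]) (auto simp: ksubsets_def)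

lemma ksubsets_finite: "J \<in> ksubsets m n \<Longrightarrow> finite J"
  by (auto simp: ksubsets_def intro: finite_subset)

text \<open>Induction on the number of rows: expand along the first row of the product, collect the sum over
  columns of \<open>K\<close> to a minor with the extra row \<open>Z i\<close>, and sort that row into place.\<close>

lemma minor_Cauchy_Binet:
  assumes "finite K"
  shows "minor (map (\<lambda>w \<kappa>. \<Sum>i<n. w i * Z i \<kappa>) R) K =
    (\<Sum>J\<in>ksubsets (length R) n. minor R J * minor (map Z (sorted_list_of_set J)) K)"
  using assms
proof (induction R arbitrary: K)
  case Nil
  have "ksubsets 0 n = {{}}"
    unfolding ksubsets_def by (auto dest: finite_subset[OF _ finite_atLeastLessThan])
  then show ?case by simp
next
  case (Cons w R)
  let ?m = "length R" and ?ZJ = "\<lambda>J. map Z (sorted_list_of_set J)"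
  have fin: "finite (K - {\<kappa>})" for \<kappa> using Cons.prems by simp
  have "minor (map (\<lambda>w \<kappa>. \<Sum>i<n. w i * Z i \<kappa>) (w # R)) K =
    (\<Sum>\<kappa>\<in>K. (-1) ^ card {j \<in> K. j < \<kappa>} * (\<Sum>i<n. w i * Z i \<kappa>) *
      (\<Sum>J\<in>ksubsets ?m n. minor R J * minor (?ZJ J) (K - {\<kappa>})))"
    using Cons.IH[OF fin] by simp
  also have "\<dots> = (\<Sum>\<kappa>\<in>K. \<Sum>i<n. \<Sum>J\<in>ksubsets ?m n. w i * minor R J *
      ((-1) ^ card {j \<in> K. j < \<kappa>} * Z i \<kappa> * minor (?ZJ J) (K - {\<kappa>})))"
    by (simp add: sum_distrib_left sum_distrib_right mult_ac)
  also have "\<dots> = (\<Sum>i<n. \<Sum>\<kappa>\<in>K. \<Sum>J\<in>ksubsets ?m n. w i * minor R J *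
      ((-1) ^ card {j \<in> K. j < \<kappa>} * Z i \<kappa> * minor (?ZJ J) (K - {\<kappa>})))"
    by (rule sum.swap)
  also have "\<dots> = (\<Sum>i<n. \<Sum>J\<in>ksubsets ?m n. \<Sum>\<kappa>\<in>K. w i * minor R J *
      ((-1) ^ card {j \<in> K. j < \<kappa>} * Z i \<kappa> * minor (?ZJ J) (K - {\<kappa>})))"
    by (intro sum.cong refl sum.swap)
  also have "\<dots> = (\<Sum>i<n. \<Sum>J\<in>ksubsets ?m n. w i * minor R J * minor (Z i # ?ZJ J) K)"
    by (simp add: sum_distrib_left)
  also have "\<dots> = (\<Sum>i<n. \<Sum>J\<in>{J \<in> ksubsets ?m n. i \<notin> J}. w i * minor R J *
      ((-1) ^ card {x \<in> J. x < i} * minor (?ZJ (insert i J)) K))"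
  proof (rule sum.cong[OF refl])
    fix i
    have "w i * minor R J * minor (Z i # ?ZJ J) K = (if i \<notin> J then w i * minor R J *
      ((-1) ^ card {x \<in> J. x < i} * minor (?ZJ (insert i J)) K) else 0)" if "J \<in> ksubsets ?m n" for J
      using minor_insort[OF _ _ Cons.prems, of "sorted_list_of_set J" Z i] ksubsets_finite[OF that]
      by (simp del: minor.simps)
    then show "(\<Sum>J\<in>ksubsets ?m n. w i * minor R J * minor (Z i # ?ZJ J) K) =
      (\<Sum>J\<in>{J \<in> ksubsets ?m n. i \<notin> J}. w i * minor R J *
      ((-1) ^ card {x \<in> J. x < i} * minor (?ZJ (insert i J)) K))"
      using finite_ksubsets by (simp add: sum.inter_filter)
  qed
  also have "\<dots> = (\<Sum>(i, J)\<in>(SIGMA i:{..<n}. {J \<in> ksubsets ?m n. i \<notin> J}). w i * minor R J *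
      ((-1) ^ card {x \<in> J. x < i} * minor (?ZJ (insert i J)) K))"
    using finite_ksubsets by (intro sum.Sigma) auto
  also have "\<dots> = (\<Sum>(J, i)\<in>(SIGMA J:ksubsets (Suc ?m) n. J).
      (-1) ^ card {j \<in> J. j < i} * w i * minor R (J - {i}) * minor (?ZJ J) K)"
  proof (rule sum.reindex_bij_witness[of _ "\<lambda>(J, i). (i, J - {i})" "\<lambda>(i, J). (insert i J, i)"])
    fix p assume "p \<in> (SIGMA i:{..<n}. {J \<in> ksubsets ?m n. i \<notin> J})"
    then obtain i J where p: "p = (i, J)" "i < n" "J \<in> ksubsets ?m n" "i \<notin> J" by blast
    have f: "finite J" using p ksubsets_finite by blast
    have e: "insert i J - {i} = J" "{j. (j = i \<or> j \<in> J) \<and> j < i} = {x \<in> J. x < i}" using p by auto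
    show "(case case p of (i, J) \<Rightarrow> (insert i J, i) of (J, i) \<Rightarrow> (i, J - {i})) = p" using p e by simp
    show "(case p of (i, J) \<Rightarrow> (insert i J, i)) \<in> (SIGMA J:ksubsets (Suc ?m) n. J)"
      using p f by (auto simp: ksubsets_def)
    show "(case case p of (i, J) \<Rightarrow> (insert i J, i) of (J, i) \<Rightarrow>
        (-1) ^ card {j \<in> J. j < i} * w i * minor R (J - {i}) * minor (?ZJ J) K) =
      (case p of (i, J) \<Rightarrow> w i * minor R J * ((-1) ^ card {x \<in> J. x < i} * minor (?ZJ (insert i J)) K))"
      using p e by (simp add: mult_ac del: sorted_list_of_set_insert_remove)
  next
    fix p assume "p \<in> (SIGMA J:ksubsets (Suc ?m) n. J)"
    then obtain i J where p: "p = (J, i)" "J \<in> ksubsets (Suc ?m) n" "i \<in> J" by blast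
    have f: "finite J" using p ksubsets_finite by blast
    show "(case case p of (J, i) \<Rightarrow> (i, J - {i}) of (i, J) \<Rightarrow> (insert i J, i)) = p" using p by auto
    show "(case p of (J, i) \<Rightarrow> (i, J - {i})) \<in> (SIGMA i:{..<n}. {J \<in> ksubsets ?m n. i \<notin> J})"
      using p f by (auto simp: ksubsets_def)
  qed
  also have "\<dots> = (\<Sum>J\<in>ksubsets (Suc ?m) n. \<Sum>i\<in>J.
      (-1) ^ card {j \<in> J. j < i} * w i * minor R (J - {i}) * minor (?ZJ J) K)"
    using finite_ksubsets ksubsets_finite by (intro sum.Sigma[symmetric]) auto
  finally show ?case by (simp add: sum_distrib_right)
qed

text \<open>The two unit rows delete the columns \<open>h\<close> and \<open>j\<close>; moving these columns to the end passes the
  columns between them once and those beyond \<open>j\<close> twice.\<close>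

lemma minor_unit_rows:
  assumes "finite J" "h < j"
  shows "minor (R @ [\<lambda>i. of_bool (i = h), \<lambda>i. of_bool (i = j)]) J =
    (if h \<in> J \<and> j \<in> J then (-1) ^ card (J \<inter> {h<..<j}) * minor R (J - {h, j}) else 0)"
  using assms(1)
proof (induction R arbitrary: J)
  case Nil
  let ?r = "[\<lambda>i. of_bool (i = h), \<lambda>i. of_bool (i = j)] :: (nat \<Rightarrow> real) list"
  show ?case
  proof (cases "J = {h, j}")
    case True
    have e: "{x \<in> {h, j}. x < h} = {}" "{h, j} \<inter> {h<..<j} = {}" "{h, j} - {h} = {j}" "{x. x = j \<and> x < j} = {}"
      using assms(2) by auto
    have "minor ?r {h, j} = (\<Sum>i\<in>{h, j}. (-1) ^ card {x \<in> {h, j}. x < i} * of_bool (i = h) *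
        minor [\<lambda>i. of_bool (i = j)] ({h, j} - {i}))"
      by (simp only: minor.simps)
    also have "\<dots> = (-1) ^ card {x \<in> {h, j}. x < h} * minor [\<lambda>i. of_bool (i = j)] ({h, j} - {h})"
      using assms(2) by (simp del: minor.simps)
    also have "\<dots> = 1" unfolding e by (simp add: e)
    finally show ?thesis unfolding True using e by simp
  next
    case False
    have "minor ?r J = 0"
    proof (cases "card J = 2")
      case True
      have "\<not> J \<subseteq> {h, j}"
      proof
        assume "J \<subseteq> {h, j}"
        moreover have "card {h, j} = 2" using assms(2) by simp
        ultimately have "J = {h, j}" using True card_subset_eq[of "{h, j}" J] by simp
        then show False using False by simp
      qed
      then obtain i where "i \<in> J" "i \<noteq> h" "i \<noteq> j" by blast
      then show ?thesis by (intro minor_zero_column[of i]) auto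
    next
      case False
      then show ?thesis using Nil by (intro minor_card) auto
    qed
    moreover have "J - {h, j} \<noteq> {}" if "h \<in> J" "j \<in> J" using False that by blast
    ultimately show ?thesis by auto
  qed
next
  case (Cons w R)
  let ?r = "[\<lambda>i. of_bool (i = h), \<lambda>i. of_bool (i = j)] :: (nat \<Rightarrow> real) list"
  have IH: "minor (R @ ?r) (J - {i}) = (if h \<in> J - {i} \<and> j \<in> J - {i}
     then (-1) ^ card ((J - {i}) \<inter> {h<..<j}) * minor R (J - {i} - {h, j}) else 0)" for i
    using Cons.prems by (intro Cons.IH) simp
  show ?case
  proof (cases "h \<in> J \<and> j \<in> J")
    case False
    then have "minor (R @ ?r) (J - {i}) = 0" for i unfolding IH by auto
    then show ?thesis unfolding if_not_P[OF False] by simp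
  next
    case True
    let ?J = "J - {h, j}"
    have "minor ((w # R) @ ?r) J = (\<Sum>i\<in>J. (-1) ^ card {x \<in> J. x < i} * w i * minor (R @ ?r) (J - {i}))" by simp
    also have "\<dots> = (\<Sum>i\<in>?J. (-1) ^ card {x \<in> J. x < i} * w i * minor (R @ ?r) (J - {i}))"
      using Cons.prems by (intro sum.mono_neutral_right) (auto simp: IH)
    also have "\<dots> = (\<Sum>i\<in>?J. (-1) ^ card (J \<inter> {h<..<j}) * ((-1) ^ card {x \<in> ?J. x < i} * w i * minor R (?J - {i})))"
    proof (rule sum.cong[OF refl])
      fix i assume i: "i \<in> ?J"
      have "card {x \<in> J. x < i} = card {x \<in> J - {h}. x < i} + of_bool (h < i)"
        using i True Cons.prems by (intro card_less_remove) auto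
      also have "card {x \<in> J - {h}. x < i} = card {x \<in> J - {h} - {j}. x < i} + of_bool (j < i)"
        using i True Cons.prems assms(2) by (intro card_less_remove) auto
      also have "J - {h} - {j} = ?J" by blast
      finally have c1: "card {x \<in> J. x < i} = card {x \<in> ?J. x < i} + of_bool (j < i) + of_bool (h < i)" .
      have c2: "card (J \<inter> {h<..<j}) = card ((J - {i}) \<inter> {h<..<j}) + of_bool (h < i \<and> i < j)"
      proof (cases "h < i \<and> i < j")
        case True
        then have "J \<inter> {h<..<j} = insert i ((J - {i}) \<inter> {h<..<j})" using i by auto
        then show ?thesis using True Cons.prems by simp
      next
        case False
        then have "J \<inter> {h<..<j} = (J - {i}) \<inter> {h<..<j}" by auto
        then show ?thesis using False by simp
      qed
      have sgn: "(-1::real) ^ card {x \<in> J. x < i} * (-1) ^ card ((J - {i}) \<inter> {h<..<j}) =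
        (-1) ^ card (J \<inter> {h<..<j}) * (-1) ^ card {x \<in> ?J. x < i}"
        unfolding c1 c2 using i assms(2) by (auto simp: power_add not_less le_less)
      have "J - {i} - {h, j} = ?J - {i}" by blast
      then have m: "minor (R @ ?r) (J - {i}) = (-1) ^ card ((J - {i}) \<inter> {h<..<j}) * minor R (?J - {i})"
        unfolding IH using i True by auto
      have "(-1) ^ card {x \<in> J. x < i} * w i * minor (R @ ?r) (J - {i}) =
        ((-1) ^ card {x \<in> J. x < i} * (-1) ^ card ((J - {i}) \<inter> {h<..<j})) * w i * minor R (?J - {i})"
        unfolding m by (simp add: mult_ac)
      then show "(-1) ^ card {x \<in> J. x < i} * w i * minor (R @ ?r) (J - {i}) =
        (-1) ^ card (J \<inter> {h<..<j}) * ((-1) ^ card {x \<in> ?J. x < i} * w i * minor R (?J - {i}))"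
        unfolding sgn by (simp add: mult_ac)
    qed
    also have "\<dots> = (-1) ^ card (J \<inter> {h<..<j}) * minor (w # R) ?J" by (simp add: sum_distrib_left)
    finally show ?thesis using True by simp
  qed
qed

text \<open>The term of the Leibniz expansion that takes the entry in column \<open>xs ! r\<close> from row \<open>r\<close>; the sign
  counts inversions.\<close>

fun leibniz_term :: "(nat \<Rightarrow> real) list \<Rightarrow> nat list \<Rightarrow> real" where
  "leibniz_term (w # R) (x # xs) = (-1) ^ card {y \<in> set xs. y < x} * w x * leibniz_term R xs"
| "leibniz_term _ _ = 1"

definition arrangements :: "(nat \<Rightarrow> real) list \<Rightarrow> nat set \<Rightarrow> nat list set" where
  "arrangements R I = {xs. length xs = length R \<and> distinct xs \<and> set xs = I}"

text \<open>If no two terms of the Leibniz expansion have opposite signs, there is no cancellation. The factor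
  \<open>\<sigma>\<close> absorbs the part of a term that belongs to the rows already expanded.\<close>

lemma minor_no_cancellation_aux:
  assumes "finite I" "\<And>xs. xs \<in> arrangements R I \<Longrightarrow> \<sigma> * leibniz_term R xs \<ge> 0"
  shows "\<sigma> * minor R I \<ge> 0 \<and> (\<sigma> * minor R I > 0 \<longleftrightarrow> (\<exists>xs\<in>arrangements R I. \<sigma> * leibniz_term R xs > 0))"
  using assms
proof (induction R arbitrary: I \<sigma>)
  case Nil
  have "arrangements [] I = (if I = {} then {[]} else {})" unfolding arrangements_def by auto
  then show ?case using Nil by auto
next
  case (Cons w R)
  define s where "s = (\<lambda>i. \<sigma> * (-1) ^ card {j \<in> I. j < i} * w i)"
  have sum: "\<sigma> * minor (w # R) I = (\<Sum>i\<in>I. s i * minor R (I - {i}))"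
    unfolding s_def by (simp add: sum_distrib_left mult.assoc)
  have arr: "arrangements (w # R) I = (\<Union>i\<in>I. (#) i ` arrangements R (I - {i}))"
  proof
    show "arrangements (w # R) I \<subseteq> (\<Union>i\<in>I. (#) i ` arrangements R (I - {i}))"
    proof
      fix xs assume xs: "xs \<in> arrangements (w # R) I"
      then obtain x ys where "xs = x # ys" unfolding arrangements_def by (cases xs) auto
      then show "xs \<in> (\<Union>i\<in>I. (#) i ` arrangements R (I - {i}))"
        using xs unfolding arrangements_def by auto
    qed
    show "(\<Union>i\<in>I. (#) i ` arrangements R (I - {i})) \<subseteq> arrangements (w # R) I"
    proof
      fix xs assume "xs \<in> (\<Union>i\<in>I. (#) i ` arrangements R (I - {i}))"
      then obtain i ys where i: "i \<in> I" "ys \<in> arrangements R (I - {i})" "xs = i # ys" by blast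
      then show "xs \<in> arrangements (w # R) I" unfolding arrangements_def by fastforce
    qed
  qed
  have lt: "\<sigma> * leibniz_term (w # R) (i # xs) = s i * leibniz_term R xs"
    if "i \<in> I" "xs \<in> arrangements R (I - {i})" for i xs
  proof -
    have "{y \<in> set xs. y < i} = {j \<in> I. j < i}" using that unfolding arrangements_def by auto
    then show ?thesis unfolding s_def by (simp add: mult.assoc)
  qed
  have IH: "s i * minor R (I - {i}) \<ge> 0 \<and> (s i * minor R (I - {i}) > 0 \<longleftrightarrow>
      (\<exists>xs\<in>arrangements R (I - {i}). s i * leibniz_term R xs > 0))" if i: "i \<in> I" for i
  proof (rule Cons.IH)
    fix xs assume xs: "xs \<in> arrangements R (I - {i})"
    then have "i # xs \<in> arrangements (w # R) I" using arr i by blast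
    then show "0 \<le> s i * leibniz_term R xs" using Cons.prems(2) lt[OF i xs] by metis
  qed (use Cons.prems in simp)
  have "(\<Sum>i\<in>I. s i * minor R (I - {i})) > 0 \<longleftrightarrow> (\<exists>i\<in>I. s i * minor R (I - {i}) > 0)"
  proof
    assume pos: "(\<Sum>i\<in>I. s i * minor R (I - {i})) > 0"
    show "\<exists>i\<in>I. s i * minor R (I - {i}) > 0"
    proof (rule ccontr)
      assume "\<not> ?thesis"
      then have "(\<Sum>i\<in>I. s i * minor R (I - {i})) \<le> 0" by (intro sum_nonpos) (simp add: not_less)
      with pos show False by simp
    qed
  next
    assume "\<exists>i\<in>I. s i * minor R (I - {i}) > 0"
    then obtain i where "i \<in> I" "s i * minor R (I - {i}) > 0" by blast
    then show "(\<Sum>i\<in>I. s i * minor R (I - {i})) > 0"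
      using IH by (intro sum_pos2[OF Cons.prems(1)]) auto
  qed
  moreover have "(\<Sum>i\<in>I. s i * minor R (I - {i})) \<ge> 0" using IH by (intro sum_nonneg) blast
  moreover have "(\<exists>i\<in>I. s i * minor R (I - {i}) > 0) \<longleftrightarrow>
      (\<exists>xs\<in>arrangements (w # R) I. \<sigma> * leibniz_term (w # R) xs > 0)"
    unfolding arr using IH lt by (simp del: leibniz_term.simps) 
  ultimately show ?case unfolding sum by blast
qed

lemma minor_no_cancellation:
  assumes "finite I" "\<And>xs. xs \<in> arrangements R I \<Longrightarrow> leibniz_term R xs \<ge> 0"
  shows "minor R I \<ge> 0" "minor R I > 0 \<longleftrightarrow> (\<exists>xs\<in>arrangements R I. leibniz_term R xs > 0)"
  using minor_no_cancellation_aux[of I R 1] assms by auto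

lemma det_eq_minor:
  assumes "strict_mono_on {..<length R} e"
  shows "det (mat (length R) (length R) (\<lambda>(r, c). (R ! r) (e c))) = minor R (e ` {..<length R})"
  using assms
proof (induction R arbitrary: e)
  case Nil
  then show ?case by (simp add: det_dim_zero)
next
  case (Cons w R)
  let ?m = "length R"
  let ?A = "mat (Suc ?m) (Suc ?m) (\<lambda>(r, c). ((w # R) ! r) (e c))"
  let ?I = "e ` {..<Suc ?m}"
  have mono: "e c < e c'" if "c < c'" "c' < Suc ?m" for c c'
    using Cons.prems that by (auto simp: strict_mono_on_def)
  then have inj: "inj_on e {..<Suc ?m}" by (intro linorder_inj_onI) (auto simp: less_imp_neq)
  have "det ?A = (\<Sum>c<Suc ?m. ?A $$ (0, c) * cofactor ?A 0 c)"
    by (rule laplace_expansion_row) auto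
  also have "\<dots> = (\<Sum>c<Suc ?m. (-1) ^ card {j \<in> ?I. j < e c} * w (e c) * minor R (?I - {e c}))"
  proof (rule sum.cong[OF refl])
    fix c assume "c \<in> {..<Suc ?m}"
    then have c: "c < Suc ?m" by simp
    define e' where "e' = (\<lambda>x. e (if x < c then x else Suc x))"
    have "strict_mono_on {..<?m} e'" unfolding e'_def strict_mono_on_def using mono by auto
    then have IH: "det (mat ?m ?m (\<lambda>(r, c). (R ! r) (e' c))) = minor R (e' ` {..<?m})" by (rule Cons.IH)
    have "mat_delete ?A 0 c = mat ?m ?m (\<lambda>(r, c). (R ! r) (e' c))"
      unfolding mat_delete_def e'_def by (rule eq_matI) auto
    moreover have "e' ` {..<?m} = ?I - {e c}"
    proof -
      have "(\<lambda>x. if x < c then x else Suc x) ` {..<?m} = {..<Suc ?m} - {c}"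
      proof
        show "{..<Suc ?m} - {c} \<subseteq> (\<lambda>x. if x < c then x else Suc x) ` {..<?m}"
        proof
          fix y assume y: "y \<in> {..<Suc ?m} - {c}"
          show "y \<in> (\<lambda>x. if x < c then x else Suc x) ` {..<?m}"
          proof (cases "y < c")
            case True then show ?thesis using c by (intro image_eqI[of _ _ y]) auto
          next
            case False
            then show ?thesis using y c by (intro image_eqI[of _ _ "y - 1"]) auto
          qed
        qed
      qed auto
      then have "e' ` {..<?m} = e ` ({..<Suc ?m} - {c})" unfolding e'_def by (metis image_image)
      also have "\<dots> = ?I - {e c}" using inj c by (auto simp: inj_on_def)
      finally show ?thesis .
    qed
    moreover have "card {j \<in> ?I. j < e c} = c"
    proof -
      have "{j \<in> ?I. j < e c} = e ` {..<c}"
      proof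
        show "{j \<in> ?I. j < e c} \<subseteq> e ` {..<c}"
        proof
          fix y assume "y \<in> {j \<in> ?I. j < e c}"
          then obtain x where x: "x < Suc ?m" "y = e x" "e x < e c" by auto
          have "\<not> c \<le> x" using mono[of c x] x by (metis le_neq_implies_less less_asym less_irrefl)
          then show "y \<in> e ` {..<c}" using x by auto
        qed
        show "e ` {..<c} \<subseteq> {j \<in> ?I. j < e c}" using mono c by auto
      qed
      moreover have "inj_on e {..<c}" by (rule inj_on_subset[OF inj]) (use c in auto)
      ultimately show ?thesis by (simp add: card_image)
    qed
    ultimately show "?A $$ (0, c) * cofactor ?A 0 c =
      (-1) ^ card {j \<in> ?I. j < e c} * w (e c) * minor R (?I - {e c})"
      unfolding cofactor_def using IH c by simp
  qed
  also have "\<dots> = (\<Sum>i\<in>?I. (-1) ^ card {j \<in> ?I. j < i} * w i * minor R (?I - {i}))"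
    using inj by (subst sum.reindex) auto
  finally show ?case by simp
qed

definition row_fns :: "real mat \<Rightarrow> (nat \<Rightarrow> real) list" where
  "row_fns A = map (\<lambda>r i. if i < dim_col A then A $$ (r, i) else 0) [0..<dim_row A]"

lemma length_row_fns: "length (row_fns A) = dim_row A"
  by (simp add: row_fns_def)

lemma plucker_eq_minor:
  assumes A: "A \<in> carrier_mat k n" and I: "I \<in> ksubsets k n"
  shows "plucker A I = minor (row_fns A) I"
proof -
  have fin: "finite I" "card I = k" "I \<subseteq> {0..<n}" using I by (auto simp: ksubsets_def intro: finite_subset)
  have "{j. j < n \<and> j \<in> I} = I" using fin by auto
  then have "submatrix A UNIV I = mat k k (\<lambda>(r, c). (row_fns A ! r) (pick I c))"
    using A fin pick_in_set_le[of _ I] unfolding submatrix_def row_fns_def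
    by (intro eq_matI) (fastforce simp: pick_UNIV)+
  moreover have "strict_mono_on {..<k} (pick I)"
    unfolding strict_mono_on_def using fin by (auto intro: pick_mono_le)
  moreover have "pick I ` {..<k} = I"
  proof (rule card_subset_eq[OF fin(1)])
    show "pick I ` {..<k} \<subseteq> I" using fin pick_in_set_le by auto
    have "inj_on (pick I) {..<k}" using \<open>strict_mono_on {..<k} (pick I)\<close> by (rule strict_mono_on_imp_inj_on)
    then show "card (pick I ` {..<k}) = card I" using fin by (simp add: card_image)
  qed
  moreover have "length (row_fns A) = k" using A by (simp add: length_row_fns)
  ultimately show ?thesis unfolding plucker_def using det_eq_minor[of "row_fns A" "pick I"] by simp
qed

lemma det_eq_minor_rows:
  assumes "A \<in> carrier_mat m m"
  shows "det A = minor (row_fns A) {..<m}"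
proof -
  have "A = mat m m (\<lambda>(r, c). (row_fns A ! r) c)" using assms unfolding row_fns_def by (intro eq_matI) auto
  moreover have "strict_mono_on {..<m} (\<lambda>c. c)" by (auto simp: strict_mono_on_def)
  ultimately show ?thesis using det_eq_minor[of "row_fns A" "\<lambda>c. c"] assms by (simp add: length_row_fns)
qed

section \<open>Representatives of points of the Grassmannian\<close>

lemma two_sided_inverse:
  fixes A :: "real mat"
  assumes "A \<in> carrier_mat m m" "det A \<noteq> 0"
  obtains B where "B \<in> carrier_mat m m" "A * B = 1\<^sub>m m" "B * A = 1\<^sub>m m"
  using det_non_zero_imp_unit[OF assms, of "()"] that unfolding Units_def ring_mat_def by auto

lemma row_space_mult_left:
  fixes A :: "real mat"
  assumes G: "G \<in> carrier_mat k k" "det G \<noteq> 0" and A: "A \<in> carrier_mat k n"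
  shows "vec_space.row_space n (G * A) = vec_space.row_space n A"
proof (rule vec_space.row_space_is_preserved[OF _ G(1) A])
  obtain B where "B \<in> carrier_mat k k" "G * B = 1\<^sub>m k" "B * G = 1\<^sub>m k" by (rule two_sided_inverse[OF G])
  then show "invertible_mat G" using G(1) unfolding invertible_mat_def inverts_mat_def by auto
qed

lemma mat_factor:
  fixes A :: "real mat"
  assumes A: "A \<in> carrier_mat k n" and A': "A' \<in> carrier_mat m n"
    and rows: "\<And>r. r < m \<Longrightarrow> \<exists>y\<in>carrier_vec k. A\<^sup>T *\<^sub>v y = row A' r"
  obtains G where "G \<in> carrier_mat m k" "A' = G * A"
proof -
  obtain y where y: "\<And>r. r < m \<Longrightarrow> y r \<in> carrier_vec k \<and> A\<^sup>T *\<^sub>v y r = row A' r" using rows by metis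
  define G where "G = mat m k (\<lambda>(r, c). y r $ c)"
  have G: "G \<in> carrier_mat m k" unfolding G_def by simp
  have "A' = G * A"
  proof (rule eq_matI)
    fix r c assume rc: "r < dim_row (G * A)" "c < dim_col (G * A)"
    then have r: "r < m" and c: "c < n" using G A by auto
    have "A' $$ (r, c) = row A' r $ c" using A' r c by simp
    also have "\<dots> = (A\<^sup>T *\<^sub>v y r) $ c" using y[OF r] by simp
    also have "\<dots> = (\<Sum>i<k. A $$ (i, c) * y r $ i)"
      using A y[OF r, THEN conjunct1] c by (auto simp: scalar_prod_def lessThan_atLeast0 intro!: sum.cong)
    also have "\<dots> = (G * A) $$ (r, c)"
      using A G r c unfolding G_def by (auto simp: scalar_prod_def lessThan_atLeast0 mult.commute intro!: sum.cong)
    finally show "A' $$ (r, c) = (G * A) $$ (r, c)" .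
  qed (use A A' G in auto)
  with G that show ?thesis by blast
qed

lemma row_in_row_space:
  fixes A :: "real mat"
  assumes A: "A \<in> carrier_mat k n" and r: "r < k"
  shows "row A r \<in> vec_space.row_space n A"
proof -
  have "A\<^sup>T *\<^sub>v unit_vec k r = row A r"
    using A r by (intro eq_vecI) (auto simp: scalar_prod_right_unit)
  moreover have "row A r \<in> carrier_vec n" using A r by auto
  ultimately show ?thesis unfolding vec_space.row_space_eq[OF A] using A
    by (auto intro!: bexI[of _ "unit_vec k r"])
qed

lemma row_space_factor:
  fixes A :: "real mat"
  assumes A: "A \<in> carrier_mat k n" and A': "A' \<in> carrier_mat m n"
    and sub: "vec_space.row_space n A' \<subseteq> vec_space.row_space n A"
  obtains G where "G \<in> carrier_mat m k" "A' = G * A"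
proof (rule mat_factor[OF A A'])
  fix r assume "r < m"
  then have "row A' r \<in> vec_space.row_space n A" using row_in_row_space[OF A'] sub by blast
  then show "\<exists>y\<in>carrier_vec k. A\<^sup>T *\<^sub>v y = row A' r" unfolding vec_space.row_space_eq[OF A] using A by auto
qed

lemma plucker_mult_left:
  assumes G: "G \<in> carrier_mat k k" and A: "A \<in> carrier_mat k n" and I: "I \<in> ksubsets k n"
  shows "plucker (G * A) I = det G * plucker A I"
proof -
  have fin: "finite I" "card I = k" "I \<subseteq> {0..<n}" using I by (auto simp: ksubsets_def intro: finite_subset)
  have cI: "{j. j < n \<and> j \<in> I} = I" using fin by auto
  have pk: "pick I c < n" if "c < k" for c using pick_in_set_le[of c I] fin that by auto
  have S: "submatrix A UNIV I \<in> carrier_mat k k" using A fin cI by (simp add: submatrix_def)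
  have "submatrix (G * A) UNIV I = G * submatrix A UNIV I"
  proof (rule eq_matI)
    fix r c assume "r < dim_row (G * submatrix A UNIV I)" "c < dim_col (G * submatrix A UNIV I)"
    then have rc: "r < k" "c < k" using S G by auto
    have "col A (pick I c) = col (submatrix A UNIV I) c"
      using A rc pk fin cI by (intro eq_vecI) (auto simp: submatrix_def pick_UNIV)
    then show "submatrix (G * A) UNIV I $$ (r, c) = (G * submatrix A UNIV I) $$ (r, c)"
      using A G S rc pk fin cI by (auto simp: submatrix_def pick_UNIV)
  qed (use A G S fin cI in \<open>auto simp: submatrix_def\<close>)
  then show ?thesis unfolding plucker_def using det_mult[OF G S] by simp
qed

lemma rank_le_nrows:
  fixes A :: "real mat"
  assumes A: "A \<in> carrier_mat k n"
  shows "vec_space.rank k A \<le> k"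
proof -
  interpret V: vec_space "TYPE(real)" k .
  have c: "set (cols A) \<subseteq> carrier_vec k" using A cols_dim by blast
  have "VectorSpace.subspace class_ring (V.span (set (cols A))) V.V"
    using c by (intro V.span_is_subspace) simp
  then have "vectorspace.dim class_ring (V.span_vs (set (cols A))) \<le> V.dim"
    using V.subspace_dim V.fin_dim V.fin_dim_span_cols[OF A] by blast
  then show ?thesis unfolding V.rank_def V.dim_is_n .
qed

lemma rank_from_plucker:
  assumes A: "A \<in> carrier_mat k n" and I: "I \<in> ksubsets k n" "plucker A I \<noteq> 0"
  shows "vec_space.rank k A = k"
proof -
  have "{j. j < n \<and> j \<in> I} = I" "card I = k" using I by (auto simp: ksubsets_def)
  then have "k \<le> vec_space.rank k A"
    using vec_space.rank_gt_minor[OF A, of UNIV I] I(2) unfolding plucker_def by simp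
  then show ?thesis using rank_le_nrows[OF A] by simp
qed

lemma rank_from_right_inverse:
  fixes A :: "real mat"
  assumes A: "A \<in> carrier_mat k n" and X: "X \<in> carrier_mat n k" and AX: "A * X = 1\<^sub>m k"
  shows "vec_space.rank k A = k"
proof -
  interpret V: vec_space "TYPE(real)" k .
  have "w \<in> V.col_space A" if w: "w \<in> carrier_vec k" for w
  proof -
    have "A *\<^sub>v (X *\<^sub>v w) = w" using A X AX w by (metis assoc_mult_mat_vec one_mult_mat_vec)
    moreover have "X *\<^sub>v w \<in> carrier_vec n" using X w by simp
    ultimately show ?thesis unfolding V.col_space_eq[OF A] using A w by auto
  qed
  moreover have "V.col_space A \<subseteq> carrier_vec k" unfolding V.col_space_eq[OF A] using A by auto
  ultimately have "V.span (set (cols A)) = carrier_vec k" unfolding V.col_space_def by blast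
  then have "V.span_vs (set (cols A)) = V.V" by (simp add: module_vec_def)
  then show ?thesis unfolding V.rank_def using V.dim_is_n by simp
qed

text \<open>Equal row spaces give a factor in both directions, and a nonzero minor forces the product of
  their determinants to be \<open>1\<close>.\<close>

lemma representatives_factor:
  assumes A: "represents k n A V" and A': "represents k n A' V"
    and I: "I \<in> ksubsets k n" "plucker A I \<noteq> 0"
  obtains G where "G \<in> carrier_mat k k" "det G \<noteq> 0" "A' = G * A"
proof -
  have c: "A \<in> carrier_mat k n" "A' \<in> carrier_mat k n"
    and r: "vec_space.row_space n A = V" "vec_space.row_space n A' = V"
    using A A' unfolding represents_def by auto
  obtain G where G: "G \<in> carrier_mat k k" "A' = G * A" using row_space_factor[OF c] r by blast
  obtain H where H: "H \<in> carrier_mat k k" "A = H * A'" using row_space_factor[OF c(2,1)] r by blast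
  have "plucker A I = det H * plucker A' I"
    using plucker_mult_left[OF H(1) c(2) I(1)] unfolding H(2)[symmetric] .
  moreover have "plucker A' I = det G * plucker A I"
    using plucker_mult_left[OF G(1) c(1) I(1)] unfolding G(2)[symmetric] .
  ultimately have "det G \<noteq> 0" using I(2) by auto
  with G that show ?thesis by blast
qed

lemma matrix_of_represents:
  assumes "represents k n A V" shows "represents k n (matrix_of k n V) V"
  unfolding matrix_of_def using assms by (rule someI)

lemma Z_tilde_eq:
  assumes A: "represents k n A V" and I: "I \<in> ksubsets k n" "plucker A I \<noteq> 0"
    and Z: "Z \<in> carrier_mat n (k + 2)"
  shows "Z_tilde k n Z V = vec_space.row_space (k + 2) (A * Z)"
proof -
  obtain G where G: "G \<in> carrier_mat k k" "det G \<noteq> 0" "matrix_of k n V = G * A"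
    by (rule representatives_factor[OF A matrix_of_represents[OF A] I])
  have c: "A \<in> carrier_mat k n" using A unfolding represents_def by auto
  have "matrix_of k n V * Z = G * (A * Z)" using G c Z by (simp add: assoc_mult_mat[of _ k k _ n])
  then show ?thesis unfolding Z_tilde_def using row_space_mult_left[OF G(1,2)] c Z by simp
qed

lemma moment_map_eq:
  assumes A: "represents k n A V" and I: "I \<in> ksubsets k n" "plucker A I \<noteq> 0"
  shows "moment_map k n V = vec n (\<lambda>i. (\<Sum>I\<in>ksubsets k n. (plucker A I)\<^sup>2 * of_bool (i \<in> I)) /
    (\<Sum>I\<in>ksubsets k n. (plucker A I)\<^sup>2))"
proof -
  obtain G where G: "G \<in> carrier_mat k k" "det G \<noteq> 0" "matrix_of k n V = G * A"
    by (rule representatives_factor[OF A matrix_of_represents[OF A] I])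
  have c: "A \<in> carrier_mat k n" using A unfolding represents_def by auto
  let ?q = "\<lambda>I. (plucker A I)\<^sup>2" and ?d = "(det G)\<^sup>2"
  have p: "(plucker (matrix_of k n V) I)\<^sup>2 = ?d * ?q I" if "I \<in> ksubsets k n" for I
    using plucker_mult_left[OF G(1) c that] G(3) by (simp add: power_mult_distrib)
  have "(\<Sum>I\<in>ksubsets k n. \<bar>plucker (matrix_of k n V) I\<bar>\<^sup>2 * indicator_vec n I $ i) =
      ?d * (\<Sum>I\<in>ksubsets k n. ?q I * of_bool (i \<in> I))" if "i < n" for i
    unfolding sum_distrib_left using that by (intro sum.cong) (auto simp: p indicator_vec_def)
  moreover have "(\<Sum>I\<in>ksubsets k n. \<bar>plucker (matrix_of k n V) I\<bar>\<^sup>2) = ?d * (\<Sum>I\<in>ksubsets k n. ?q I)"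
    unfolding sum_distrib_left by (intro sum.cong) (auto simp: p)
  ultimately show ?thesis unfolding moment_map_def Let_def using G(2)
    by (intro eq_vecI) auto
qed

lemma moment_map_carrier: "moment_map k n V \<in> carrier_vec n"
  unfolding moment_map_def Let_def by simp

section \<open>Twistor coordinates\<close>

definition mat_row :: "real mat \<Rightarrow> nat \<Rightarrow> nat \<Rightarrow> real" where
  "mat_row Z i = (\<lambda>\<kappa>. if \<kappa> < dim_col Z then Z $$ (i, \<kappa>) else 0)"

lemma append_two_carrier:
  assumes "A \<in> carrier_mat k m"
  shows "A @\<^sub>r mat_of_rows m [u, v] \<in> carrier_mat (k + 2) m"
proof -
  have "mat_of_rows m [u, v] \<in> carrier_mat 2 m"
    using mat_of_rows_carrier(1)[of m "[u, v]"] by (simp add: numeral_2_eq_2)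
  then show ?thesis using carrier_append_rows[OF assms] by blast
qed

lemma row_fns_append_two:
  assumes A: "A \<in> carrier_mat k m" and "u \<in> carrier_vec m" "v \<in> carrier_vec m"
  shows "row_fns (A @\<^sub>r mat_of_rows m [u, v]) =
    row_fns A @ [\<lambda>i. if i < m then u $ i else 0, \<lambda>i. if i < m then v $ i else 0]"
proof -
  let ?M = "A @\<^sub>r mat_of_rows m [u, v]"
  have c: "?M \<in> carrier_mat (k + 2) m" by (rule append_two_carrier[OF A])
  have e: "?M $$ (r, i) = (if r < k then A $$ (r, i) else [u, v] ! (r - k) $ i)" if "r < k + 2" "i < m" for r i
    using that A by (auto simp: append_rows_def mat_of_rows_def)
  show ?thesis
  proof (rule nth_equalityI)
    show "length (row_fns ?M) = length (row_fns A @ [\<lambda>i. if i < m then u $ i else 0, \<lambda>i. if i < m then v $ i else 0])"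
      using c A by (simp add: length_row_fns)
    fix r assume "r < length (row_fns ?M)"
    then have r: "r < k + 2" using c by (simp add: length_row_fns)
    have l: "row_fns ?M ! r = (\<lambda>i. if i < m then ?M $$ (r, i) else 0)"
      using r c by (auto simp: row_fns_def simp del: upt_Suc)
    consider "r < k" | "r = k" | "r = k + 1" using r by linarith
    then show "row_fns ?M ! r =
      (row_fns A @ [\<lambda>i. if i < m then u $ i else 0, \<lambda>i. if i < m then v $ i else 0]) ! r"
      unfolding l using A e[OF r] by cases (auto simp: row_fns_def nth_append fun_eq_iff)
  qed
qed

lemma twistor_eq_minor:
  assumes A: "A \<in> carrier_mat k (k + 2)" and Z: "Z \<in> carrier_mat n (k + 2)" and "i < n" "j < n"
  shows "twistor Z A i j = minor (row_fns A @ [mat_row Z i, mat_row Z j]) {..<k + 2}"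
proof -
  have r: "row Z i \<in> carrier_vec (k + 2)" "row Z j \<in> carrier_vec (k + 2)"
    using Z assms(3,4) row_carrier_vec by blast+
  let ?M = "A @\<^sub>r mat_of_rows (k + 2) [row Z i, row Z j]"
  have c: "?M \<in> carrier_mat (k + 2) (k + 2)" by (rule append_two_carrier[OF A])
  have m: "mat_row Z i = (\<lambda>x. if x < k + 2 then row Z i $ x else 0)" if "i < n" for i
    using Z that by (auto simp: mat_row_def fun_eq_iff)
  have "twistor Z A i j = det ?M" using Z unfolding twistor_def by simp
  also have "\<dots> = minor (row_fns ?M) {..<k + 2}" by (rule det_eq_minor_rows[OF c])
  finally show ?thesis unfolding row_fns_append_two[OF A r] m[OF assms(3)] m[OF assms(4)] .
qed

lemma row_fns_mult:
  assumes C: "C \<in> carrier_mat k n" and Z: "Z \<in> carrier_mat n m"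
  shows "row_fns (C * Z) = map (\<lambda>w \<kappa>. \<Sum>i<n. w i * mat_row Z i \<kappa>) (row_fns C)"
proof (rule nth_equalityI)
  fix r assume "r < length (row_fns (C * Z))"
  then have r: "r < k" using C by (simp add: length_row_fns)
  then show "row_fns (C * Z) ! r = map (\<lambda>w \<kappa>. \<Sum>i<n. w i * mat_row Z i \<kappa>) (row_fns C) ! r"
    using C Z by (auto simp: row_fns_def mat_row_def scalar_prod_def fun_eq_iff lessThan_atLeast0 intro!: sum.cong)
qed (use C in \<open>simp add: length_row_fns\<close>)

lemma minor_rows_submatrix:
  assumes Z: "Z \<in> carrier_mat n m" and J: "J \<in> ksubsets m n"
  shows "minor (map (mat_row Z) (sorted_list_of_set J)) {..<m} = det (submatrix Z J UNIV)"
proof -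
  have fin: "finite J" "card J = m" "J \<subseteq> {0..<n}" using J by (auto simp: ksubsets_def intro: finite_subset)
  have cJ: "{j. j < n \<and> j \<in> J} = J" using fin by auto
  have mono: "pick J c < pick J c'" if "c < c'" "c' < m" for c c'
    using pick_mono_le[of c' J c] fin that by simp
  have S: "submatrix Z J UNIV \<in> carrier_mat m m" using Z fin cJ by (simp add: submatrix_def)
  have "map (pick J) [0..<m] = sorted_list_of_set J"
  proof (rule sorted_distinct_set_unique)
    show "sorted (map (pick J) [0..<m])"
      using mono by (auto simp: sorted_iff_nth_mono_less less_imp_le)
    have inj: "inj_on (pick J) {0..<m}"
      using mono by (intro linorder_inj_onI) (auto simp: less_imp_neq)
    then show "distinct (map (pick J) [0..<m])" by (simp add: distinct_map)
    have "pick J ` {0..<m} = J"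
    proof (rule card_subset_eq[OF fin(1)])
      show "pick J ` {0..<m} \<subseteq> J" using fin pick_in_set_le by auto
      show "card (pick J ` {0..<m}) = card J" using inj fin by (simp add: card_image)
    qed
    then show "set (map (pick J) [0..<m]) = set (sorted_list_of_set J)" using fin by simp
  qed (use fin in auto)
  then have "map (mat_row Z) (sorted_list_of_set J) = map (mat_row Z) (map (pick J) [0..<m])" by simp
  also have "\<dots> = row_fns (submatrix Z J UNIV)"
    using Z fin cJ unfolding row_fns_def mat_row_def by (auto simp: submatrix_def pick_UNIV fun_eq_iff)
  finally show ?thesis using det_eq_minor_rows[OF S] by simp
qed

text \<open>The matrix \<open>C * Z\<close> with two more rows of \<open>Z\<close> is the product with \<open>Z\<close> of the matrix \<open>C\<close> with two more
  unit rows, whose minors are signed Pluecker coordinates of \<open>C\<close>; so the Cauchy-Binet formula applies.\<close>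

lemma twistor_expansion:
  assumes C: "C \<in> carrier_mat k n" and Z: "Z \<in> carrier_mat n (k + 2)" and hj: "h < j" "j < n"
  shows "twistor Z (C * Z) h j = (\<Sum>J\<in>{J \<in> ksubsets (k + 2) n. h \<in> J \<and> j \<in> J}.
    (-1) ^ card (J \<inter> {h<..<j}) * plucker C (J - {h, j}) * det (submatrix Z J UNIV))"
proof -
  let ?K = "{..<k + 2}" and ?e = "\<lambda>h i. of_bool (i = h) :: real"
  have e: "(\<lambda>\<kappa>. \<Sum>i<n. ?e h i * mat_row Z i \<kappa>) = mat_row Z h" if "h < n" for h
    using that by (auto simp: fun_eq_iff of_bool_def if_distrib[of "\<lambda>x. x * _"] sum.delta cong: if_cong)
  have l: "length (row_fns C @ [?e h, ?e j]) = k + 2" using C by (simp add: length_row_fns)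
  have "twistor Z (C * Z) h j = minor (row_fns (C * Z) @ [mat_row Z h, mat_row Z j]) ?K"
    using C Z hj by (intro twistor_eq_minor) auto
  also have "\<dots> = minor (map (\<lambda>w \<kappa>. \<Sum>i<n. w i * mat_row Z i \<kappa>) (row_fns C @ [?e h, ?e j])) ?K"
    unfolding row_fns_mult[OF C Z] using e hj by simp
  also have "\<dots> = (\<Sum>J\<in>ksubsets (k + 2) n. minor (row_fns C @ [?e h, ?e j]) J *
      minor (map (mat_row Z) (sorted_list_of_set J)) ?K)"
    using minor_Cauchy_Binet[where K = ?K and n = n and Z = "mat_row Z" and R = "row_fns C @ [?e h, ?e j]"] unfolding l by simp
  also have "\<dots> = (\<Sum>J\<in>ksubsets (k + 2) n. if h \<in> J \<and> j \<in> J then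
      (-1) ^ card (J \<inter> {h<..<j}) * plucker C (J - {h, j}) * det (submatrix Z J UNIV) else 0)"
  proof (rule sum.cong[OF refl])
    fix J assume J: "J \<in> ksubsets (k + 2) n"
    note fJ = ksubsets_finite[OF J]
    have "J - {h, j} \<in> ksubsets k n" if "h \<in> J" "j \<in> J"
      using J that hj fJ by (auto simp: ksubsets_def card_Diff_subset)
    then show "minor (row_fns C @ [?e h, ?e j]) J * minor (map (mat_row Z) (sorted_list_of_set J)) ?K =
      (if h \<in> J \<and> j \<in> J then
      (-1) ^ card (J \<inter> {h<..<j}) * plucker C (J - {h, j}) * det (submatrix Z J UNIV) else 0)"
      using minor_unit_rows[OF fJ hj(1), of "row_fns C"] minor_rows_submatrix[OF Z J] plucker_eq_minor[OF C]
      by simp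
  qed
  also have "\<dots> = (\<Sum>J\<in>{J \<in> ksubsets (k + 2) n. h \<in> J \<and> j \<in> J}.
    (-1) ^ card (J \<inter> {h<..<j}) * plucker C (J - {h, j}) * det (submatrix Z J UNIV))"
    using finite_ksubsets by (simp add: sum.inter_filter)
  finally show ?thesis .
qed

text \<open>All terms of the expansion have the sign \<open>(-1) ^ a\<close>, and the one belonging to \<open>I0\<close> is nonzero.\<close>

lemma sgn_twistor:
  assumes C: "C \<in> carrier_mat k n" and Z: "Z \<in> Mat_pos n (k + 2)" and hj: "h < j" "j < n"
    and nonneg: "\<And>I. I \<in> ksubsets k n \<Longrightarrow> plucker C I \<ge> 0"
    and a: "\<And>I. I \<in> ksubsets k n \<Longrightarrow> plucker C I \<noteq> 0 \<Longrightarrow> h \<notin> I \<Longrightarrow> j \<notin> I \<Longrightarrow> card (I \<inter> {h<..<j}) = a"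
    and ex: "I0 \<in> ksubsets k n" "plucker C I0 > 0" "h \<notin> I0" "j \<notin> I0"
  shows "sgn (twistor Z (C * Z) h j) = (-1) ^ a"
proof -
  have Zc: "Z \<in> carrier_mat n (k + 2)" and Zp: "\<And>J. J \<in> ksubsets (k + 2) n \<Longrightarrow> det (submatrix Z J UNIV) > 0"
    using Z unfolding Mat_pos_def by auto
  let ?X = "{J \<in> ksubsets (k + 2) n. h \<in> J \<and> j \<in> J}"
  let ?s = "\<Sum>J\<in>?X. plucker C (J - {h, j}) * det (submatrix Z J UNIV)"
  have mem: "J - {h, j} \<in> ksubsets k n" if "J \<in> ?X" for J
    using that hj ksubsets_finite[of J] by (auto simp: ksubsets_def card_Diff_subset)
  have "twistor Z (C * Z) h j = (\<Sum>J\<in>?X. (-1) ^ a * (plucker C (J - {h, j}) * det (submatrix Z J UNIV)))"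
    unfolding twistor_expansion[OF C Zc hj]
  proof (rule sum.cong[OF refl])
    fix J assume J: "J \<in> ?X"
    have "(J - {h, j}) \<inter> {h<..<j} = J \<inter> {h<..<j}" by auto
    then have "card (J \<inter> {h<..<j}) = a" if "plucker C (J - {h, j}) \<noteq> 0"
      using a[OF mem[OF J] that] by simp
    then show "(-1) ^ card (J \<inter> {h<..<j}) * plucker C (J - {h, j}) * det (submatrix Z J UNIV) =
      (-1) ^ a * (plucker C (J - {h, j}) * det (submatrix Z J UNIV))"
      by (cases "plucker C (J - {h, j}) = 0") auto
  qed
  also have "\<dots> = (-1) ^ a * ?s" by (simp add: sum_distrib_left)
  finally have t: "twistor Z (C * Z) h j = (-1) ^ a * ?s" .
  have f0: "finite I0" using ex ksubsets_finite by blast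
  let ?J0 = "I0 \<union> {h, j}"
  have J0: "?J0 \<in> ?X" using ex hj f0 by (auto simp: ksubsets_def)
  have "?J0 - {h, j} = I0" using ex by auto
  then have pos: "plucker C (?J0 - {h, j}) * det (submatrix Z ?J0 UNIV) > 0" using ex Zp J0 by simp
  have "finite ?X" using finite_ksubsets by simp
  then have "?s > 0" using J0 pos
  proof (rule sum_pos2)
    fix J assume J: "J \<in> ?X"
    then show "0 \<le> plucker C (J - {h, j}) * det (submatrix Z J UNIV)"
      using nonneg[OF mem[OF J]] Zp[of J] by (simp add: less_imp_le)
  qed
  moreover have "sgn ((-1 :: real) ^ a) = (-1) ^ a" by (cases "even a") auto
  ultimately show ?thesis unfolding t by (simp add: sgn_mult)
qed

lemma right_inverse_from_twistor:
  assumes A: "A \<in> carrier_mat k (k + 2)" and Z: "Z \<in> carrier_mat n (k + 2)" and "i < n" "j < n"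
    and nz: "twistor Z A i j \<noteq> 0"
  obtains X where "X \<in> carrier_mat (k + 2) k" "A * X = 1\<^sub>m k"
proof -
  let ?W = "mat_of_rows (k + 2) [row Z i, row Z j]"
  let ?M = "A @\<^sub>r ?W"
  have W: "dim_row ?W = 2" "dim_col ?W = k + 2" by simp_all
  have c: "?M \<in> carrier_mat (k + 2) (k + 2)" by (rule append_two_carrier[OF A])
  have "det ?M \<noteq> 0" using nz Z unfolding twistor_def by simp
  then obtain B where B: "B \<in> carrier_mat (k + 2) (k + 2)" "?M * B = 1\<^sub>m (k + 2)"
    using two_sided_inverse[OF c] by metis
  define X where "X = mat (k + 2) k (\<lambda>(r, c). B $$ (r, c))"
  have X: "X \<in> carrier_mat (k + 2) k" unfolding X_def by simp
  have "A * X = 1\<^sub>m k"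
  proof (rule eq_matI)
    fix r s assume "r < dim_row (1\<^sub>m k :: real mat)" "s < dim_col (1\<^sub>m k :: real mat)"
    then have rs: "r < k" "s < k" by auto
    have "row ?M r = row A r"
      using A W rs by (intro eq_vecI) (auto simp: append_rows_def)
    moreover have "col B s = col X s" unfolding X_def using B rs by (intro eq_vecI) auto
    moreover have "(?M * B) $$ (r, s) = row ?M r \<bullet> col B s" using c B rs by (intro index_mult_mat) auto
    moreover have "(A * X) $$ (r, s) = row A r \<bullet> col X s" using A X rs by (intro index_mult_mat) auto
    ultimately show "(A * X) $$ (r, s) = 1\<^sub>m k $$ (r, s)" using B(2) rs by simp
  qed (use A X in auto)
  with X that show ?thesis by blast
qed

lemma minor_linear_at:
  "minor (R @ (\<lambda>i. a * u i + b * v i) # R') I = a * minor (R @ u # R') I + b * minor (R @ v # R') I"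
proof (induction R arbitrary: I)
  case Nil
  show ?case unfolding append_Nil by (rule minor_linear)
next
  case (Cons w R)
  show ?case unfolding append_Cons minor.simps Cons.IH sum_distrib_left sum.distrib[symmetric]
    by (rule sum.cong) (simp_all add: algebra_simps)
qed

lemma minor_swap_at:
  assumes "finite I"
  shows "minor (R @ u # v # R') I = - minor (R @ v # u # R') I"
  using assms
proof (induction R arbitrary: I)
  case Nil
  then show ?case unfolding append_Nil by (rule minor_swap)
next
  case (Cons w R)
  have "minor (R @ u # v # R') (I - {i}) = - minor (R @ v # u # R') (I - {i})" for i
    using Cons by simp
  then show ?case unfolding append_Cons minor.simps by (simp add: sum_negf)
qed

lemma twistor_swap:
  assumes "A \<in> carrier_mat k (k + 2)" "Z \<in> carrier_mat n (k + 2)" "i < n" "j < n"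
  shows "twistor Z A j i = - twistor Z A i j"
  unfolding twistor_eq_minor[OF assms(1,2,4,3)] twistor_eq_minor[OF assms(1,2,3,4)]
  by (rule minor_swap_at) simp

text \<open>Modulo the row space of \<open>A\<close> the rows of \<open>Z\<close> are vectors in a plane, and \<open>w\<close> is the linear relation
  that any three vectors of a plane satisfy. Concretely, the rows of \<open>A\<close> together with rows \<open>b\<close> and \<open>c\<close> of
  \<open>Z\<close> are a basis, and by Cramer's rule \<open>w\<close> has coefficient \<open>0\<close> at the last two.\<close>

lemma three_term_in_row_space:
  assumes A: "A \<in> carrier_mat k (k + 2)" and Z: "Z \<in> carrier_mat n (k + 2)"
    and abc: "a < n" "b < n" "c < n" and nz: "twistor Z A b c \<noteq> 0"
  defines "w \<equiv> vec (k + 2) (\<lambda>\<kappa>. twistor Z A b c * Z $$ (a, \<kappa>) - twistor Z A a c * Z $$ (b, \<kappa>)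
      + twistor Z A a b * Z $$ (c, \<kappa>))"
  shows "\<exists>y\<in>carrier_vec k. A\<^sup>T *\<^sub>v y = w"
proof -
  let ?f = "twistor Z A" and ?m = "k + 2"
  let ?W = "mat_of_rows ?m [row Z b, row Z c]"
  let ?M = "A @\<^sub>r ?W"
  have r: "row Z i \<in> carrier_vec ?m" if "i < n" for i using Z that by auto
  have wc: "w \<in> carrier_vec ?m" unfolding w_def by simp
  have W: "dim_row ?W = 2" "dim_col ?W = ?m" by simp_all
  have cM: "?M \<in> carrier_mat ?m ?m" by (rule append_two_carrier[OF A])
  have dM: "det ?M = ?f b c" using Z unfolding twistor_def by simp
  then obtain B where B: "B \<in> carrier_mat ?m ?m" "B * ?M = 1\<^sub>m ?m"
    using two_sided_inverse[OF cM] nz by metis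
  define x where "x = B\<^sup>T *\<^sub>v w"
  have x: "x \<in> carrier_vec ?m" unfolding x_def using B wc by simp
  have "?M\<^sup>T * B\<^sup>T = 1\<^sub>m ?m" using transpose_mult[OF B(1) cM] B(2) by simp
  then have Mx: "?M\<^sup>T *\<^sub>v x = w" unfolding x_def
    using cM B wc assoc_mult_mat_vec[of "?M\<^sup>T" ?m ?m "B\<^sup>T" ?m w] by simp
  define g where "g = (\<lambda>i. if i < ?m then w $ i else 0)"
  have gw: "g = (\<lambda>\<kappa>. 1 * (\<lambda>\<kappa>. ?f b c * mat_row Z a \<kappa> + (- ?f a c) * mat_row Z b \<kappa>) \<kappa> + ?f a b * mat_row Z c \<kappa>)"
    unfolding g_def w_def mat_row_def using Z by (auto simp: fun_eq_iff)
  let ?mn = "\<lambda>u v. minor (row_fns A @ [u, v]) {..<?m}"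
  have mr: "mat_row Z i = (\<lambda>x. if x < ?m then row Z i $ x else 0)" if "i < n" for i
    using Z that by (auto simp: mat_row_def fun_eq_iff)
  have f: "?mn (mat_row Z i) (mat_row Z j) = ?f i j" if "i < n" "j < n" for i j
    using twistor_eq_minor[OF A Z that] by simp
  have f0: "?f i i = 0" if "i < n" for i using twistor_swap[OF A Z that that] by simp
  have lin1: "?mn (\<lambda>i. p * u i + q * v i) z = p * ?mn u z + q * ?mn v z" for p q u v z
    by (rule minor_linear_at)
  have lin2: "?mn z (\<lambda>i. p * u i + q * v i) = p * ?mn z u + q * ?mn z v" for p q u v z
    using minor_linear_at[of "row_fns A @ [z]" p u q v "[]"] by simp
  have k0: "?mn g (mat_row Z c) = 0"
    unfolding gw lin1 using f abc f0 by simp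
  have k1: "?mn (mat_row Z b) g = 0"
    unfolding gw lin2 using f abc f0 twistor_swap[OF A Z abc(1,2)] by simp
  have rep: "x $ i * ?f b c = 0" if i: "i = k \<or> i = k + 1" for i
  proof -
    have ik: "i < ?m" using i by auto
    have "x $ i * ?f b c = det (replace_col (?M\<^sup>T) w i)"
      using cramer_lemma_mat[of "?M\<^sup>T" ?m x i] cM x ik Mx det_transpose[OF cM] dM by simp
    also have "replace_col (?M\<^sup>T) w i =
      (A @\<^sub>r mat_of_rows ?m (if i = k then [w, row Z c] else [row Z b, w]))\<^sup>T" (is "_ = ?N\<^sup>T")
      using A i wc r abc Z by (intro eq_matI)
        (auto simp: replace_col_def append_rows_def mat_of_rows_def less_Suc_eq nth_Cons')
    also have "det (?N\<^sup>T) = det ?N"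
      by (rule det_transpose[of _ ?m])
        (use append_two_carrier[OF A, of w "row Z c"] append_two_carrier[OF A, of "row Z b" w] in auto)
    also have "det ?N = minor (row_fns ?N) {..<?m}"
      by (rule det_eq_minor_rows)
        (use append_two_carrier[OF A, of w "row Z c"] append_two_carrier[OF A, of "row Z b" w] in auto)
    also have "\<dots> = 0"
      using i row_fns_append_two[OF A wc r[OF abc(3)]] row_fns_append_two[OF A r[OF abc(2)] wc]
        k0 k1 unfolding g_def mr[OF abc(2)] mr[OF abc(3)] by auto
    finally show ?thesis .
  qed
  then have x0: "x $ k = 0" "x $ (k + 1) = 0" using nz by auto
  define y where "y = vec k (\<lambda>i. x $ i)"
  have "A\<^sup>T *\<^sub>v y = ?M\<^sup>T *\<^sub>v x"
  proof (rule eq_vecI)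
    fix \<kappa> assume "\<kappa> < dim_vec (?M\<^sup>T *\<^sub>v x)"
    then have \<kappa>: "\<kappa> < ?m" using cM by simp
    have "(?M\<^sup>T *\<^sub>v x) $ \<kappa> = (\<Sum>i<?m. ?M $$ (i, \<kappa>) * x $ i)"
      using cM x \<kappa> by (auto simp: scalar_prod_def lessThan_atLeast0 intro!: sum.cong)
    also have "\<dots> = (\<Sum>i<k. ?M $$ (i, \<kappa>) * x $ i)" using x0 by simp
    also have "\<dots> = (\<Sum>i<k. A $$ (i, \<kappa>) * y $ i)"
      using A W \<kappa> by (intro sum.cong) (auto simp: append_rows_def y_def)
    also have "\<dots> = (A\<^sup>T *\<^sub>v y) $ \<kappa>"
      using A \<kappa> by (auto simp: scalar_prod_def y_def lessThan_atLeast0 intro!: sum.cong)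
    finally show "(A\<^sup>T *\<^sub>v y) $ \<kappa> = (?M\<^sup>T *\<^sub>v x) $ \<kappa>" by simp
  qed (use A cM in auto)
  then show ?thesis using Mx unfolding y_def by (intro bexI[of _ "vec k (\<lambda>i. x $ i)"]) auto
qed

section \<open>Signs on the amplituhedron side\<close>

lemma leibniz_term_map:
  assumes "sorted ms" "distinct ms" "inj_on X (set ms)"
  shows "leibniz_term (map w ms) (map X ms) =
    (-1) ^ card {(b, b'). b \<in> set ms \<and> b' \<in> set ms \<and> b < b' \<and> X b' < X b} * (\<Prod>b\<in>set ms. w b (X b))"
  using assms
proof (induction ms)
  case (Cons m ms)
  let ?P = "\<lambda>ms. {(b, b'). b \<in> set ms \<and> b' \<in> set ms \<and> b < b' \<and> X b' < X b}"
  let ?N = "{b' \<in> set ms. X b' < X m}"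
  have lt: "m < b" if "b \<in> set ms" for b
    using Cons.prems that by (auto simp: le_less)
  have "?P (m # ms) = ?P ms \<union> {m} \<times> ?N" using lt by (auto dest: less_asym)
  moreover have "?P ms \<inter> {m} \<times> ?N = {}" using lt by auto
  moreover have "finite (?P ms)" by (rule finite_subset[of _ "set ms \<times> set ms"]) auto
  moreover have "card ({m} \<times> ?N) = card ?N" by (simp add: card_cartesian_product)
  ultimately have c: "card (?P (m # ms)) = card (?P ms) + card ?N"
    by (simp add: card_Un_disjoint)
  have "{y \<in> set (map X ms). y < X m} = X ` ?N" by auto
  moreover have "inj_on X ?N" by (rule inj_on_subset[OF Cons.prems(3)]) auto
  ultimately have "card {y \<in> set (map X ms). y < X m} = card ?N" by (simp only: card_image)
  moreover have "leibniz_term (map w ms) (map X ms) = (-1) ^ card (?P ms) * (\<Prod>b\<in>set ms. w b (X b))"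
    using Cons by (auto intro: inj_on_subset)
  ultimately have "leibniz_term (map w (m # ms)) (map X (m # ms)) =
      (-1) ^ card ?N * w m (X m) * ((-1) ^ card (?P ms) * (\<Prod>b\<in>set ms. w b (X b)))"
    by simp
  also have "\<dots> = (-1) ^ card (?P (m # ms)) * (\<Prod>b\<in>set (m # ms). w b (X b))"
    unfolding c using Cons.prems(2) by (simp add: power_add mult_ac)
  finally show ?case .
qed simp

lemma bij_betw_filter:
  assumes "bij_betw f A B" "\<And>x. x \<in> A \<Longrightarrow> P x \<longleftrightarrow> Q (f x)"
  shows "bij_betw f {x \<in> A. P x} {y \<in> B. Q y}"
proof -
  have "inj_on f A" and im: "f ` A = B" using assms(1) by (auto simp: bij_betw_def)
  then have "inj_on f {x \<in> A. P x}" by (auto intro: inj_on_subset)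
  moreover have "f ` {x \<in> A. P x} = {y \<in> f ` A. Q y}" using assms(2) by auto
  ultimately show ?thesis unfolding im bij_betw_def by simp
qed

context triangulated
begin

lemma tri_dichotomy:
  assumes hj: "arc h j" and t: "t \<in> faces n D"
  shows "t \<subseteq> {h..j} \<or> t \<inter> {h<..<j} = {}"
proof (rule ccontr)
  assume n: "\<not> ?thesis"
  obtain a b c where abc: "tri a b c" "t = {a, b, c}" by (rule faceE_tri[OF t])
  note d = triD[OF abc(1)]
  obtain v where v: "v \<in> t" "h < v" "v < j" using n by auto
  have "a \<le> v" "v \<le> c" using v abc d by auto
  then have "a \<le> h \<and> j \<le> c \<or> h \<le> a \<and> c \<le> j"
    using arcs_nested[OF d(3) hj] v by linarith
  moreover have "\<not> (h \<le> a \<and> c \<le> j)" using n abc d by auto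
  ultimately have ac: "a \<le> h" "j \<le> c" "(h, j) \<noteq> (a, c)" by auto
  then have "v = b" using v abc by auto
  then show False using tri_hidden[OF abc(1) hj ac] v by auto
qed

text \<open>A triangle on the left of the arc is represented by a vertex between its ends, since the ends
  themselves are not available; a triangle on the right has no vertex there.\<close>

lemma transversal_between:
  assumes B: "B \<subseteq> faces n D" and I: "transversal I B" and hj: "arc h j" "h \<notin> I" "j \<notin> I"
  shows "card (I \<inter> {h<..<j}) = count_in B h j"
proof -
  obtain \<phi> where \<phi>: "bij_betw \<phi> I B" "\<And>i. i \<in> I \<Longrightarrow> i \<in> \<phi> i" using I unfolding transversal_def by blast
  have iff: "\<phi> i \<subseteq> {h..j} \<longleftrightarrow> i \<in> {h<..<j}" if i: "i \<in> I" for i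
  proof
    assume "\<phi> i \<subseteq> {h..j}"
    then have "i \<in> {h..j}" using \<phi>(2)[OF i] by blast
    then show "i \<in> {h<..<j}" using hj i by (auto simp: le_less)
  next
    assume "i \<in> {h<..<j}"
    moreover have "\<phi> i \<in> faces n D" using \<phi>(1) i B bij_betwE by blast
    ultimately show "\<phi> i \<subseteq> {h..j}" using tri_dichotomy[OF hj(1)] \<phi>(2)[OF i] by blast
  qed
  have "bij_betw \<phi> {i \<in> I. i \<in> {h<..<j}} {t \<in> B. t \<subseteq> {h..j}}"
    using iff by (intro bij_betw_filter[OF \<phi>(1)]) simp
  moreover have "{i \<in> I. i \<in> {h<..<j}} = I \<inter> {h<..<j}" by blast
  ultimately show ?thesis unfolding count_in_def using bij_betw_same_card by fastforce
qed

lemma polygon_full: "polygon {0..<n}"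
  using n3 unfolding polygon_def sides_def by auto

text \<open>Represent all triangles of the \<open>n\<close>-gon by the vertices other than \<open>h\<close> and \<open>j\<close>, and keep the
  representatives of black triangles.\<close>

lemma transversal_avoiding:
  assumes B: "B \<subseteq> faces n D" and hj: "arc h j"
  obtains I where "I \<subseteq> {0..<n}" "transversal I B" "h \<notin> I" "j \<notin> I"
proof -
  have b: "h < n" "j < n" "h \<noteq> j" using arc_less[OF hj] arc_bound[OF hj] by auto
  have F: "{t \<in> faces n D. t \<subseteq> {0..<n}} = faces n D" unfolding faces_def by auto
  have "transversal ({0..<n} - {h, j}) (faces n D)"
    using polygon_transversal[OF polygon_full, of h j] b F by simp
  then obtain \<phi> where \<phi>: "bij_betw \<phi> ({0..<n} - {h, j}) (faces n D)"
    "\<And>i. i \<in> {0..<n} - {h, j} \<Longrightarrow> i \<in> \<phi> i" unfolding transversal_def by blast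
  define I where "I = {i \<in> {0..<n} - {h, j}. \<phi> i \<in> B}"
  have "bij_betw \<phi> I {t \<in> faces n D. t \<in> B}"
    unfolding I_def by (rule bij_betw_filter[OF \<phi>(1)]) simp
  moreover have "{t \<in> faces n D. t \<in> B} = B" using B by blast
  ultimately have "bij_betw \<phi> I B" by simp
  moreover have sub: "I \<subseteq> {0..<n} - {h, j}" unfolding I_def by blast
  ultimately have "transversal I B" unfolding transversal_def using \<phi>(2) by blast
  then show ?thesis using that[of I] sub by blast
qed

lemma twistor_signs:
  assumes B: "B \<subseteq> faces n D" "card B = k" and C: "C \<in> carrier_mat k n" and Z: "Z \<in> Mat_pos n (k + 2)"
    and pos: "\<And>I. I \<in> ksubsets k n \<Longrightarrow> if transversal I B then plucker C I > 0 else plucker C I = 0"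
    and hj: "arc h j"
  shows "sgn (twistor Z (C * Z) h j) = (-1) ^ count_in B h j"
proof -
  obtain I0 where I0: "I0 \<subseteq> {0..<n}" "transversal I0 B" "h \<notin> I0" "j \<notin> I0"
    by (rule transversal_avoiding[OF B(1) hj])
  then have "I0 \<in> ksubsets k n" using transversal_card B(2) unfolding ksubsets_def by auto
  moreover from this have "plucker C I0 > 0" using pos I0 by force
  moreover have "plucker C I \<ge> 0" if "I \<in> ksubsets k n" for I
    using pos[OF that] by (auto split: if_splits)
  moreover have "transversal I B" if "I \<in> ksubsets k n" "plucker C I \<noteq> 0" for I
    using pos[OF that(1)] that(2) by (auto split: if_splits)
  ultimately show ?thesis
    using sgn_twistor[OF C Z arc_less[OF hj] arc_bound[OF hj]] transversal_between[OF B(1) _ hj] I0 by metis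
qed

text \<open>For the converse the rows of \<open>C\<close> are indexed by the black triangles, in the order of their middle
  vertices; \<open>lo b\<close> and \<open>hi b\<close> are the other two vertices of the triangle with middle vertex \<open>b\<close>.\<close>

definition lo :: "nat \<Rightarrow> nat" where "lo b = (THE a. \<exists>c. tri a b c)"
definition hi :: "nat \<Rightarrow> nat" where "hi b = (THE c. \<exists>a. tri a b c)"
definition corners :: "nat \<Rightarrow> nat set" where "corners b = {lo b, b, hi b}"
definition mids :: "nat set set \<Rightarrow> nat set" where "mids B = {b. \<exists>a c. tri a b c \<and> {a, b, c} \<in> B}"

lemma lo_hi:
  assumes "tri a b c" shows "lo b = a \<and> hi b = c"
proof
  show "lo b = a" unfolding lo_def using assms tri_mid_unique[OF assms] by (intro the_equality) blast+
  show "hi b = c" unfolding hi_def using assms tri_mid_unique[OF assms] by (intro the_equality) blast+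
qed

lemma midsD:
  assumes "b \<in> mids B"
  shows "tri (lo b) b (hi b)" "corners b \<in> B" "lo b < b" "b < hi b" "hi b < n"
proof -
  obtain a c where t: "tri a b c" "{a, b, c} \<in> B" using assms unfolding mids_def by blast
  then show "tri (lo b) b (hi b)" "corners b \<in> B" using lo_hi[OF t(1)] unfolding corners_def by auto
  then show "lo b < b" "b < hi b" "hi b < n" using triD by auto
qed

lemma corners_bij:
  assumes "B \<subseteq> faces n D"
  shows "bij_betw corners (mids B) B"
proof (rule bij_betwI')
  fix x y assume xy: "x \<in> mids B" "y \<in> mids B"
  show "(corners x = corners y) = (x = y)"
  proof
    assume "corners x = corners y"
    then show "x = y"
      using tri_eq(2)[OF midsD(1)[OF xy(1)] midsD(1)[OF xy(2)]] unfolding corners_def by simp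
  qed simp
next
  fix t assume t: "t \<in> B"
  then have tf: "t \<in> faces n D" using assms by blast
  obtain a b c where abc: "tri a b c" "t = {a, b, c}" by (rule faceE_tri[OF tf])
  then have "b \<in> mids B" "corners b = t" using t lo_hi unfolding mids_def corners_def by auto
  then show "\<exists>x\<in>mids B. t = corners x" by blast
qed (use midsD in auto)

lemma finite_mids: "finite (mids B)"
proof (rule finite_subset)
  show "mids B \<subseteq> {..<n}" using midsD(4,5) by (metis lessThan_iff order.strict_trans subsetI)
qed simp

lemma count_in_mids:
  assumes "B \<subseteq> faces n D"
  shows "count_in B h j = card {b \<in> mids B. corners b \<subseteq> {h..j}}"
proof -
  have "bij_betw corners {b \<in> mids B. corners b \<subseteq> {h..j}} {t \<in> B. t \<subseteq> {h..j}}"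
    by (rule bij_betw_filter[OF corners_bij[OF assms]]) simp
  then show ?thesis unfolding count_in_def by (simp add: bij_betw_same_card)
qed

lemma relative_position:
  assumes "tri a b c" "tri a' b' c'" "b < b'"
  shows "b \<le> a' \<and> c' \<le> c \<or> a' \<le> a \<and> c \<le> b' \<or> c \<le> a'"
proof (rule ccontr)
  assume n: "\<not> ?thesis"
  note d = triD[OF assms(1)] and d' = triD[OF assms(2)]
  have "a' < c" using n by simp
  moreover have "a < c'" using d(1,2) d'(1,2) assms(3) by linarith
  ultimately have "a \<le> a' \<and> c' \<le> c \<or> a' \<le> a \<and> c \<le> c'"
    using arcs_nested[OF d(3) d'(3)] by linarith
  then show False
  proof
    assume i: "a \<le> a' \<and> c' \<le> c"
    then have "a' < b" using n by auto
    show False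
    proof (cases "(a', c') = (a, c)")
      case True
      then have "b = b'" using tri_unique[of a b c b'] assms(1,2) by simp
      then show False using assms(3) by simp
    next
      case False
      then have "c' \<le> b \<or> b \<le> a'" using tri_hidden[OF assms(1) d'(3)] i by blast
      then show False using d'(1,2) assms(3) \<open>a' < b\<close> by linarith
    qed
  next
    assume o: "a' \<le> a \<and> c \<le> c'"
    show False
    proof (cases "(a, c) = (a', c')")
      case True
      then have "b = b'" using tri_unique[of a b c b'] assms(1,2) by simp
      then show False using assms(3) by simp
    next
      case False
      then have "c \<le> b' \<or> b' \<le> a" using tri_hidden[OF assms(2) d(3)] o by blast
      then show False using n o d(1,2) assms(3) by linarith
    qed
  qed
qed

text \<open>The inversions of a choice of one corner from every black triangle come from the triangles under
  the lower edge next to a chosen outer corner.\<close>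

lemma inversion_count:
  assumes B: "B \<subseteq> faces n D" and X: "inj_on X (mids B)" "\<And>b. b \<in> mids B \<Longrightarrow> X b \<in> corners b"
  shows "card {(b, b'). b \<in> mids B \<and> b' \<in> mids B \<and> b < b' \<and> X b' < X b} =
    (\<Sum>b\<in>mids B. (if X b = hi b then count_in B b (hi b) else 0) +
                  (if X b = lo b then count_in B (lo b) b else 0))"
proof -
  let ?M = "mids B"
  let ?P = "{(b, b'). b \<in> ?M \<and> b' \<in> ?M \<and> b < b' \<and> X b' < X b}"
  define P1 where "P1 = (SIGMA b:?M. {b' \<in> ?M. X b = hi b \<and> corners b' \<subseteq> {b..hi b}})"
  define P2 where "P2 = (SIGMA b':?M. {b \<in> ?M. X b' = lo b' \<and> corners b \<subseteq> {lo b'..b'}})"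
  have sub: "corners b \<subseteq> {h..j} \<longleftrightarrow> h \<le> lo b \<and> hi b \<le> j" if "b \<in> ?M" for b h j
    using midsD[OF that] unfolding corners_def by auto
  have Xr: "lo b \<le> X b" "X b \<le> hi b" "X b = lo b \<or> X b = b \<or> X b = hi b" if "b \<in> ?M" for b
    using X(2)[OF that] midsD[OF that] unfolding corners_def by auto
  have neq: "X b \<noteq> X b'" if "b \<in> ?M" "b' \<in> ?M" "b \<noteq> b'" for b b'
    using X(1) that by (auto simp: inj_on_def)
  have "?P = P1 \<union> prod.swap ` P2"
  proof
    show "?P \<subseteq> P1 \<union> prod.swap ` P2"
    proof
      fix p assume "p \<in> ?P"
      then obtain b b' where p: "p = (b, b')" and m: "b \<in> ?M" "b' \<in> ?M" and lt: "b < b'" "X b' < X b" by blast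
      note d = midsD[OF m(1)] and d' = midsD[OF m(2)] and r = Xr[OF m(1)] and r' = Xr[OF m(2)]
      consider "b \<le> lo b' \<and> hi b' \<le> hi b" | "lo b' \<le> lo b \<and> hi b \<le> b'" | "hi b \<le> lo b'"
        using relative_position[OF d(1) d'(1) lt(1)] by blast
      then show "p \<in> P1 \<union> prod.swap ` P2"
      proof cases
        case 1
        then have "X b = hi b" using r r' lt d by linarith
        then have "p \<in> P1" unfolding P1_def p using m 1 sub by auto
        then show ?thesis by blast
      next
        case 2
        then have "X b' = lo b'" using r r' lt d' by linarith
        then have "(b', b) \<in> P2" unfolding P2_def using m 2 sub by auto
        then show ?thesis unfolding p by force
      next
        case 3
        then show ?thesis using r r' lt by linarith
      qed
    qed
    show "P1 \<union> prod.swap ` P2 \<subseteq> ?P"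
    proof
      fix p assume "p \<in> P1 \<union> prod.swap ` P2"
      then show "p \<in> ?P"
      proof
        assume "p \<in> P1"
        then obtain b b' where p: "p = (b, b')" and m: "b \<in> ?M" "b' \<in> ?M" and e: "X b = hi b" "corners b' \<subseteq> {b..hi b}"
          unfolding P1_def by blast
        have s: "b \<le> lo b'" "hi b' \<le> hi b" using e sub m by auto
        then have "b < b'" using midsD[OF m(2)] by auto
        moreover have "X b' < X b" using Xr[OF m(2)] s e neq[OF m] \<open>b < b'\<close> by auto
        ultimately show ?thesis using p m by auto
      next
        assume "p \<in> prod.swap ` P2"
        then obtain b b' where p: "p = (b, b')" and m: "b \<in> ?M" "b' \<in> ?M" and e: "X b' = lo b'" "corners b \<subseteq> {lo b'..b'}"
          unfolding P2_def by auto
        have s: "lo b' \<le> lo b" "hi b \<le> b'" using e sub m by auto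
        then have "b < b'" using midsD[OF m(1)] by auto
        moreover have "X b' < X b" using Xr[OF m(1)] s e neq[OF m] \<open>b < b'\<close> by auto
        ultimately show ?thesis using p m by auto
      qed
    qed
  qed
  moreover have "P1 \<inter> prod.swap ` P2 = {}"
  proof -
    have False if b: "b \<in> ?M" "b' \<in> ?M" "corners b' \<subseteq> {b..hi b}" "corners b \<subseteq> {lo b'..b'}" for b b'
    proof -
      have "b \<le> lo b'" "lo b' \<le> lo b" using b sub by auto
      then show False using midsD[OF b(1)] by auto
    qed
    then show ?thesis unfolding P1_def P2_def by auto
  qed
  moreover have f: "finite P1" "finite P2" unfolding P1_def P2_def using finite_mids by auto
  moreover have "card (prod.swap ` P2) = card P2" by (intro card_image) simp
  ultimately have "card ?P = card P1 + card P2" by (simp add: card_Un_disjoint)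
  moreover have "card P1 = (\<Sum>b\<in>?M. if X b = hi b then count_in B b (hi b) else 0)"
    unfolding P1_def using finite_mids
    by (subst card_SigmaI) (auto intro!: sum.cong simp: count_in_mids[OF B])
  moreover have "card P2 = (\<Sum>b\<in>?M. if X b = lo b then count_in B (lo b) b else 0)"
    unfolding P2_def using finite_mids
    by (subst card_SigmaI) (auto intro!: sum.cong simp: count_in_mids[OF B])
  ultimately show ?thesis by (simp add: sum.distrib)
qed

text \<open>If every \<open>f h j\<close> has the sign \<open>(-1) ^ count_in B h j\<close>, these are the coefficients of the three-term
  relation between the rows \<open>lo b\<close>, \<open>b\<close>, \<open>hi b\<close> of \<open>Z\<close>, up to a sign that makes the one at \<open>b\<close> positive.\<close>

definition crow :: "nat set set \<Rightarrow> (nat \<Rightarrow> nat \<Rightarrow> real) \<Rightarrow> nat \<Rightarrow> nat \<Rightarrow> real" where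
  "crow B f b i =
     (if i = lo b then \<bar>f b (hi b)\<bar> * (-1) ^ count_in B (lo b) b
      else if i = b then \<bar>f (lo b) (hi b)\<bar>
      else if i = hi b then \<bar>f (lo b) b\<bar> * (-1) ^ count_in B b (hi b) else 0)"

text \<open>The signs of the chosen entries cancel the sign of the inversions, so every nonzero term of the
  Leibniz expansion is positive; nonzero terms are choices of one corner per black triangle.\<close>

lemma crow_minor:
  assumes B: "B \<subseteq> faces n D" and f: "\<And>h j. arc h j \<Longrightarrow> f h j \<noteq> 0" and I: "finite I"
  shows "if transversal I B then minor (map (crow B f) (sorted_list_of_set (mids B))) I > 0
    else minor (map (crow B f) (sorted_list_of_set (mids B))) I = 0"
proof -
  let ?M = "mids B" and ?w = "crow B f"
  let ?ms = "sorted_list_of_set ?M"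
  let ?R = "map ?w ?ms"
  have ms: "sorted ?ms" "distinct ?ms" "set ?ms = ?M" using finite_mids by auto
  have lt: "if \<forall>b\<in>?M. X b \<in> corners b then leibniz_term ?R (map X ?ms) > 0
      else leibniz_term ?R (map X ?ms) = 0" if inj: "inj_on X ?M" for X
  proof (cases "\<forall>b\<in>?M. X b \<in> corners b")
    case False
    then obtain b where "b \<in> ?M" "X b \<notin> corners b" by blast
    then have "?w b (X b) = 0" unfolding crow_def corners_def by auto
    then have "(\<Prod>b\<in>?M. ?w b (X b)) = 0" using \<open>b \<in> ?M\<close> finite_mids by auto
    then show ?thesis using False leibniz_term_map[OF ms(1,2), of X ?w] inj ms(3) by simp
  next
    case True
    define e where "e = (\<lambda>b. (if X b = hi b then count_in B b (hi b) else 0) +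
                  (if X b = lo b then count_in B (lo b) b else 0))"
    have "?w b (X b) = (-1) ^ e b * \<bar>?w b (X b)\<bar> \<and> ?w b (X b) \<noteq> 0" if b: "b \<in> ?M" for b
    proof -
      note d = midsD[OF b] and t = triD[OF midsD(1)[OF b]]
      have "f b (hi b) \<noteq> 0" "f (lo b) (hi b) \<noteq> 0" "f (lo b) b \<noteq> 0" using f t by auto
      moreover have "X b = lo b \<or> X b = b \<or> X b = hi b" using True b unfolding corners_def by auto
      ultimately show ?thesis using d unfolding crow_def e_def
        by (auto simp: abs_mult power_abs)
    qed
    then have p: "?w b (X b) = (-1) ^ e b * \<bar>?w b (X b)\<bar>" "\<bar>?w b (X b)\<bar> > 0" if "b \<in> ?M" for b
      using that by auto
    have "(\<Prod>b\<in>?M. ?w b (X b)) = (\<Prod>b\<in>?M. (-1) ^ e b * \<bar>?w b (X b)\<bar>)"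
      using p(1) by (intro prod.cong) auto
    also have "\<dots> = (-1) ^ (\<Sum>b\<in>?M. e b) * (\<Prod>b\<in>?M. \<bar>?w b (X b)\<bar>)"
      by (simp add: prod.distrib power_sum)
    finally have "(\<Prod>b\<in>?M. ?w b (X b)) = (-1) ^ (\<Sum>b\<in>?M. e b) * (\<Prod>b\<in>?M. \<bar>?w b (X b)\<bar>)" .
    moreover have "card {(b, b'). b \<in> ?M \<and> b' \<in> ?M \<and> b < b' \<and> X b' < X b} = (\<Sum>b\<in>?M. e b)"
      unfolding e_def using inversion_count[OF B inj] True by blast
    ultimately have "leibniz_term ?R (map X ?ms) = (\<Prod>b\<in>?M. \<bar>?w b (X b)\<bar>)"
      using leibniz_term_map[OF ms(1,2), of X ?w] inj ms(3) by (simp add: power_mult_distrib[symmetric] flip: mult.assoc)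
    then show ?thesis using True p(2) by (simp add: prod_pos)
  qed
  have ex: "\<exists>X. xs = map X ?ms \<and> inj_on X ?M \<and> X ` ?M = I" if xs: "xs \<in> arrangements ?R I" for xs
  proof -
    have x: "length xs = length ?ms" "distinct xs" "set xs = I" using xs unfolding arrangements_def by auto
    define X where "X = (\<lambda>b. the (map_of (zip ?ms xs) b))"
    have "xs = map X ?ms"
      by (rule nth_equalityI) (use x ms in \<open>auto simp: X_def map_of_zip_nth\<close>)
    then show ?thesis using x ms distinct_map by (metis set_map)
  qed
  have nonneg: "leibniz_term ?R xs \<ge> 0" if "xs \<in> arrangements ?R I" for xs
    using ex[OF that] lt by (metis less_imp_le order_refl)
  have "(\<exists>xs\<in>arrangements ?R I. leibniz_term ?R xs > 0) \<longleftrightarrow> transversal I B"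
  proof
    assume "\<exists>xs\<in>arrangements ?R I. leibniz_term ?R xs > 0"
    then obtain X where X: "inj_on X ?M" "X ` ?M = I" "leibniz_term ?R (map X ?ms) > 0" using ex by blast
    then have c: "\<forall>b\<in>?M. X b \<in> corners b" using lt[OF X(1)] by (metis less_irrefl)
    let ?Y = "the_inv_into ?M X"
    have bX: "bij_betw X ?M I" using X unfolding bij_betw_def by blast
    have "bij_betw (corners \<circ> ?Y) I B"
      using bij_betw_the_inv_into[OF bX] corners_bij[OF B] by (rule bij_betw_trans)
    moreover have "i \<in> (corners \<circ> ?Y) i" if i: "i \<in> I" for i
    proof -
      have "?Y i \<in> ?M" "X (?Y i) = i"
        using X i by (auto intro: the_inv_into_into[OF X(1)] f_the_inv_into_f[OF X(1)])
      then show ?thesis using c by fastforce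
    qed
    ultimately show "transversal I B" unfolding transversal_def by blast
  next
    assume "transversal I B"
    then obtain \<phi> where \<phi>: "bij_betw \<phi> I B" "\<And>i. i \<in> I \<Longrightarrow> i \<in> \<phi> i" unfolding transversal_def by blast
    let ?Y = "the_inv_into I \<phi>"
    define X where "X = ?Y \<circ> corners"
    have bX: "bij_betw X ?M I"
      unfolding X_def using corners_bij[OF B] bij_betw_the_inv_into[OF \<phi>(1)] by (rule bij_betw_trans)
    have "X b \<in> corners b" if "b \<in> ?M" for b
    proof -
      have "corners b \<in> \<phi> ` I" using midsD(2)[OF that] \<phi>(1) unfolding bij_betw_def by blast
      moreover have "inj_on \<phi> I" using \<phi>(1) unfolding bij_betw_def by blast
      ultimately have "?Y (corners b) \<in> I" "\<phi> (?Y (corners b)) = corners b"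
        using the_inv_into_into[of \<phi> I "corners b" I] f_the_inv_into_f[of \<phi> I "corners b"] by blast+
      then show ?thesis using \<phi>(2) unfolding X_def by fastforce
    qed
    then have "leibniz_term ?R (map X ?ms) > 0" using lt[of X] bX unfolding bij_betw_def by auto
    moreover have "map X ?ms \<in> arrangements ?R I"
      unfolding arrangements_def using bX ms unfolding bij_betw_def by (auto simp: distinct_map)
    ultimately show "\<exists>xs\<in>arrangements ?R I. leibniz_term ?R xs > 0" by blast
  qed
  then show ?thesis using minor_no_cancellation[OF I nonneg] by (auto simp: less_le)
qed

text \<open>Each row of \<open>C * Z\<close> is an instance of the three-term relation, so \<open>C * Z = G * A\<close> for some square
  matrix \<open>G\<close>. It is invertible because the twistor coordinates of \<open>C * Z\<close> do not vanish.\<close>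

lemma amplituhedron_converse:
  assumes B: "B \<subseteq> faces n D" "card B = k" and A: "A \<in> carrier_mat k (k + 2)" and Z: "Z \<in> Mat_pos n (k + 2)"
    and sg: "\<And>h j. arc h j \<Longrightarrow> sgn (twistor Z A h j) = (-1) ^ count_in B h j"
  obtains C where "C \<in> carrier_mat k n"
    "\<And>I. I \<in> ksubsets k n \<Longrightarrow> if transversal I B then plucker C I > 0 else plucker C I = 0"
    "vec_space.row_space (k + 2) (C * Z) = vec_space.row_space (k + 2) A"
proof -
  let ?f = "twistor Z A" and ?M = "mids B"
  let ?ms = "sorted_list_of_set ?M"
  have Zc: "Z \<in> carrier_mat n (k + 2)" using Z unfolding Mat_pos_def by auto
  have nz: "?f h j \<noteq> 0" if "arc h j" for h j
    using sg[OF that] by (metis power_not_zero sgn_0 zero_neq_neg_one)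
  have cM: "card ?M = k" using bij_betw_same_card[OF corners_bij[OF B(1)]] B(2) by simp
  have ms: "length ?ms = k" "set ?ms = ?M" using cM finite_mids by auto
  define C where "C = mat k n (\<lambda>(r, i). crow B ?f (?ms ! r) i)"
  have C: "C \<in> carrier_mat k n" unfolding C_def by simp
  have mem: "?ms ! r \<in> ?M" if "r < k" for r using ms that nth_mem by metis
  have rows: "row_fns C = map (crow B ?f) ?ms"
  proof (rule nth_equalityI)
    fix r assume "r < length (row_fns C)"
    then have r: "r < k" using C by (simp add: length_row_fns)
    have "crow B ?f (?ms ! r) i = 0" if "\<not> i < n" for i
      using midsD[OF mem[OF r]] that unfolding crow_def by auto
    then show "row_fns C ! r = map (crow B ?f) ?ms ! r"
      using r ms unfolding row_fns_def C_def by (auto simp: fun_eq_iff)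
  qed (use C ms in \<open>simp add: length_row_fns\<close>)
  have pos: "if transversal I B then plucker C I > 0 else plucker C I = 0" if "I \<in> ksubsets k n" for I
    unfolding plucker_eq_minor[OF C that] rows
    by (rule crow_minor[OF B(1) nz ksubsets_finite[OF that]])
  have abs: "\<bar>?f h j\<bar> = (-1) ^ count_in B h j * ?f h j" if "arc h j" for h j
    unfolding sg[OF that, symmetric] by (simp add: abs_sgn)
  have "\<exists>y\<in>carrier_vec k. A\<^sup>T *\<^sub>v y = row (C * Z) r" if r: "r < k" for r
  proof -
    obtain b where b: "b = ?ms ! r" "b \<in> ?M" using mem[OF r] by blast
    obtain a c where ac: "a = lo b" "c = hi b" by blast
    note m = midsD[OF b(2), folded ac]
    note d = triD[OF m(1)]
    let ?s = "\<lambda>h j. (-1 :: real) ^ count_in B h j"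
    define w where "w = vec (k + 2) (\<lambda>\<kappa>. ?f b c * Z $$ (a, \<kappa>) - ?f a c * Z $$ (b, \<kappa>) + ?f a b * Z $$ (c, \<kappa>))"
    obtain y where y: "y \<in> carrier_vec k" "A\<^sup>T *\<^sub>v y = w"
      using three_term_in_row_space[OF A Zc _ _ _ nz[OF d(5)], of a] d unfolding w_def by auto
    have "count_in B a c = count_in B a b + count_in B b c + 1"
      using count_in_tri[OF B(1) m(1)] m(2) unfolding corners_def ac by simp
    \<comment> \<open>the middle coefficient of the relation carries a minus sign, which the black triangle compensates\<close>
    then have sac: "?s a c = - (?s a b * ?s b c)" by (simp add: power_add)
    have sq: "?s a b * ?s a b = 1" "?s b c * ?s b c = 1" by (simp_all flip: power_add)
    have row: "row (C * Z) r = (?s a b * ?s b c) \<cdot>\<^sub>v w"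
    proof (rule eq_vecI)
      fix \<kappa> assume "\<kappa> < dim_vec ((?s a b * ?s b c) \<cdot>\<^sub>v w)"
      then have \<kappa>: "\<kappa> < k + 2" unfolding w_def by simp
      have "row (C * Z) r $ \<kappa> = (\<Sum>i<n. crow B ?f b i * Z $$ (i, \<kappa>))"
        using C Zc r \<kappa> unfolding C_def b by (auto simp: scalar_prod_def lessThan_atLeast0 intro!: sum.cong)
      also have "\<dots> = (\<Sum>i\<in>{a, b, c}. crow B ?f b i * Z $$ (i, \<kappa>))"
        using d by (intro sum.mono_neutral_right) (auto simp: crow_def ac)
      also have "\<dots> = crow B ?f b a * Z $$ (a, \<kappa>) + crow B ?f b b * Z $$ (b, \<kappa>) + crow B ?f b c * Z $$ (c, \<kappa>)"
        using d by simp
      also have "\<dots> = (?s b c * ?f b c * ?s a b) * Z $$ (a, \<kappa>) + (?s a c * ?f a c) * Z $$ (b, \<kappa>)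
          + (?s a b * ?f a b * ?s b c) * Z $$ (c, \<kappa>)"
        using d abs[OF d(3)] abs[OF d(4)] abs[OF d(5)] unfolding crow_def ac[symmetric] by simp
      also have "\<dots> = (?s a b * ?s b c) * w $ \<kappa>"
        unfolding sac w_def using \<kappa> by (simp add: algebra_simps)
      finally show "row (C * Z) r $ \<kappa> = ((?s a b * ?s b c) \<cdot>\<^sub>v w) $ \<kappa>" using \<kappa> unfolding w_def by simp
    qed (use C Zc in \<open>simp add: w_def\<close>)
    have "A\<^sup>T *\<^sub>v ((?s a b * ?s b c) \<cdot>\<^sub>v y) = row (C * Z) r"
      unfolding row y(2)[symmetric] using A y(1) by (intro mult_mat_vec) auto
    then show ?thesis using y(1) by (intro bexI[of _ "(?s a b * ?s b c) \<cdot>\<^sub>v y"]) auto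
  qed
  then obtain G where G: "G \<in> carrier_mat k k" "C * Z = G * A"
    using mat_factor[OF A, of "C * Z" k] C Zc by auto
  have "sgn (twistor Z (C * Z) 0 (n - 1)) = (-1) ^ count_in B 0 (n - 1)"
    by (rule twistor_signs[OF B C Z pos arc_root])
  then have "twistor Z (C * Z) 0 (n - 1) \<noteq> 0" by (metis power_not_zero sgn_0 zero_neq_neg_one)
  moreover have "C * Z \<in> carrier_mat k (k + 2)" using C Zc by simp
  ultimately obtain X where X: "X \<in> carrier_mat (k + 2) k" "C * Z * X = 1\<^sub>m k"
    using right_inverse_from_twistor[where A = "C * Z" and i = 0 and j = "n - 1", OF _ Zc] n3 by auto
  then have "G * (A * X) = 1\<^sub>m k" using G A by (simp add: assoc_mult_mat[of _ k k _ "k + 2"])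
  then have "det G * det (A * X) = 1" using det_mult[OF G(1), of "A * X"] A X by simp
  then have "det G \<noteq> 0" by auto
  then have "vec_space.row_space (k + 2) (C * Z) = vec_space.row_space (k + 2) A"
    unfolding G(2) by (intro row_space_mult_left[OF G(1) _ A])
  with C pos that show ?thesis by blast
qed

end

section \<open>States under an arc\<close>

lemma minor_rotate:
  assumes "finite I"
  shows "minor (v # R1 @ R2) I = (-1) ^ length R1 * minor (R1 @ v # R2) I"
  using assms
proof (induction R1 arbitrary: I)
  case (Cons w R1)
  have "minor (v # (w # R1) @ R2) I = - minor (w # v # R1 @ R2) I"
    unfolding append_Cons by (rule minor_swap[OF Cons.prems])
  also have "\<dots> = - (\<Sum>i\<in>I. (-1) ^ card {j \<in> I. j < i} * w i * minor (v # R1 @ R2) (I - {i}))"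
    by (simp only: minor.simps)
  also have "\<dots> = - (\<Sum>i\<in>I. (-1) ^ card {j \<in> I. j < i} * w i * ((-1) ^ length R1 * minor (R1 @ v # R2) (I - {i})))"
  proof -
    have "minor (v # R1 @ R2) (I - {i}) = (-1) ^ length R1 * minor (R1 @ v # R2) (I - {i})" for i
      using Cons.prems by (intro Cons.IH) simp
    then show ?thesis by (simp only:)
  qed
  also have "\<dots> = (-1) ^ length (w # R1) * minor ((w # R1) @ v # R2) I"
    by (simp add: sum_distrib_left sum_negf mult_ac)
  finally show ?case .
qed simp

lemma minor_single: "minor [\<lambda>i. of_bool (i = a)] {a} = 1"
proof -
  have e: "{j. j = a \<and> j < a} = {}" by auto
  show ?thesis by (simp add: e)
qed

context triangulated
begin

context
  fixes B :: "nat set set"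
  assumes B: "B \<subseteq> faces n D"
begin

abbreviation (input) cnt :: "nat \<Rightarrow> nat \<Rightarrow> nat" where "cnt \<equiv> count_in B"

text \<open>The vertices \<open>e\<^sub>I\<close> of the polytope, restricted to the coordinates under an arc: \<open>y\<close> is the excess
  of \<open>I\<close> over the area. Only \<open>y \<le> 1\<close> can occur under the arc itself.\<close>

definition states :: "nat \<Rightarrow> nat \<Rightarrow> nat \<Rightarrow> nat set set" where
  "states a c y = {I. I \<subseteq> {a..<c} \<and> card I = count_in B a c + y \<and>
     (\<forall>h j. arc h j \<longrightarrow> a \<le> h \<longrightarrow> j \<le> c \<longrightarrow>
        count_in B h j \<le> card (I \<inter> {h..<j}) \<and> card (I \<inter> {h..<j}) \<le> count_in B h j + 1)}"

lemma statesD: "I \<in> states a c y \<Longrightarrow> I \<subseteq> {a..<c} \<and> finite I \<and> card I = cnt a c + y"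
  unfolding states_def by (auto intro: finite_subset)

lemma finite_states: "finite (states a c y)"
  by (rule finite_subset[of _ "Pow {a..<c}"]) (auto simp: states_def)

lemma states_side: "states i (i + 1) 0 = {{}}" "states i (i + 1) 1 = {{i}}"
proof -
  have c0: "cnt i (i + 1) = 0" by (rule count_in_Suc[OF B])
  have hj: "h = i \<and> j = i + 1" if "arc h j" "i \<le> h" "j \<le> i + 1" for h j
    using arc_less[OF that(1)] that by auto
  have s: "I \<in> states i (i + 1) y \<longleftrightarrow> I \<subseteq> {i} \<and> card I = y" for I y
  proof -
    have e: "{i..<i + 1} = {i}" by auto
    have "card (I \<inter> {i}) \<le> 1" using card_mono[of "{i}" "I \<inter> {i}"] by simp
    then have "\<forall>h j. arc h j \<longrightarrow> i \<le> h \<longrightarrow> j \<le> i + 1 \<longrightarrow>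
        cnt h j \<le> card (I \<inter> {h..<j}) \<and> card (I \<inter> {h..<j}) \<le> cnt h j + 1"
      using hj c0 e by (metis le0 add_0)
    then show ?thesis unfolding states_def c0 e by simp
  qed
  have sub: "I \<subseteq> {i} \<and> card I = 0 \<longleftrightarrow> I = {}" "I \<subseteq> {i} \<and> card I = 1 \<longleftrightarrow> I = {i}" for I
    by (cases "i \<in> I"; auto simp: subset_singleton_iff)+
  show "states i (i + 1) 0 = {{}}" by (rule Set.set_eqI) (simp only: s sub singleton_iff)
  show "states i (i + 1) 1 = {{i}}" by (rule Set.set_eqI) (simp only: s sub singleton_iff)
qed

text \<open>Apart from the top edge, the arcs under \<open>(a, c)\<close> are those under \<open>(a, b)\<close> and those under \<open>(b, c)\<close>.\<close>

lemma states_tri: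
  assumes t: "tri a b c" and I: "I \<subseteq> {a..<c}" and y: "y \<le> 1"
  shows "I \<in> states a c y \<longleftrightarrow> (\<exists>y1 y2. y1 \<le> 1 \<and> y2 \<le> 1 \<and> y1 + y2 = y + of_bool ({a, b, c} \<in> B) \<and>
     I \<inter> {a..<b} \<in> states a b y1 \<and> I \<inter> {b..<c} \<in> states b c y2)"
proof -
  note d = triD[OF t]
  let ?L = "I \<inter> {a..<b}" and ?R = "I \<inter> {b..<c}"
  have fin: "finite I" using I finite_subset by blast
  have "I = ?L \<union> ?R" "?L \<inter> ?R = {}" using I d by auto
  then have cI: "card I = card ?L + card ?R" using fin by (metis card_Un_disjoint finite_Int)
  have cnt: "cnt a c = cnt a b + cnt b c + of_bool ({a, b, c} \<in> B)" by (rule count_in_tri[OF B t])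
  have arcs: "(h, j) = (a, c) \<or> a \<le> h \<and> j \<le> b \<or> b \<le> h \<and> j \<le> c" if "arc h j" "a \<le> h" "j \<le> c" for h j
    using tri_hidden[OF t that] that by blast
  have resL: "?L \<inter> {h..<j} = I \<inter> {h..<j}" if "a \<le> h" "j \<le> b" for h j using that by auto
  have resR: "?R \<inter> {h..<j} = I \<inter> {h..<j}" if "b \<le> h" "j \<le> c" for h j using that by auto
  show ?thesis
  proof
    assume IS: "I \<in> states a c y"
    then have ok: "cnt h j \<le> card (I \<inter> {h..<j}) \<and> card (I \<inter> {h..<j}) \<le> cnt h j + 1"
      if "arc h j" "a \<le> h" "j \<le> c" for h j using that unfolding states_def by blast
    have okL: "cnt a b \<le> card ?L \<and> card ?L \<le> cnt a b + 1" using ok[OF d(4)] d by auto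
    have okR: "cnt b c \<le> card ?R \<and> card ?R \<le> cnt b c + 1" using ok[OF d(5)] d by auto
    have L: "?L \<in> states a b (card ?L - cnt a b)"
      unfolding states_def using okL ok resL d(2) by auto
    have R: "?R \<in> states b c (card ?R - cnt b c)"
      unfolding states_def using okR ok resR d(1) by auto
    have "(card ?L - cnt a b) + (card ?R - cnt b c) = y + of_bool ({a, b, c} \<in> B)"
      using okL okR cI cnt statesD[OF IS] by linarith
    then show "\<exists>y1 y2. y1 \<le> 1 \<and> y2 \<le> 1 \<and> y1 + y2 = y + of_bool ({a, b, c} \<in> B) \<and>
     ?L \<in> states a b y1 \<and> ?R \<in> states b c y2"
      using L R okL okR by (intro exI[of _ "card ?L - cnt a b"] exI[of _ "card ?R - cnt b c"]) auto
  next
    assume "\<exists>y1 y2. y1 \<le> 1 \<and> y2 \<le> 1 \<and> y1 + y2 = y + of_bool ({a, b, c} \<in> B) \<and>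
     ?L \<in> states a b y1 \<and> ?R \<in> states b c y2"
    then obtain y1 y2 where ys: "y1 + y2 = y + of_bool ({a, b, c} \<in> B)"
      and L: "?L \<in> states a b y1" and R: "?R \<in> states b c y2" by blast
    have card: "card I = cnt a c + y" using ys cI cnt statesD[OF L] statesD[OF R] by linarith
    have "cnt h j \<le> card (I \<inter> {h..<j}) \<and> card (I \<inter> {h..<j}) \<le> cnt h j + 1"
      if hj: "arc h j" "a \<le> h" "j \<le> c" for h j
      using arcs[OF hj]
    proof (elim disjE)
      assume "(h, j) = (a, c)"
      moreover have "I \<inter> {a..<c} = I" using I by blast
      ultimately show ?thesis using card y by simp
    next
      assume "a \<le> h \<and> j \<le> b"
      then have "cnt h j \<le> card (?L \<inter> {h..<j}) \<and> card (?L \<inter> {h..<j}) \<le> cnt h j + 1"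
          and e: "?L \<inter> {h..<j} = I \<inter> {h..<j}"
        using L hj resL[of h j] unfolding states_def by blast+
      then show ?thesis by (simp only: e)
    next
      assume "b \<le> h \<and> j \<le> c"
      then have "cnt h j \<le> card (?R \<inter> {h..<j}) \<and> card (?R \<inter> {h..<j}) \<le> cnt h j + 1"
          and e: "?R \<inter> {h..<j} = I \<inter> {h..<j}"
        using R hj resR[of h j] unfolding states_def by blast+
      then show ?thesis by (simp only: e)
    qed
    then show "I \<in> states a c y" unfolding states_def using I card by blast
  qed
qed

text \<open>A white triangle passes on the sum of the two excesses, a black one the sum minus one; so at most
  one of the lower edges of a white triangle, and at least one of a black triangle, has excess \<open>1\<close>.\<close>

lemma states_white:
  assumes t: "tri a b c" and w: "{a, b, c} \<notin> B" and I: "I \<subseteq> {a..<c}"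
  shows "I \<in> states a c 0 \<longleftrightarrow> I \<inter> {a..<b} \<in> states a b 0 \<and> I \<inter> {b..<c} \<in> states b c 0"
    and "I \<in> states a c 1 \<longleftrightarrow> I \<inter> {a..<b} \<in> states a b 1 \<and> I \<inter> {b..<c} \<in> states b c 0 \<or>
                             I \<inter> {a..<b} \<in> states a b 0 \<and> I \<inter> {b..<c} \<in> states b c 1"
proof -
  have e: "y1 \<le> 1 \<and> y2 \<le> 1 \<and> y1 + y2 = 1 \<and> P \<longleftrightarrow> (y1 = 1 \<and> y2 = 0 \<or> y1 = 0 \<and> y2 = 1) \<and> P" for y1 y2 :: nat and P
    by auto
  show "I \<in> states a c 0 \<longleftrightarrow> I \<inter> {a..<b} \<in> states a b 0 \<and> I \<inter> {b..<c} \<in> states b c 0"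
    using states_tri[OF t I, of 0] w by simp
  show "I \<in> states a c 1 \<longleftrightarrow> I \<inter> {a..<b} \<in> states a b 1 \<and> I \<inter> {b..<c} \<in> states b c 0 \<or>
                             I \<inter> {a..<b} \<in> states a b 0 \<and> I \<inter> {b..<c} \<in> states b c 1"
    using states_tri[OF t I, of 1] w unfolding of_bool_def by (simp only: e if_False add_0_right order_refl) blast
qed

lemma states_black:
  assumes t: "tri a b c" and w: "{a, b, c} \<in> B" and I: "I \<subseteq> {a..<c}"
  shows "I \<in> states a c 0 \<longleftrightarrow> I \<inter> {a..<b} \<in> states a b 1 \<and> I \<inter> {b..<c} \<in> states b c 0 \<or>
                             I \<inter> {a..<b} \<in> states a b 0 \<and> I \<inter> {b..<c} \<in> states b c 1"
    and "I \<in> states a c 1 \<longleftrightarrow> I \<inter> {a..<b} \<in> states a b 1 \<and> I \<inter> {b..<c} \<in> states b c 1"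
proof -
  have e: "y1 \<le> 1 \<and> y2 \<le> 1 \<and> y1 + y2 = 1 \<and> P \<longleftrightarrow> (y1 = 1 \<and> y2 = 0 \<or> y1 = 0 \<and> y2 = 1) \<and> P"
    "y1 \<le> 1 \<and> y2 \<le> 1 \<and> y1 + y2 = 1 + 1 \<and> P \<longleftrightarrow> y1 = 1 \<and> y2 = 1 \<and> P" for y1 y2 :: nat and P
    by auto
  show "I \<in> states a c 0 \<longleftrightarrow> I \<inter> {a..<b} \<in> states a b 1 \<and> I \<inter> {b..<c} \<in> states b c 0 \<or>
                             I \<inter> {a..<b} \<in> states a b 0 \<and> I \<inter> {b..<c} \<in> states b c 1"
    using states_tri[OF t I, of 0] w unfolding of_bool_def by (simp only: e if_True add_0_left zero_le) blast
  show "I \<in> states a c 1 \<longleftrightarrow> I \<inter> {a..<b} \<in> states a b 1 \<and> I \<inter> {b..<c} \<in> states b c 1"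
    using states_tri[OF t I, of 1] w unfolding of_bool_def by (simp only: e if_True order_refl) blast
qed

lemma states_disjoint: "I \<in> states a c y \<Longrightarrow> I \<in> states a c y' \<Longrightarrow> y = y'"
  using statesD[of I a c y] statesD[of I a c y'] by simp

text \<open>The rows \<open>R\<close> produce the states with excess \<open>0\<close>, and one more row \<open>v\<close> those with excess \<open>1\<close>. At a
  white triangle the extra rows of the two lower edges are added up to the new extra row; at a black
  triangle this sum becomes an ordinary row, and one of the two remains as extra row. The blocks live on
  disjoint columns, so all minors are products, and by the sizes of the column sets at most one product
  is nonzero.\<close>

definition supported :: "nat \<Rightarrow> nat \<Rightarrow> (nat \<Rightarrow> real) \<Rightarrow> bool" where
  "supported a c w \<longleftrightarrow> (\<forall>i. i \<notin> {a..<c} \<longrightarrow> w i = 0)"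

lemma states_matrix:
  assumes "arc a c"
  shows "\<exists>R v. length R = cnt a c \<and> (\<forall>w\<in>set (v # R). supported a c w) \<and>
    (\<forall>I\<subseteq>{a..<c}. minor R I = of_bool (I \<in> states a c 0) \<and> minor (v # R) I = of_bool (I \<in> states a c 1))"
  using assms
proof (induction "c - a" arbitrary: a c rule: less_induct)
  case less
  note ac = less.prems arc_less[OF less.prems]
  show ?case
  proof (cases "a + 1 < c")
    case False
    then have c: "c = a + 1" using ac by simp
    let ?v = "\<lambda>i. of_bool (i = a) :: real"
    have "minor [] I = of_bool (I \<in> states a c 0) \<and> minor [?v] I = of_bool (I \<in> states a c 1)"
      if "I \<subseteq> {a..<c}" for I
    proof -
      have "I = {} \<or> I = {a}" using that c by auto
      then show ?thesis unfolding c states_side using minor_single[of a] by auto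
    qed
    moreover have "cnt a c = 0" unfolding c by (rule count_in_Suc[OF B])
    ultimately show ?thesis using c
      by (intro exI[of _ "[]"] exI[of _ ?v]) (auto simp: supported_def)
  next
    case True
    obtain b where t: "tri a b c" using triE[OF ac(1) True] .
    note d = triD[OF t]
    have less1: "b - a < c - a" and less2: "c - b < c - a" using d(1,2) by auto
    obtain R1 v1 where 1: "length R1 = cnt a b" "\<And>w. w \<in> set (v1 # R1) \<Longrightarrow> supported a b w"
      "\<And>I. I \<subseteq> {a..<b} \<Longrightarrow> minor R1 I = of_bool (I \<in> states a b 0) \<and> minor (v1 # R1) I = of_bool (I \<in> states a b 1)"
      using less.hyps[OF less1 d(4)] by metis
    obtain R2 v2 where 2: "length R2 = cnt b c" "\<And>w. w \<in> set (v2 # R2) \<Longrightarrow> supported b c w"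
      "\<And>I. I \<subseteq> {b..<c} \<Longrightarrow> minor R2 I = of_bool (I \<in> states b c 0) \<and> minor (v2 # R2) I = of_bool (I \<in> states b c 1)"
      using less.hyps[OF less2 d(5)] by metis
    \<comment> \<open>the sign compensates for moving the second extra row past the first block\<close>
    define r where "r = (\<lambda>i. 1 * v1 i + (-1) ^ length R1 * v2 i)"
    have sup: "supported a c w" if "w \<in> set (v1 # R1) \<union> set (v2 # R2) \<union> {r}" for w
    proof -
      have s1: "supported a c w" if "supported a b w" for w using that d unfolding supported_def by auto
      have s2: "supported a c w" if "supported b c w" for w using that d unfolding supported_def by auto
      have "supported a c v1" "supported a c v2" using 1(2)[of v1] 2(2)[of v2] s1 s2 by auto
      then have "supported a c r" unfolding supported_def r_def by auto
      then show ?thesis using that 1(2) 2(2) s1 s2 by auto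
    qed
    have blocks: "minor (S1 @ S2) I = minor S1 (I \<inter> {a..<b}) * minor S2 (I \<inter> {b..<c})"
      if "I \<subseteq> {a..<c}" "set S1 \<subseteq> set (v1 # R1)" "set S2 \<subseteq> set (v2 # R2)" for I S1 S2
    proof (rule minor_append)
      show "finite I" using that finite_subset by blast
      show "w i = 0" if "w \<in> set S1" "i \<notin> {a..<b}" for w i
        using 1(2)[of w] that \<open>set S1 \<subseteq> _\<close> unfolding supported_def by blast
      show "w i = 0" if "w \<in> set S2" "i \<notin> {b..<c}" for w i
        using 2(2)[of w] that \<open>set S2 \<subseteq> _\<close> unfolding supported_def by blast
    qed (use that d in auto)
    have mr: "minor (r # R1 @ R2) I =
        of_bool (I \<inter> {a..<b} \<in> states a b 1 \<and> I \<inter> {b..<c} \<in> states b c 0 \<or>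
                 I \<inter> {a..<b} \<in> states a b 0 \<and> I \<inter> {b..<c} \<in> states b c 1)" if I: "I \<subseteq> {a..<c}" for I
    proof -
      have fin: "finite I" using I finite_subset by blast
      have LR: "I \<inter> {a..<b} \<subseteq> {a..<b}" "I \<inter> {b..<c} \<subseteq> {b..<c}" by auto
      have "minor (r # R1 @ R2) I = minor ((v1 # R1) @ R2) I + (-1) ^ length R1 * minor (v2 # R1 @ R2) I"
        unfolding r_def minor_linear by simp
      also have "\<dots> = minor ((v1 # R1) @ R2) I + minor (R1 @ v2 # R2) I"
        unfolding minor_rotate[OF fin] by (simp flip: mult.assoc power_add)
      also have "\<dots> = of_bool (I \<inter> {a..<b} \<in> states a b 1) * of_bool (I \<inter> {b..<c} \<in> states b c 0) +
         of_bool (I \<inter> {a..<b} \<in> states a b 0) * of_bool (I \<inter> {b..<c} \<in> states b c 1)"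
        using blocks[OF I, of "v1 # R1" R2] blocks[OF I, of R1 "v2 # R2"] 1(3)[OF LR(1)] 2(3)[OF LR(2)]
        by (simp only: set_subset_Cons subset_refl)
      also have "\<dots> = of_bool (I \<inter> {a..<b} \<in> states a b 1 \<and> I \<inter> {b..<c} \<in> states b c 0 \<or>
                 I \<inter> {a..<b} \<in> states a b 0 \<and> I \<inter> {b..<c} \<in> states b c 1)"
        using states_disjoint[of "I \<inter> {a..<b}" a b 0 1] by auto
      finally show ?thesis .
    qed
    show ?thesis
    proof (cases "{a, b, c} \<in> B")
      case False
      have "minor (R1 @ R2) I = of_bool (I \<in> states a c 0) \<and> minor (r # R1 @ R2) I = of_bool (I \<in> states a c 1)"
        if I: "I \<subseteq> {a..<c}" for I
      proof -
        have LR: "I \<inter> {a..<b} \<subseteq> {a..<b}" "I \<inter> {b..<c} \<subseteq> {b..<c}" by auto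
        have "minor (R1 @ R2) I = minor R1 (I \<inter> {a..<b}) * minor R2 (I \<inter> {b..<c})"
          by (rule blocks[OF I]) auto
        then show ?thesis unfolding mr[OF I] states_white[OF t False I]
          using 1(3)[OF LR(1)] 2(3)[OF LR(2)] by simp
      qed
      moreover have "length (R1 @ R2) = cnt a c"
        using 1(1) 2(1) count_in_tri[OF B t] False by simp
      moreover have "\<forall>w\<in>set (r # R1 @ R2). supported a c w" using sup by auto
      ultimately show ?thesis by blast
    next
      case True
      have "minor (r # R1 @ R2) I = of_bool (I \<in> states a c 0) \<and> minor (v1 # r # R1 @ R2) I = of_bool (I \<in> states a c 1)"
        if I: "I \<subseteq> {a..<c}" for I
      proof -
        have fin: "finite I" using I finite_subset by blast
        have LR: "I \<inter> {a..<b} \<subseteq> {a..<b}" "I \<inter> {b..<c} \<subseteq> {b..<c}" by auto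
        have "minor (v1 # r # R1 @ R2) I = minor ([v1] @ v1 # R1 @ R2) I + (-1) ^ length R1 * minor ([v1] @ v2 # R1 @ R2) I"
          using minor_linear_at[of "[v1]" 1 v1 "(-1) ^ length R1" v2 "R1 @ R2" I] unfolding r_def by simp
        also have "minor ([v1] @ v1 # R1 @ R2) I = 0" using minor_repeated[OF fin] by simp
        also have "minor ([v1] @ v2 # R1 @ R2) I = - minor (v2 # (v1 # R1) @ R2) I"
          unfolding append_Cons append_Nil by (rule minor_swap[OF fin])
        also have "\<dots> = (-1) ^ length R1 * minor ((v1 # R1) @ v2 # R2) I"
          unfolding minor_rotate[OF fin] by simp
        also have "minor ((v1 # R1) @ v2 # R2) I = of_bool (I \<inter> {a..<b} \<in> states a b 1 \<and> I \<inter> {b..<c} \<in> states b c 1)"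
          using blocks[OF I, of "v1 # R1" "v2 # R2"] 1(3)[OF LR(1)] 2(3)[OF LR(2)] by (simp del: minor.simps)
        finally have "minor (v1 # r # R1 @ R2) I = of_bool (I \<in> states a c 1)"
          unfolding states_black[OF t True I] by (simp flip: mult.assoc power_add)
        then show ?thesis unfolding mr[OF I] states_black[OF t True I] by blast
      qed
      moreover have "length (r # R1 @ R2) = cnt a c"
        using 1(1) 2(1) count_in_tri[OF B t] True by simp
      moreover have "\<forall>w\<in>set (v1 # r # R1 @ R2). supported a c w" using sup by auto
      ultimately show ?thesis by blast
    qed
  qed
qed

section \<open>Weights with prescribed marginals\<close>

lemma sum_states_product:
  fixes g h :: "nat set \<Rightarrow> real"
  assumes d: "a \<le> b" "b \<le> c" and X: "X = {I. I \<subseteq> {a..<c} \<and> I \<inter> {a..<b} \<in> states a b y1 \<and> I \<inter> {b..<c} \<in> states b c y2}"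
  shows "(\<Sum>I\<in>X. g (I \<inter> {a..<b}) * h (I \<inter> {b..<c})) = (\<Sum>I\<in>states a b y1. g I) * (\<Sum>I\<in>states b c y2. h I)"
proof -
  have "(\<Sum>I\<in>X. g (I \<inter> {a..<b}) * h (I \<inter> {b..<c})) =
      (\<Sum>(I, J)\<in>states a b y1 \<times> states b c y2. g I * h J)"
  proof (rule sum.reindex_bij_witness[of _ "\<lambda>(I, J). I \<union> J" "\<lambda>I. (I \<inter> {a..<b}, I \<inter> {b..<c})"])
    fix I assume I: "I \<in> X"
    then show "(case (I \<inter> {a..<b}, I \<inter> {b..<c}) of (I, J) \<Rightarrow> I \<union> J) = I" using d unfolding X by auto
    show "(I \<inter> {a..<b}, I \<inter> {b..<c}) \<in> states a b y1 \<times> states b c y2" using I unfolding X by auto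
  next
    fix p assume p: "p \<in> states a b y1 \<times> states b c y2"
    then obtain I J where IJ: "p = (I, J)" "I \<in> states a b y1" "J \<in> states b c y2" by auto
    have "I \<subseteq> {a..<b}" "J \<subseteq> {b..<c}" using IJ statesD by auto
    then have e: "(I \<union> J) \<inter> {a..<b} = I" "(I \<union> J) \<inter> {b..<c} = J" "I \<union> J \<subseteq> {a..<c}" using d by fastforce+
    then show "((case p of (I, J) \<Rightarrow> I \<union> J) \<inter> {a..<b}, (case p of (I, J) \<Rightarrow> I \<union> J) \<inter> {b..<c}) = p"
      using IJ by simp
    show "(case p of (I, J) \<Rightarrow> I \<union> J) \<in> X" using e IJ unfolding X by simp
  qed auto
  then show ?thesis by (simp add: sum_product sum.cartesian_product)
qed

definition weight_sum :: "(nat \<Rightarrow> real) \<Rightarrow> nat \<Rightarrow> nat \<Rightarrow> nat \<Rightarrow> (nat set \<Rightarrow> real) \<Rightarrow> real" where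
  "weight_sum \<tau> a c y g = (\<Sum>I\<in>states a c y. (\<Prod>i\<in>I. \<tau> i) * g I)"

lemma weight_sum_product:
  assumes t: "tri a b c"
    and X: "X = {I. I \<subseteq> {a..<c} \<and> I \<inter> {a..<b} \<in> states a b y1 \<and> I \<inter> {b..<c} \<in> states b c y2}"
    and gh: "\<And>I. I \<in> X \<Longrightarrow> f I = g (I \<inter> {a..<b}) * h (I \<inter> {b..<c})"
  shows "(\<Sum>I\<in>X. (\<Prod>i\<in>I. \<tau> i) * f I) = weight_sum \<tau> a b y1 g * weight_sum \<tau> b c y2 h"
proof -
  note d = triD[OF t]
  have "(\<Prod>i\<in>I. \<tau> i) * f I = ((\<Prod>i\<in>I \<inter> {a..<b}. \<tau> i) * g (I \<inter> {a..<b})) * ((\<Prod>i\<in>I \<inter> {b..<c}. \<tau> i) * h (I \<inter> {b..<c}))"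
    if I: "I \<in> X" for I
  proof -
    have s: "I \<subseteq> {a..<c}" using I unfolding X by simp
    then have "finite I" using finite_subset by blast
    moreover have "I = (I \<inter> {a..<b}) \<union> (I \<inter> {b..<c})" using s d by auto
    moreover have "(I \<inter> {a..<b}) \<inter> (I \<inter> {b..<c}) = {}" by auto
    ultimately have "(\<Prod>i\<in>I. \<tau> i) = (\<Prod>i\<in>I \<inter> {a..<b}. \<tau> i) * (\<Prod>i\<in>I \<inter> {b..<c}. \<tau> i)"
      by (metis prod.union_disjoint finite_Int)
    then show ?thesis using gh[OF I] by (simp add: mult_ac)
  qed
  then have "(\<Sum>I\<in>X. (\<Prod>i\<in>I. \<tau> i) * f I) =
     (\<Sum>I\<in>X. ((\<Prod>i\<in>I \<inter> {a..<b}. \<tau> i) * g (I \<inter> {a..<b})) * ((\<Prod>i\<in>I \<inter> {b..<c}. \<tau> i) * h (I \<inter> {b..<c})))"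
    by (intro sum.cong) auto
  also have "\<dots> = weight_sum \<tau> a b y1 g * weight_sum \<tau> b c y2 h"
    unfolding weight_sum_def using d(1,2) by (intro sum_states_product[OF _ _ X]) auto
  finally show ?thesis .
qed

lemma weight_sum_white:
  assumes t: "tri a b c" and w: "{a, b, c} \<notin> B"
    and f: "\<And>I. I \<subseteq> {a..<c} \<Longrightarrow> f I = g (I \<inter> {a..<b}) * h (I \<inter> {b..<c})"
  shows "weight_sum \<tau> a c 0 f = weight_sum \<tau> a b 0 g * weight_sum \<tau> b c 0 h"
    and "weight_sum \<tau> a c 1 f = weight_sum \<tau> a b 1 g * weight_sum \<tau> b c 0 h + weight_sum \<tau> a b 0 g * weight_sum \<tau> b c 1 h"
proof -
  define X where "X = (\<lambda>y1 y2. {I. I \<subseteq> {a..<c} \<and> I \<inter> {a..<b} \<in> states a b y1 \<and> I \<inter> {b..<c} \<in> states b c y2})"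
  have fin: "finite (X y1 y2)" for y1 y2 unfolding X_def by simp
  have p: "(\<Sum>I\<in>X y1 y2. (\<Prod>i\<in>I. \<tau> i) * f I) = weight_sum \<tau> a b y1 g * weight_sum \<tau> b c y2 h" for y1 y2
    by (rule weight_sum_product[OF t X_def[THEN fun_cong, THEN fun_cong]]) (use f in \<open>auto simp: X_def\<close>)
  have sub: "I \<subseteq> {a..<c}" if "I \<in> states a c y" for I y using statesD that by blast
  have "states a c 0 = X 0 0" unfolding X_def using states_white(1)[OF t w] sub by blast
  then show "weight_sum \<tau> a c 0 f = weight_sum \<tau> a b 0 g * weight_sum \<tau> b c 0 h"
    using p[of 0 0] unfolding weight_sum_def by simp
  have "states a c 1 = X 1 0 \<union> X 0 1" unfolding X_def using states_white(2)[OF t w] sub by blast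
  moreover have "X 1 0 \<inter> X 0 1 = {}" unfolding X_def using states_disjoint by fastforce
  ultimately show "weight_sum \<tau> a c 1 f = weight_sum \<tau> a b 1 g * weight_sum \<tau> b c 0 h + weight_sum \<tau> a b 0 g * weight_sum \<tau> b c 1 h"
    unfolding weight_sum_def[of \<tau> a c] using p fin by (simp add: sum.union_disjoint)
qed

lemma weight_sum_black:
  assumes t: "tri a b c" and w: "{a, b, c} \<in> B"
    and f: "\<And>I. I \<subseteq> {a..<c} \<Longrightarrow> f I = g (I \<inter> {a..<b}) * h (I \<inter> {b..<c})"
  shows "weight_sum \<tau> a c 0 f = weight_sum \<tau> a b 1 g * weight_sum \<tau> b c 0 h + weight_sum \<tau> a b 0 g * weight_sum \<tau> b c 1 h"
    and "weight_sum \<tau> a c 1 f = weight_sum \<tau> a b 1 g * weight_sum \<tau> b c 1 h"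
proof -
  define X where "X = (\<lambda>y1 y2. {I. I \<subseteq> {a..<c} \<and> I \<inter> {a..<b} \<in> states a b y1 \<and> I \<inter> {b..<c} \<in> states b c y2})"
  have fin: "finite (X y1 y2)" for y1 y2 unfolding X_def by simp
  have p: "(\<Sum>I\<in>X y1 y2. (\<Prod>i\<in>I. \<tau> i) * f I) = weight_sum \<tau> a b y1 g * weight_sum \<tau> b c y2 h" for y1 y2
    by (rule weight_sum_product[OF t X_def[THEN fun_cong, THEN fun_cong]]) (use f in \<open>auto simp: X_def\<close>)
  have sub: "I \<subseteq> {a..<c}" if "I \<in> states a c y" for I y using statesD that by blast
  have "states a c 1 = X 1 1" unfolding X_def using states_black(2)[OF t w] sub by blast
  then show "weight_sum \<tau> a c 1 f = weight_sum \<tau> a b 1 g * weight_sum \<tau> b c 1 h"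
    using p[of 1 1] unfolding weight_sum_def by simp
  have "states a c 0 = X 1 0 \<union> X 0 1" unfolding X_def using states_black(1)[OF t w] sub by blast
  moreover have "X 1 0 \<inter> X 0 1 = {}" unfolding X_def using states_disjoint by fastforce
  ultimately show "weight_sum \<tau> a c 0 f = weight_sum \<tau> a b 1 g * weight_sum \<tau> b c 0 h + weight_sum \<tau> a b 0 g * weight_sum \<tau> b c 1 h"
    unfolding weight_sum_def[of \<tau> a c] using p fin by (simp add: sum.union_disjoint)
qed

definition excess :: "(nat \<Rightarrow> real) \<Rightarrow> nat \<Rightarrow> nat \<Rightarrow> real" where
  "excess x a c = (\<Sum>i=a..<c. x i) - count_in B a c"

definition interior_point :: "(nat \<Rightarrow> real) \<Rightarrow> nat \<Rightarrow> nat \<Rightarrow> bool" where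
  "interior_point x a c \<longleftrightarrow> (\<forall>h j. arc h j \<longrightarrow> a \<le> h \<longrightarrow> j \<le> c \<longrightarrow> 0 < excess x h j \<and> excess x h j < 1)"

lemma excess_tri:
  assumes "tri a b c"
  shows "excess x a c = excess x a b + excess x b c - of_bool ({a, b, c} \<in> B)"
  unfolding excess_def count_in_tri[OF B assms]
  using triD[OF assms] sum.atLeastLessThan_concat[of a b c x] by simp

lemma weight_sum_cong:
  assumes "\<And>i. i \<in> {a..<c} \<Longrightarrow> \<tau> i = \<tau>' i"
  shows "weight_sum \<tau> a c y g = weight_sum \<tau>' a c y g"
  unfolding weight_sum_def
proof (rule sum.cong[OF refl])
  fix I assume "I \<in> states a c y"
  then have "I \<subseteq> {a..<c}" using statesD by blast
  then have "(\<Prod>i\<in>I. \<tau> i) = (\<Prod>i\<in>I. \<tau>' i)" using assms by (intro prod.cong) auto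
  then show "(\<Prod>i\<in>I. \<tau> i) * g I = (\<Prod>i\<in>I. \<tau>' i) * g I" by simp
qed

text \<open>The two arithmetic identities behind the induction step for marginals. In the first, \<open>G1\<close> adds the
  contributions of a state that has excess \<open>1\<close> on the edge with marginals \<open>g1\<close>, and of one that has it on
  the other edge; the second treats \<open>G0\<close> in the same way.\<close>

lemma white_mixture:
  fixes P :: real
  assumes "P > 0" "\<rho> > 0" "y1 + y2 > 0" "y = y1 + y2" "\<rho>1 = \<rho> * y1 / y" "\<rho>2 = \<rho> * y2 / y"
    and "G0 = g0 * P" "G1 = (\<rho>1 * g1 + \<rho>2 * g0) * P"
  shows "(1 - y) * (G0 / P) + y * (G1 / (\<rho> * P)) = (1 - y1) * g0 + y1 * g1"
proof -
  have y: "y > 0" using assms(3,4) by simp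
  have "y * (G1 / (\<rho> * P)) = (y * \<rho>1 / \<rho>) * g1 + (y * \<rho>2 / \<rho>) * g0"
    unfolding assms(8) using assms(1,2) by (simp add: field_simps)
  also have "y * \<rho>1 / \<rho> = y1" unfolding assms(5) using assms(2) y by simp
  also have "y * \<rho>2 / \<rho> = y2" unfolding assms(6) using assms(2) y by simp
  finally have "y * (G1 / (\<rho> * P)) = y1 * g1 + y2 * g0" .
  moreover have "G0 / P = g0" unfolding assms(7) using assms(1) by simp
  ultimately show ?thesis unfolding assms(4) by (simp add: algebra_simps)
qed

lemma black_mixture:
  fixes P :: real
  assumes "P > 0" "\<rho>1 > 0" "\<rho>2 > 0" "y = y1 + y2 - 1"
    and "(1 - y) * \<rho>1 = (1 - y2) * (\<rho>1 + \<rho>2)" "(1 - y) * \<rho>2 = (1 - y1) * (\<rho>1 + \<rho>2)"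
    and "G0 = (\<rho>1 * g1 + \<rho>2 * g0) * P" "G1 = \<rho>1 * \<rho>2 * g1 * P"
  shows "(1 - y) * (G0 / ((\<rho>1 + \<rho>2) * P)) + y * (G1 / (\<rho>1 * \<rho>2 * P)) = (1 - y1) * g0 + y1 * g1"
proof -
  have s: "\<rho>1 + \<rho>2 > 0" using assms(2,3) by simp
  have "G0 / ((\<rho>1 + \<rho>2) * P) = (\<rho>1 * g1 + \<rho>2 * g0) / (\<rho>1 + \<rho>2)" unfolding assms(7) using assms(1) by simp
  then have "(1 - y) * (G0 / ((\<rho>1 + \<rho>2) * P)) = ((1 - y) * \<rho>1 * g1 + (1 - y) * \<rho>2 * g0) / (\<rho>1 + \<rho>2)"
    by (simp add: algebra_simps)
  also have "\<dots> = (1 - y2) * g1 + (1 - y1) * g0"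
    unfolding assms(5,6) using s by (simp add: add_divide_distrib)
  finally have "(1 - y) * (G0 / ((\<rho>1 + \<rho>2) * P)) = (1 - y2) * g1 + (1 - y1) * g0" .
  moreover have "G1 / (\<rho>1 * \<rho>2 * P) = g1" unfolding assms(8) using assms(1-3) by simp
  ultimately show ?thesis unfolding assms(4) by (simp add: algebra_simps)
qed

text \<open>Give the state \<open>I\<close> the weight \<open>\<Prod>i\<in>I. \<tau> i\<close>. Mixing the two conditional distributions, on states with
  excess \<open>0\<close> and with excess \<open>1\<close>, with the probabilities \<open>1 - excess\<close> and \<open>excess\<close> of \<open>x\<close> yields the mean
  \<open>x\<close>; the ratio of the two partition functions is \<open>\<rho>\<close>.\<close>

definition one :: "nat set \<Rightarrow> real" where "one I = 1"
definition has :: "nat \<Rightarrow> nat set \<Rightarrow> real" where "has i I = of_bool (i \<in> I)"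

definition realizes :: "(nat \<Rightarrow> real) \<Rightarrow> (nat \<Rightarrow> real) \<Rightarrow> real \<Rightarrow> nat \<Rightarrow> nat \<Rightarrow> bool" where
  "realizes x \<tau> \<rho> a c \<longleftrightarrow> (\<forall>i. \<tau> i > 0) \<and> weight_sum \<tau> a c 0 one > 0 \<and>
     weight_sum \<tau> a c 1 one = \<rho> * weight_sum \<tau> a c 0 one \<and>
     (\<forall>i\<in>{a..<c}. (1 - excess x a c) * (weight_sum \<tau> a c 0 (has i) / weight_sum \<tau> a c 0 one) +
        excess x a c * (weight_sum \<tau> a c 1 (has i) / weight_sum \<tau> a c 1 one) = x i)"

text \<open>The dual graph is a tree, so the conditional distributions of the two halves can be prescribed
  independently. The ratio \<open>\<rho>\<close> is free because scaling \<open>\<tau>\<close> scales it; the ratios for the halves are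
  chosen so that, given the excess of the top edge, the lower edges get the conditional probabilities
  dictated by \<open>x\<close>.\<close>

lemma realizable:
  assumes "arc a c" "interior_point x a c" "\<rho> > 0"
  shows "\<exists>\<tau>. realizes x \<tau> \<rho> a c"
  using assms
proof (induction "c - a" arbitrary: a c \<rho> rule: less_induct)
  case less
  note ac = less.prems(1) arc_less[OF less.prems(1)]
  have rho: "\<rho> > 0" by fact
  show ?case
  proof (cases "a + 1 < c")
    case False
    then have c: "c = a + 1" using ac by simp
    have "cnt a c = 0" unfolding c by (rule count_in_Suc[OF B])
    then have "excess x a c = x a" unfolding excess_def c by simp
    then show ?thesis using rho unfolding realizes_def c weight_sum_def states_side one_def has_def
      by (intro exI[of _ "\<lambda>_. \<rho>"]) auto
  next
    case True
    obtain b where t: "tri a b c" using triE[OF ac(1) True] .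
    note d = triD[OF t]
    let ?y = "excess x a c" and ?y1 = "excess x a b" and ?y2 = "excess x b c"
    have int: "interior_point x a b" "interior_point x b c"
      using less.prems(2) d unfolding interior_point_def by auto
    have y: "0 < ?y" "?y < 1" "0 < ?y1" "?y1 < 1" "0 < ?y2" "?y2 < 1"
      using less.prems(2) d unfolding interior_point_def by auto
    define \<beta> where "\<beta> \<longleftrightarrow> {a, b, c} \<in> B"
    have ysum: "?y = ?y1 + ?y2 - of_bool \<beta>" unfolding \<beta>_def by (rule excess_tri[OF t])
    \<comment> \<open>white: \<open>\<rho> = \<rho>1 + \<rho>2\<close>, split like the excesses; black: \<open>1 / \<rho> = 1 / \<rho>1 + 1 / \<rho>2\<close>, split like
      the deficits \<open>1 - excess\<close>\<close>
    define \<rho>1 \<rho>2 where "\<rho>1 = (if \<beta> then \<rho> * (1 - ?y) / (1 - ?y1) else \<rho> * ?y1 / ?y)"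
      and "\<rho>2 = (if \<beta> then \<rho> * (1 - ?y) / (1 - ?y2) else \<rho> * ?y2 / ?y)"
    have rp: "\<rho>1 > 0" "\<rho>2 > 0" unfolding \<rho>1_def \<rho>2_def using y rho by auto
    obtain \<tau>1 where t1: "realizes x \<tau>1 \<rho>1 a b"
      using less.hyps[OF _ d(4) int(1) rp(1)] d(1,2) by (auto simp: diff_less_mono)
    obtain \<tau>2 where t2: "realizes x \<tau>2 \<rho>2 b c"
      using less.hyps[OF _ d(5) int(2) rp(2)] d(1,2) by (auto simp: diff_less_mono2)
    define \<tau> where "\<tau> = (\<lambda>i. if i < b then \<tau>1 i else \<tau>2 i)"
    have w1: "weight_sum \<tau> a b y g = weight_sum \<tau>1 a b y g" for y g
      by (rule weight_sum_cong) (simp add: \<tau>_def)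
    have w2: "weight_sum \<tau> b c y g = weight_sum \<tau>2 b c y g" for y g
      by (rule weight_sum_cong) (simp add: \<tau>_def)
    let ?F = "\<lambda>y. weight_sum \<tau> a c y one" and ?G = "\<lambda>y i. weight_sum \<tau> a c y (has i)"
    let ?p = "weight_sum \<tau> a b 0 one" and ?q = "weight_sum \<tau> b c 0 one"
    have pq: "?p > 0" "?q > 0" and p1: "weight_sum \<tau> a b 1 one = \<rho>1 * ?p" and q1: "weight_sum \<tau> b c 1 one = \<rho>2 * ?q"
      using t1 t2 unfolding realizes_def w1 w2 by auto
    define g0 g1 where "g0 = (\<lambda>i. if i < b then weight_sum \<tau> a b 0 (has i) / ?p else weight_sum \<tau> b c 0 (has i) / ?q)"
      and "g1 = (\<lambda>i. if i < b then weight_sum \<tau> a b 1 (has i) / (\<rho>1 * ?p) else weight_sum \<tau> b c 1 (has i) / (\<rho>2 * ?q))"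
    have x: "x i = (1 - (if i < b then ?y1 else ?y2)) * g0 i + (if i < b then ?y1 else ?y2) * g1 i"
      if "i \<in> {a..<c}" for i
      using t1 t2 that p1 q1 unfolding realizes_def g0_def g1_def w1 w2 by auto
    have o: "one I = one (I \<inter> {a..<b}) * one (I \<inter> {b..<c})" for I by (simp add: one_def)
    have hL: "has i I = has i (I \<inter> {a..<b}) * one (I \<inter> {b..<c})" if "a \<le> i" "i < b" for i I
      using that by (simp add: has_def one_def)
    have hR: "has i I = one (I \<inter> {a..<b}) * has i (I \<inter> {b..<c})" if "b \<le> i" "i < c" for i I
      using that by (simp add: has_def one_def)
    have G: "weight_sum \<tau> a b 0 (has i) = g0 i * ?p" "weight_sum \<tau> a b 1 (has i) = g1 i * (\<rho>1 * ?p)" if "i < b" for i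
      using that pq rp unfolding g0_def g1_def by auto
    have G': "weight_sum \<tau> b c 0 (has i) = g0 i * ?q" "weight_sum \<tau> b c 1 (has i) = g1 i * (\<rho>2 * ?q)" if "\<not> i < b" for i
      using that pq rp unfolding g0_def g1_def by auto
    have "?F 0 > 0 \<and> ?F 1 = \<rho> * ?F 0 \<and> (\<forall>i\<in>{a..<c}. (1 - ?y) * (?G 0 i / ?F 0) + ?y * (?G 1 i / ?F 1) = x i)"
    proof (cases \<beta>)
      case False
      then have w: "{a, b, c} \<notin> B" unfolding \<beta>_def by simp
      have r: "\<rho>1 = \<rho> * ?y1 / ?y" "\<rho>2 = \<rho> * ?y2 / ?y" "?y = ?y1 + ?y2" using False ysum unfolding \<rho>1_def \<rho>2_def by auto
      have F0: "?F 0 = ?p * ?q" using weight_sum_white(1)[where f = one and g = one and h = one and \<tau> = \<tau>, OF t w o] .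
      have "?F 1 = \<rho>1 * ?p * ?q + ?p * (\<rho>2 * ?q)" using weight_sum_white(2)[where f = one and g = one and h = one and \<tau> = \<tau>, OF t w o] p1 q1 by simp
      moreover have rs: "\<rho>1 + \<rho>2 = \<rho>"
      proof -
        have "\<rho>1 + \<rho>2 = \<rho> * (?y1 + ?y2) / ?y" unfolding r(1,2) by (simp add: add_divide_distrib distrib_left)
        then show ?thesis unfolding r(3)[symmetric] using y(1) by simp
      qed
      ultimately have F1: "?F 1 = \<rho> * ?F 0" unfolding F0 by (simp add: algebra_simps flip: rs)
      have "(1 - ?y) * (?G 0 i / ?F 0) + ?y * (?G 1 i / ?F 1) = x i" if i: "i \<in> {a..<c}" for i
      proof (cases "i < b")
        case True
        have i1: "a \<le> i" using i by simp
        have A: "?G 0 i = g0 i * (?p * ?q)" "?G 1 i = (\<rho>1 * g1 i + \<rho>2 * g0 i) * (?p * ?q)"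
          unfolding weight_sum_white(1)[where f = "has i" and g = "has i" and h = one and \<tau> = \<tau>, OF t w hL[OF i1 True]] weight_sum_white(2)[where f = "has i" and g = "has i" and h = one and \<tau> = \<tau>, OF t w hL[OF i1 True]] G[OF True] q1
          by (simp_all add: algebra_simps)
        show ?thesis unfolding F1 F0 using white_mixture[OF _ rho _ r(3,1,2) A] pq y x[OF i] True by simp
      next
        case False
        have ib: "b \<le> i" and i2: "i < c" using i False by simp_all
        have r3: "?y = ?y2 + ?y1" using r(3) by simp
        have A: "?G 0 i = g0 i * (?p * ?q)" "?G 1 i = (\<rho>2 * g1 i + \<rho>1 * g0 i) * (?p * ?q)"
          unfolding weight_sum_white(1)[where f = "has i" and g = one and h = "has i" and \<tau> = \<tau>, OF t w hR[OF ib i2]] weight_sum_white(2)[where f = "has i" and g = one and h = "has i" and \<tau> = \<tau>, OF t w hR[OF ib i2]] G'[OF False] p1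
          by (simp_all add: algebra_simps)
        show ?thesis unfolding F1 F0 using white_mixture[OF _ rho _ r3 r(2,1) A] pq y x[OF i] False by simp
      qed
      then show ?thesis using F1 F0 pq by simp
    next
      case True
      then have w: "{a, b, c} \<in> B" unfolding \<beta>_def by simp
      have r: "\<rho>1 = \<rho> * (1 - ?y) / (1 - ?y1)" "\<rho>2 = \<rho> * (1 - ?y) / (1 - ?y2)" "?y = ?y1 + ?y2 - 1"
        using True ysum unfolding \<rho>1_def \<rho>2_def by auto
      have f1: "\<rho>1 * (1 - ?y1) = \<rho> * (1 - ?y)" "\<rho>2 * (1 - ?y2) = \<rho> * (1 - ?y)" unfolding r(1,2) using y by auto
      have "?F 0 = \<rho>1 * ?p * ?q + ?p * (\<rho>2 * ?q)" using weight_sum_black(1)[where f = one and g = one and h = one and \<tau> = \<tau>, OF t w o] p1 q1 by simp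
      then have F0: "?F 0 = (\<rho>1 + \<rho>2) * (?p * ?q)" by (simp add: algebra_simps)
      have F1': "?F 1 = \<rho>1 * \<rho>2 * (?p * ?q)" using weight_sum_black(2)[where f = one and g = one and h = one and \<tau> = \<tau>, OF t w o] p1 q1 by (simp add: mult_ac)
      have rs: "\<rho>1 * \<rho>2 = \<rho> * (\<rho>1 + \<rho>2)"
      proof -
        have "\<rho>1 * \<rho>2 * (1 - ?y) = \<rho>1 * \<rho>2 * ((1 - ?y1) + (1 - ?y2))" using r(3) by simp
        also have "\<dots> = \<rho>2 * (\<rho>1 * (1 - ?y1)) + \<rho>1 * (\<rho>2 * (1 - ?y2))" by (simp add: algebra_simps)
        also have "\<dots> = \<rho> * (\<rho>1 + \<rho>2) * (1 - ?y)" unfolding f1 by (simp add: algebra_simps)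
        finally show ?thesis using y by simp
      qed
      have F1: "?F 1 = \<rho> * ?F 0" unfolding F1' F0 rs by simp
      have s1: "(1 - ?y) * \<rho>1 = (1 - ?y2) * (\<rho>1 + \<rho>2)" "(1 - ?y) * \<rho>2 = (1 - ?y1) * (\<rho>1 + \<rho>2)"
      proof -
        have "\<rho>1 * (\<rho> * (1 - ?y)) = (1 - ?y2) * (\<rho>1 * \<rho>2)" unfolding f1(2)[symmetric] by simp
        also have "\<dots> = (1 - ?y2) * (\<rho>1 + \<rho>2) * \<rho>" unfolding rs by simp
        finally show "(1 - ?y) * \<rho>1 = (1 - ?y2) * (\<rho>1 + \<rho>2)" using rho by (simp add: mult.commute)
        have "\<rho>2 * (\<rho> * (1 - ?y)) = (1 - ?y1) * (\<rho>1 * \<rho>2)" unfolding f1(1)[symmetric] by simp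
        also have "\<dots> = (1 - ?y1) * (\<rho>1 + \<rho>2) * \<rho>" unfolding rs by simp
        finally show "(1 - ?y) * \<rho>2 = (1 - ?y1) * (\<rho>1 + \<rho>2)" using rho by (simp add: mult.commute)
      qed
      have "(1 - ?y) * (?G 0 i / ?F 0) + ?y * (?G 1 i / ?F 1) = x i" if i: "i \<in> {a..<c}" for i
      proof (cases "i < b")
        case True
        have i1: "a \<le> i" using i by simp
        have A: "?G 0 i = (\<rho>1 * g1 i + \<rho>2 * g0 i) * (?p * ?q)" "?G 1 i = \<rho>1 * \<rho>2 * g1 i * (?p * ?q)"
          unfolding weight_sum_black(1)[where f = "has i" and g = "has i" and h = one and \<tau> = \<tau>, OF t w hL[OF i1 True]] weight_sum_black(2)[where f = "has i" and g = "has i" and h = one and \<tau> = \<tau>, OF t w hL[OF i1 True]] G[OF True] q1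
          by (simp_all add: algebra_simps)
        show ?thesis unfolding F1' F0 using black_mixture[OF _ rp r(3) s1 A] pq x[OF i] True by simp
      next
        case False
        have ib: "b \<le> i" and i2: "i < c" using i False by simp_all
        have r3: "?y = ?y2 + ?y1 - 1" using r(3) by simp
        have s2: "(1 - ?y) * \<rho>2 = (1 - ?y1) * (\<rho>2 + \<rho>1)" "(1 - ?y) * \<rho>1 = (1 - ?y2) * (\<rho>2 + \<rho>1)"
          using s1 by (simp_all add: add.commute)
        have A: "?G 0 i = (\<rho>2 * g1 i + \<rho>1 * g0 i) * (?p * ?q)" "?G 1 i = \<rho>2 * \<rho>1 * g1 i * (?p * ?q)"
          unfolding weight_sum_black(1)[where f = "has i" and g = one and h = "has i" and \<tau> = \<tau>, OF t w hR[OF ib i2]] weight_sum_black(2)[where f = "has i" and g = one and h = "has i" and \<tau> = \<tau>, OF t w hR[OF ib i2]] G'[OF False] p1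
          by (simp_all add: algebra_simps)
        show ?thesis unfolding F1' F0 using black_mixture[OF _ rp(2,1) r3 s2 A] pq x[OF i] False by (simp add: add.commute mult.commute)
      qed
      then show ?thesis using F1 F0 pq rp by simp
    qed
    moreover have "\<tau> i > 0" for i using t1 t2 unfolding realizes_def \<tau>_def by auto
    ultimately show ?thesis unfolding realizes_def by blast
  qed
qed

text \<open>Distribute the excess evenly over the two lower edges of every triangle.\<close>

lemma interior_point_exists:
  assumes "arc a c" "0 < y" "y < 1"
  shows "\<exists>x. interior_point x a c \<and> excess x a c = y"
  using assms
proof (induction "c - a" arbitrary: a c y rule: less_induct)
  case less
  note ac = less.prems(1) arc_less[OF less.prems(1)]
  show ?case
  proof (cases "a + 1 < c")
    case False
    then have c: "c = a + 1" using ac by simp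
    have "cnt a c = 0" unfolding c by (rule count_in_Suc[OF B])
    then have e: "excess (\<lambda>_. y) a c = y" unfolding excess_def c by simp
    have "interior_point (\<lambda>_. y) a c" unfolding interior_point_def
    proof (intro allI impI)
      fix h j assume "arc h j" "a \<le> h" "j \<le> c"
      then have "h = a" "j = c" using arc_less[of h j] c by auto
      then show "0 < excess (\<lambda>_. y) h j \<and> excess (\<lambda>_. y) h j < 1" using e less.prems by simp
    qed
    then show ?thesis using e by blast
  next
    case True
    obtain b where t: "tri a b c" using triE[OF ac(1) True] .
    note d = triD[OF t]
    define z where "z = (if {a, b, c} \<in> B then (1 + y) / 2 else y / 2)"
    have z: "0 < z" "z < 1" unfolding z_def using less.prems by auto
    obtain x1 where x1: "interior_point x1 a b" "excess x1 a b = z"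
      using less.hyps[OF _ d(4) z] d(1,2) by (auto simp: diff_less_mono)
    obtain x2 where x2: "interior_point x2 b c" "excess x2 b c = z"
      using less.hyps[OF _ d(5) z] d(1,2) by (auto simp: diff_less_mono2)
    define x where "x = (\<lambda>i. if i < b then x1 i else x2 i)"
    have e1: "excess x h j = excess x1 h j" if "j \<le> b" for h j
      unfolding excess_def x_def using that by (auto intro!: sum.cong)
    have e2: "excess x h j = excess x2 h j" if "b \<le> h" for h j
      unfolding excess_def x_def using that by (auto intro!: sum.cong)
    have ey: "excess x a c = y"
      unfolding excess_tri[OF t] using e1[of b a] e2[of b c] x1 x2 by (auto simp: z_def field_simps)
    have "0 < excess x h j \<and> excess x h j < 1" if hj: "arc h j" "a \<le> h" "j \<le> c" for h j
    proof -
      consider "(h, j) = (a, c)" | "j \<le> b" | "b \<le> h" using tri_hidden[OF t hj] by blast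
      then show ?thesis
      proof cases
        case 1 then show ?thesis using ey less.prems by simp
      next
        case 2 then show ?thesis using e1 x1 hj unfolding interior_point_def by simp
      next
        case 3 then show ?thesis using e2 x2 hj unfolding interior_point_def by simp
      qed
    qed
    then show ?thesis using ey unfolding interior_point_def by blast
  qed
qed

text \<open>The coordinate \<open>n - 1\<close> belongs to the side that is also the root arc. It is \<open>1\<close> minus the excess of
  that arc, as if a last white triangle joined the root arc to a side \<open>(n - 1, n)\<close>.\<close>

definition full_states :: "nat set set" where
  "full_states = {I. I \<subseteq> {0..<n} \<and> card I = card B + 1 \<and>
     (\<forall>h j. arc h j \<longrightarrow> count_in B h j \<le> card (I \<inter> {h..<j}) \<and> card (I \<inter> {h..<j}) \<le> count_in B h j + 1)}"

lemma finite_full_states: "finite full_states"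
  by (rule finite_subset[of _ "Pow {0..<n}"]) (auto simp: full_states_def)

lemma full_states_iff:
  assumes "I \<subseteq> {0..<n}"
  shows "I \<in> full_states \<longleftrightarrow> (n - 1 \<notin> I \<and> I \<inter> {0..<n - 1} \<in> states 0 (n - 1) 1) \<or>
     (n - 1 \<in> I \<and> I \<inter> {0..<n - 1} \<in> states 0 (n - 1) 0)"
proof -
  let ?L = "I \<inter> {0..<n - 1}"
  have fin: "finite I" using assms finite_subset by blast
  have cB: "cnt 0 (n - 1) = card B" by (rule count_in_root[OF B])
  have bd: "j \<le> n - 1" if "arc h j" for h j using arc_bound[OF that] by simp
  have res: "?L \<inter> {h..<j} = I \<inter> {h..<j}" if "arc h j" for h j using bd[OF that] by auto
  have "I = ?L \<union> (I \<inter> {n - 1})" using assms by fastforce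
  then have cI: "card I = card ?L + of_bool (n - 1 \<in> I)"
    using fin by (subst (1) \<open>I = _\<close>, subst card_Un_disjoint) auto
  have rng: "cnt 0 (n - 1) \<le> card ?L \<and> card ?L \<le> cnt 0 (n - 1) + 1" if "I \<in> full_states"
    using that arc_root unfolding full_states_def by blast
  have "I \<in> full_states \<longleftrightarrow> card I = card B + 1 \<and>
     (\<forall>h j. arc h j \<longrightarrow> cnt h j \<le> card (?L \<inter> {h..<j}) \<and> card (?L \<inter> {h..<j}) \<le> cnt h j + 1)"
    unfolding full_states_def using assms res by auto
  moreover have "?L \<in> states 0 (n - 1) y \<longleftrightarrow> card ?L = card B + y \<and>
     (\<forall>h j. arc h j \<longrightarrow> cnt h j \<le> card (?L \<inter> {h..<j}) \<and> card (?L \<inter> {h..<j}) \<le> cnt h j + 1)" for y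
    unfolding states_def cB using bd by auto
  ultimately show ?thesis using cI by auto
qed

lemma sum_full_states:
  fixes f :: "nat set \<Rightarrow> real"
  shows "(\<Sum>I\<in>full_states. f I) = (\<Sum>I\<in>states 0 (n - 1) 1. f I) + (\<Sum>I\<in>states 0 (n - 1) 0. f (insert (n - 1) I))"
proof -
  have sub: "I \<subseteq> {0..<n - 1}" if "I \<in> states 0 (n - 1) y" for I y using statesD[OF that] by blast
  have eq: "full_states = states 0 (n - 1) 1 \<union> insert (n - 1) ` states 0 (n - 1) 0"
  proof
    show "full_states \<subseteq> states 0 (n - 1) 1 \<union> insert (n - 1) ` states 0 (n - 1) 0"
    proof
      fix I assume I: "I \<in> full_states"
      then have s: "I \<subseteq> {0..<n}" unfolding full_states_def by blast
      have N: "{0..<n} = insert (n - 1) {0..<n - 1}" using n3 by auto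
      have "I \<inter> {0..<n - 1} = I" if "n - 1 \<notin> I" using s that unfolding N by blast
      moreover have "insert (n - 1) (I \<inter> {0..<n - 1}) = I" if "n - 1 \<in> I" using s that unfolding N by blast
      ultimately show "I \<in> states 0 (n - 1) 1 \<union> insert (n - 1) ` states 0 (n - 1) 0"
        using I unfolding full_states_iff[OF s] by (metis UnI1 UnI2 image_eqI)
    qed
    show "states 0 (n - 1) 1 \<union> insert (n - 1) ` states 0 (n - 1) 0 \<subseteq> full_states"
    proof
      fix I assume "I \<in> states 0 (n - 1) 1 \<union> insert (n - 1) ` states 0 (n - 1) 0"
      then show "I \<in> full_states"
      proof
        assume I: "I \<in> states 0 (n - 1) 1"
        note s = sub[OF I]
        have "I \<subseteq> {0..<n}" "n - 1 \<notin> I" "I \<inter> {0..<n - 1} = I" using s by auto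
        then show ?thesis using full_states_iff I by auto
      next
        assume "I \<in> insert (n - 1) ` states 0 (n - 1) 0"
        then obtain J where J: "J \<in> states 0 (n - 1) 0" "I = insert (n - 1) J" by blast
        note s = sub[OF J(1)]
        have "I \<subseteq> {0..<n}" "n - 1 \<in> I" "I \<inter> {0..<n - 1} = J" using s J(2) n3 by auto
        then show ?thesis using full_states_iff J(1) by auto
      qed
    qed
  qed
  have "states 0 (n - 1) 1 \<inter> insert (n - 1) ` states 0 (n - 1) 0 = {}" using sub by fastforce
  moreover have "inj_on (insert (n - 1)) (states 0 (n - 1) 0)"
  proof (rule inj_onI)
    fix I J assume "I \<in> states 0 (n - 1) 0" "J \<in> states 0 (n - 1) 0" "insert (n - 1) I = insert (n - 1) J"
    moreover from this have "n - 1 \<notin> I" "n - 1 \<notin> J" using sub by fastforce+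
    ultimately show "I = J" by (metis insert_ident)
  qed
  ultimately show ?thesis unfolding eq using finite_states by (simp add: sum.union_disjoint sum.reindex)
qed

lemma realize_full:
  assumes x: "interior_point x 0 (n - 1)" and s: "(\<Sum>i=0..<n. x i) = real (card B) + 1"
  obtains \<tau> where "\<And>i. \<tau> i > 0" "(\<Sum>I\<in>full_states. \<Prod>i\<in>I. \<tau> i) > 0"
    "\<And>i. i < n \<Longrightarrow> (\<Sum>I\<in>full_states. (\<Prod>i\<in>I. \<tau> i) * of_bool (i \<in> I)) / (\<Sum>I\<in>full_states. \<Prod>i\<in>I. \<tau> i) = x i"
proof -
  let ?y = "excess x 0 (n - 1)"
  have y: "0 < ?y" "?y < 1" using x arc_root unfolding interior_point_def by auto
  obtain \<tau>' where t: "realizes x \<tau>' ?y 0 (n - 1)" using realizable[OF arc_root x y(1)] by blast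
  \<comment> \<open>with \<open>\<rho> = ?y\<close> and this weight, excess \<open>1\<close> and excess \<open>0\<close> get the probabilities \<open>?y\<close> and \<open>1 - ?y\<close>\<close>
  define \<tau> where "\<tau> = \<tau>'(n - 1 := 1 - ?y)"
  have w: "weight_sum \<tau> 0 (n - 1) z g = weight_sum \<tau>' 0 (n - 1) z g" for z g
    by (rule weight_sum_cong) (simp add: \<tau>_def)
  have pos: "\<tau> i > 0" for i using t y unfolding realizes_def \<tau>_def by auto
  let ?F = "\<lambda>z. weight_sum \<tau> 0 (n - 1) z one" and ?G = "\<lambda>z i. weight_sum \<tau> 0 (n - 1) z (has i)"
  have F: "?F 0 > 0" "?F 1 = ?y * ?F 0"
    and G: "\<And>i. i < n - 1 \<Longrightarrow> (1 - ?y) * (?G 0 i / ?F 0) + ?y * (?G 1 i / ?F 1) = x i"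
    using t unfolding realizes_def w by auto
  have sub: "I \<subseteq> {0..<n - 1} \<and> finite I \<and> n - 1 \<notin> I" if "I \<in> states 0 (n - 1) z" for I z using statesD[OF that] by auto
  have pr: "(\<Prod>i\<in>insert (n - 1) I. \<tau> i) = (1 - ?y) * (\<Prod>i\<in>I. \<tau> i)" if "I \<in> states 0 (n - 1) 0" for I
    using sub[OF that] by (simp add: \<tau>_def)
  have total: "(\<Sum>I\<in>full_states. (\<Prod>i\<in>I. \<tau> i) * g I) =
      weight_sum \<tau> 0 (n - 1) 1 g + (1 - ?y) * weight_sum \<tau> 0 (n - 1) 0 (\<lambda>I. g (insert (n - 1) I))" for g
    unfolding sum_full_states weight_sum_def sum_distrib_left
    by (intro arg_cong2[where f = "(+)"] refl sum.cong) (subst pr, assumption, simp only: mult_ac)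
  have o: "(\<lambda>I. one (insert (n - 1) I)) = one" by (simp add: one_def fun_eq_iff)
  have T: "(\<Sum>I\<in>full_states. \<Prod>i\<in>I. \<tau> i) = ?F 0"
    using total[of one] unfolding o F(2) by (simp add: one_def algebra_simps)
  have "(\<Sum>I\<in>full_states. (\<Prod>i\<in>I. \<tau> i) * of_bool (i \<in> I)) / ?F 0 = x i" if i: "i < n" for i
  proof (cases "i = n - 1")
    case True
    have "weight_sum \<tau> 0 (n - 1) 1 (has i) = 0" unfolding weight_sum_def has_def True
      using sub by (intro sum.neutral) auto
    moreover have "(\<lambda>I. has i (insert (n - 1) I)) = one" unfolding True has_def one_def by simp
    ultimately have "(\<Sum>I\<in>full_states. (\<Prod>i\<in>I. \<tau> i) * has i I) = (1 - ?y) * ?F 0" using total[of "has i"] by simp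
    moreover have "{0..<n} = insert (n - 1) {0..<n - 1}" using n3 by auto
    then have "x (n - 1) = 1 - ?y"
      using s unfolding excess_def count_in_root[OF B] by simp
    ultimately show ?thesis using F(1) True unfolding has_def by simp
  next
    case False
    then have i': "i < n - 1" using i by simp
    have "(\<lambda>I. has i (insert (n - 1) I)) = has i" using False unfolding has_def by (auto simp: fun_eq_iff)
    then have "(\<Sum>I\<in>full_states. (\<Prod>i\<in>I. \<tau> i) * has i I) = ?G 1 i + (1 - ?y) * ?G 0 i" using total[of "has i"] by simp
    then have "(\<Sum>I\<in>full_states. (\<Prod>i\<in>I. \<tau> i) * has i I) / ?F 0 = (1 - ?y) * (?G 0 i / ?F 0) + ?y * (?G 1 i / ?F 1)"
      unfolding F(2) using F(1) y by (simp add: field_simps)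
    then show ?thesis using G[OF i'] unfolding has_def by simp
  qed
  then show ?thesis using that[of \<tau>] pos T F(1) by simp
qed

lemma full_interior_point_exists:
  obtains x where "interior_point x 0 (n - 1)" "(\<Sum>i=0..<n. x i) = real (card B) + 1"
proof -
  obtain x where x: "interior_point x 0 (n - 1)" "excess x 0 (n - 1) = 1 / 2"
    using interior_point_exists[OF arc_root, of "1 / 2"] by auto
  define x' where "x' = x(n - 1 := 1 / 2)"
  have e: "excess x' h j = excess x h j" if "j \<le> n - 1" for h j
    unfolding excess_def x'_def using that by (auto intro!: sum.cong)
  then have "interior_point x' 0 (n - 1)" using x(1) unfolding interior_point_def by auto
  have "{0..<n} = insert (n - 1) {0..<n - 1}" using n3 by auto
  then have "(\<Sum>i=0..<n. x' i) = x' (n - 1) + (\<Sum>i=0..<n - 1. x' i)" by simp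
  moreover have "excess x' 0 (n - 1) = 1 / 2" using e[of "n - 1" 0] x(2) by simp
  then have "(\<Sum>i=0..<n - 1. x' i) = real (card B) + 1 / 2"
    unfolding excess_def count_in_root[OF B] by linarith
  moreover have "x' (n - 1) = 1 / 2" by (simp add: x'_def)
  ultimately have s: "(\<Sum>i=0..<n. x' i) = real (card B) + 1" by linarith
  show ?thesis by (rule that[OF \<open>interior_point x' 0 (n - 1)\<close> s])
qed

lemma full_states_matrix:
  obtains R where "length R = card B + 1" "\<And>w i. w \<in> set R \<Longrightarrow> i \<ge> n \<Longrightarrow> w i = 0"
    "\<And>I. I \<subseteq> {0..<n} \<Longrightarrow> minor R I = of_bool (I \<in> full_states)"
proof -
  obtain R v where R: "length R = cnt 0 (n - 1)" "\<And>w. w \<in> set (v # R) \<Longrightarrow> supported 0 (n - 1) w"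
    "\<And>I. I \<subseteq> {0..<n - 1} \<Longrightarrow> minor R I = of_bool (I \<in> states 0 (n - 1) 0) \<and> minor (v # R) I = of_bool (I \<in> states 0 (n - 1) 1)"
    using states_matrix[OF arc_root] by metis
  let ?e = "\<lambda>i. of_bool (i = n - 1) :: real"
  define r where "r = (\<lambda>i. 1 * v i + (-1) ^ length R * ?e i)"
  have "minor (r # R) I = of_bool (I \<in> full_states)" if I: "I \<subseteq> {0..<n}" for I
  proof -
    let ?L = "I \<inter> {0..<n - 1}" and ?N = "I \<inter> {n - 1..<n}"
    have fin: "finite I" using I finite_subset by blast
    have L: "?L \<subseteq> {0..<n - 1}" by auto
    have blocks: "minor (S1 @ S2) I = minor S1 ?L * minor S2 ?N"
      if "set S1 \<subseteq> set (v # R)" "set S2 \<subseteq> {?e}" for S1 S2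
    proof (rule minor_append[OF fin I])
      show "w i = 0" if "w \<in> set S1" "i \<notin> {0..<n - 1}" for w i
        using R(2)[of w] that \<open>set S1 \<subseteq> _\<close> unfolding supported_def by blast
      show "w i = 0" if "w \<in> set S2" "i \<notin> {n - 1..<n}" for w i
        using that \<open>set S2 \<subseteq> _\<close> n3 by auto
    qed auto
    have "{n - 1..<n} = {n - 1}" using n3 by auto
    then have N: "?N = (if n - 1 \<in> I then {n - 1} else {})" by auto
    have mN: "minor [] ?N = of_bool (n - 1 \<notin> I)" "minor [?e] ?N = of_bool (n - 1 \<in> I)"
      unfolding N using minor_single[of "n - 1"] by (auto simp del: minor.simps(2)) simp
    have "minor (r # R) I = minor ((v # R) @ []) I + (-1) ^ length R * minor (?e # R @ []) I"
      unfolding r_def minor_linear by simp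
    also have "\<dots> = minor ((v # R) @ []) I + minor (R @ [?e]) I"
      unfolding minor_rotate[OF fin] by (simp flip: mult.assoc power_add)
    also have "\<dots> = of_bool (?L \<in> states 0 (n - 1) 1) * of_bool (n - 1 \<notin> I) +
        of_bool (?L \<in> states 0 (n - 1) 0) * of_bool (n - 1 \<in> I)"
      using blocks[of "v # R" "[]"] blocks[of R "[?e]"] R(3)[OF L] mN
      by (simp add: subset_insertI del: minor.simps)
    also have "\<dots> = of_bool (I \<in> full_states)" unfolding full_states_iff[OF I] by auto
    finally show ?thesis .
  qed
  moreover have "w i = 0" if "w \<in> set (r # R)" "i \<ge> n" for w i
  proof -
    have "supported 0 (n - 1) v" "w \<in> set R \<Longrightarrow> supported 0 (n - 1) w" using R(2) by auto
    then show ?thesis using that n3 unfolding supported_def r_def by (cases "w = r") (auto simp: r_def)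
  qed
  moreover have "length (r # R) = card B + 1" using R(1) count_in_root[OF B] by simp
  ultimately show ?thesis using that by blast
qed

end

end

section \<open>Matchings of the dual tree\<close>

context arc_system
begin

definition side :: "nat \<Rightarrow> nat set" where "side i = {i, (i + 1) mod n}"

lemma side_simps: "i + 1 < n \<Longrightarrow> side i = {i, i + 1}" "side (n - 1) = {0, n - 1}"
  using n3 unfolding side_def by (auto simp: insert_commute)

lemma side_cases:
  assumes "i < n"
  obtains "i + 1 < n" "side i = {i, i + 1}" | "i = n - 1" "side i = {0, n - 1}"
  using assms side_simps(1)[of i] side_simps(2) by (cases "i + 1 < n") auto

lemma side_inj:
  assumes "i < n" "i' < n" "side i = side i'"
  shows "i = i'"
proof -
  have c: "i + 1 < n \<and> side i = {i, i + 1} \<or> i = n - 1 \<and> side i = {0, n - 1}" if "i < n" for i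
    using side_cases[OF that] by blast
  from c[OF assms(1)] c[OF assms(2)] show ?thesis
  proof (elim disjE conjE)
    assume "side i = {i, i + 1}" "side i' = {i', i' + 1}"
    then show ?thesis using assms(3) doubleton_eq_less[of i "i + 1" i' "i' + 1"] by simp
  next
    assume "side i = {i, i + 1}" "side i' = {0, n - 1}"
    then have "i = 0 \<and> i + 1 = n - 1" using assms(3) doubleton_eq_less[of i "i + 1" 0 "n - 1"] n3 by simp
    then show ?thesis using n3 by linarith
  next
    assume "side i = {0, n - 1}" "side i' = {i', i' + 1}"
    then have "0 = i' \<and> n - 1 = i' + 1" using assms(3) doubleton_eq_less[of 0 "n - 1" i' "i' + 1"] n3 by simp
    then show ?thesis using n3 by linarith
  qed simp
qed

definition at_side :: "nat \<Rightarrow> nat set \<Rightarrow> bool" where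
  "at_side i P \<longleftrightarrow> i < n \<and> P \<in> faces n D \<and> side i \<in> poly_edges P"

lemma at_side_inner:
  assumes "i + 1 < n"
  shows "at_side i P \<longleftrightarrow> (\<exists>a c. P = below a c \<and> lower_edge a c i (i + 1))"
proof
  assume a: "at_side i P"
  then have "P \<in> faces n D" "{i, i + 1} \<in> poly_edges P" using side_simps(1)[OF assms] unfolding at_side_def by auto
  then show "\<exists>a c. P = below a c \<and> lower_edge a c i (i + 1)"
    by (cases rule: edge_faces) auto
next
  assume "\<exists>a c. P = below a c \<and> lower_edge a c i (i + 1)"
  then obtain a c where P: "P = below a c" "lower_edge a c i (i + 1)" by blast
  then show "at_side i P" unfolding at_side_def side_simps(1)[OF assms]
    using below_face[OF lower_edgeD(1,2)[OF P(2)]] lower_edge_poly_edge[OF P(2)] assms by auto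
qed

lemma at_side_last: "at_side (n - 1) P \<longleftrightarrow> P = below 0 (n - 1)"
proof
  assume a: "at_side (n - 1) P"
  then have PF: "P \<in> faces n D" and e: "{0, n - 1} \<in> poly_edges P" using side_simps(2) unfolding at_side_def by auto
  have "0 < n - 1" using n3 by simp
  with PF e show "P = below 0 (n - 1)"
  proof (rule edge_faces)
    fix a c assume "P = below a c" "lower_edge a c 0 (n - 1)"
    then show ?thesis using lower_edgeD[of a c 0 "n - 1"] arc_bound[of a c] by auto
  qed
next
  assume "P = below 0 (n - 1)"
  then show "at_side (n - 1) P" unfolding at_side_def side_simps(2)
    using below_face[OF arc_root] below_edge_top[OF arc_root] n3 by auto
qed

lemma at_side_unique: "at_side i P \<Longrightarrow> at_side i Q \<Longrightarrow> P = Q"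
proof -
  assume a: "at_side i P" "at_side i Q"
  then have "i < n" unfolding at_side_def by blast
  then show "P = Q"
  proof (cases rule: side_cases)
    case 1
    then show ?thesis using a lower_edge_unique unfolding at_side_inner[OF 1(1)] by metis
  next
    case 2
    then show ?thesis using a at_side_last by auto
  qed
qed

lemma at_side_exists:
  assumes "i < n"
  obtains P where "at_side i P"
  using assms
proof (cases rule: side_cases)
  case 1
  have "(i, i + 1) \<noteq> (0, n - 1)" using n3 by auto
  then obtain a c where "lower_edge a c i (i + 1)" using lower_edge_exists[OF arc_Suc[OF 1(1)]] by blast
  then show ?thesis using that at_side_inner[OF 1(1)] by blast
next
  case 2
  then show ?thesis using that at_side_last by blast
qed

lemma faces_share_one_edge:
  assumes "P \<in> faces n D" "Q \<in> faces n D" "P \<noteq> Q"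
    and "e \<in> poly_edges P" "e \<in> poly_edges Q" "e' \<in> poly_edges P" "e' \<in> poly_edges Q"
  shows "e = e'"
proof (rule ccontr)
  assume n: "e \<noteq> e'"
  obtain p q where e: "e = {p, q}" "p < q" "p \<in> P" "q \<in> P" using poly_edgesE[OF assms(4)] by metis
  obtain p' q' where e': "e' = {p', q'}" "p' < q'" "p' \<in> P" "q' \<in> P" using poly_edgesE[OF assms(6)] by metis
  have "e \<subseteq> Q" "e' \<subseteq> Q" using assms(5,7) by (auto elim: poly_edgesE)
  then have "e \<union> e' \<subseteq> P" "e \<union> e' \<subseteq> Q" using e e' by auto
  moreover have "3 \<le> card (e \<union> e')"
  proof -
    have c: "card e = 2" "card e' = 2" "finite e" "finite e'" using e e' by auto
    have "\<not> e' \<subseteq> e" using n card_subset_eq[of e e'] c by auto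
    then have "e \<subset> e \<union> e'" by blast
    then have "card e < card (e \<union> e')" using c by (intro psubset_card_mono) auto
    then show ?thesis using c by simp
  qed
  ultimately show False using face_unique[OF assms(1,2)] assms(3) by blast
qed

lemma edge_two_faces:
  assumes "P \<in> faces n D" "Q \<in> faces n D" "R \<in> faces n D" "P \<noteq> Q"
    and "e \<in> poly_edges P" "e \<in> poly_edges Q" "e \<in> poly_edges R"
  shows "R = P \<or> R = Q"
proof -
  obtain h j where e: "e = {h, j}" "h < j" using poly_edgesE[OF assms(5)] by metis
  have c: "X = below h j \<or> (\<exists>a c. X = below a c \<and> lower_edge a c h j)" if "X \<in> faces n D" "e \<in> poly_edges X" for X
    using edge_faces[OF that(1) _ e(2)] that(2) unfolding e(1) by metis
  show ?thesis using c[OF assms(1,5)] c[OF assms(2,6)] c[OF assms(3,7)] assms(4) lower_edge_unique by metis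
qed

lemma edge_cases:
  assumes P: "P \<in> faces n D" and e: "e \<in> poly_edges P"
  obtains i where "at_side i P" "e = side i" | Q where "Q \<in> faces n D" "Q \<noteq> P" "e \<in> poly_edges Q"
proof -
  obtain h j where hj: "e = {h, j}" "h < j" using poly_edgesE[OF e] by metis
  have arc: "arc h j" using polygon_arc[OF face_polygon[OF P]] e hj by blast
  then have b: "j < n" by (rule arc_bound)
  show ?thesis
  proof (cases "e \<in> sides n")
    case True
    then have "j = h + 1 \<or> h = 0 \<and> j = n - 1" using hj mem_sides by blast
    then show ?thesis
    proof
      assume j: "j = h + 1"
      then have "e = side h" using hj b side_simps(1) by simp
      moreover from this have "at_side h P" unfolding at_side_def using P e b hj by auto
      ultimately show ?thesis using that by blast
    next
      assume j: "h = 0 \<and> j = n - 1"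
      then have "e = side (n - 1)" using hj side_simps(2) by simp
      moreover from this have "at_side (n - 1) P" unfolding at_side_def using P e n3 by auto
      ultimately show ?thesis using that by blast
    qed
  next
    case False
    then have nn: "(h, j) \<noteq> (0, n - 1)" "h + 1 < j" using hj b mem_sides[of h j n] by auto
    obtain a c where l: "lower_edge a c h j" using lower_edge_exists[OF arc nn(1)] .
    have "below h j \<in> faces n D" "e \<in> poly_edges (below h j)"
      "below a c \<in> faces n D" "e \<in> poly_edges (below a c)" "below h j \<noteq> below a c"
      using below_face[OF arc nn(2)] below_edge_top[OF arc nn(2)] below_face[OF lower_edgeD(1,2)[OF l]]
        lower_edge_poly_edge[OF l] below_neq_lower_edge[OF l] hj by auto
    then show ?thesis using that by metis
  qed
qed

text \<open>What remains of an almost perfect matching after forgetting boundary and bivalent vertices: every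
  region selects one of its edges, and both regions at a diagonal select it or none.\<close>

definition exact :: "nat set set \<Rightarrow> bool" where
  "exact U \<longleftrightarrow> (\<forall>P\<in>faces n D. \<exists>!e. e \<in> U \<and> e \<in> poly_edges P)"

lemma exactD: "exact U \<Longrightarrow> P \<in> faces n D \<Longrightarrow> \<exists>!e. e \<in> U \<and> e \<in> poly_edges P"
  unfolding exact_def by (rule bspec)

end

context colored
begin

definition adj :: "nat set \<Rightarrow> nat set \<Rightarrow> bool" where
  "adj P Q \<longleftrightarrow> P \<in> faces n D0 \<and> Q \<in> faces n D0 \<and> P \<noteq> Q \<and> poly_edges P \<inter> poly_edges Q \<noteq> {}"

abbreviation SS :: bicolored where
  "SS \<equiv> \<lparr>diags = D0, blacks = {P \<in> faces n D0. black P}\<rparr>"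

text \<open>A side of a black region reaches the boundary through a bivalent vertex, which is matched to the
  boundary exactly if it is not matched to the region.\<close>

definition boundary_rel :: "nat set \<Rightarrow> nat set set \<Rightarrow> bool" where
  "boundary_rel I U \<longleftrightarrow> I \<subseteq> {0..<n} \<and> (\<forall>i P. S.at_side i P \<longrightarrow> (i \<in> I \<longleftrightarrow> (S.side i \<in> U) \<noteq> black P))"

lemma doubleton_gvertex:
  "{Boundary i, Region P} = {Boundary i', Region P'} \<longleftrightarrow> i = i' \<and> P = P'"
  "{Boundary i, Bivalent i} = {Boundary i', Bivalent i'} \<longleftrightarrow> i = i'"
  "{Bivalent i, Region P} = {Bivalent i', Region P'} \<longleftrightarrow> i = i' \<and> P = P'"
  "{Boundary i, Region P} \<noteq> {Region Q, Region Q'}"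
  "{Boundary i, Region P} \<noteq> {Bivalent i', Region Q}"
  "{Boundary i, Region P} \<noteq> {Boundary i', Bivalent i''}"
  by (auto simp: doubleton_eq_iff)

lemma black_boundary_edges_iff: "(i, P) \<in> black_boundary_edges n SS \<longleftrightarrow> S.at_side i P \<and> black P"
  unfolding black_boundary_edges_def dual_tree_edges_def S.at_side_def S.side_def
  by (auto simp: doubleton_eq_iff)

lemma plabic_edges_iff:
  "f \<in> plabic_edges n SS \<longleftrightarrow> (\<exists>P Q. f = {Region P, Region Q} \<and> adj P Q) \<or>
     (\<exists>i P. f = {Boundary i, Region P} \<and> S.at_side i P \<and> \<not> black P) \<or>
     (\<exists>i P. S.at_side i P \<and> black P \<and> (f = {Boundary i, Bivalent i} \<or> f = {Bivalent i, Region P}))"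
proof -
  have d: "f \<in> dual_tree_edges n SS \<longleftrightarrow> (\<exists>P Q. f = {Region P, Region Q} \<and> adj P Q) \<or>
     (\<exists>i P. f = {Boundary i, Region P} \<and> S.at_side i P)"
    unfolding dual_tree_edges_def adj_def S.at_side_def S.side_def by auto
  have b: "f \<in> {{Boundary i, Region P} | i P. (i, P) \<in> black_boundary_edges n SS} \<longleftrightarrow>
     (\<exists>i P. f = {Boundary i, Region P} \<and> S.at_side i P \<and> black P)"
    unfolding black_boundary_edges_iff by blast
  have c: "f \<in> (\<Union>(i, P)\<in>black_boundary_edges n SS. {{Boundary i, Bivalent i}, {Bivalent i, Region P}}) \<longleftrightarrow>
     (\<exists>i P. S.at_side i P \<and> black P \<and> (f = {Boundary i, Bivalent i} \<or> f = {Bivalent i, Region P}))"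
    using black_boundary_edges_iff by auto
  have n1: "\<not> ((\<exists>P Q. f = {Region P, Region Q} \<and> adj P Q) \<and> (\<exists>i P. f = {Boundary i, Region P} \<and> S.at_side i P \<and> black P))"
    by (auto simp: doubleton_eq_iff)
  have n2: "(\<exists>i P. f = {Boundary i, Region P} \<and> S.at_side i P) \<and>
      \<not> (\<exists>i P. f = {Boundary i, Region P} \<and> S.at_side i P \<and> black P) \<longleftrightarrow>
      (\<exists>i P. f = {Boundary i, Region P} \<and> S.at_side i P \<and> \<not> black P)"
    using doubleton_gvertex(1) by (metis (no_types, lifting))
  have bool_eq: "((X \<or> Y) \<and> \<not> Y') \<or> C \<longleftrightarrow> X \<or> W \<or> C" if "\<not> (X \<and> Y')" "Y \<and> \<not> Y' \<longleftrightarrow> W" for X Y Y' C W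
    using that by blast
  show ?thesis unfolding plabic_edges_def Un_iff Diff_iff d b c by (rule bool_eq[OF n1 n2])
qed

lemma internal_vertices_iff:
  "v \<in> internal_vertices n SS \<longleftrightarrow> (\<exists>P\<in>faces n D0. v = Region P) \<or> (\<exists>i P. v = Bivalent i \<and> S.at_side i P \<and> black P)"
proof -
  have e: "black_boundary_edges n SS = {(i, P). S.at_side i P \<and> black P}"
    using black_boundary_edges_iff by auto
  have "(Bivalent \<circ> fst) ` {(i, P). S.at_side i P \<and> black P} = {Bivalent i | i P. S.at_side i P \<and> black P}"
    by force
  then show ?thesis unfolding internal_vertices_def e by auto
qed

text \<open>Two regions share at most one edge, so a matching edge between regions determines a diagonal; a
  side belongs to one region only.\<close>

lemma matching_gives_edges:
  assumes M: "almost_perfect_matching n SS M"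
  obtains U where "S.exact U" "boundary_rel (matching_boundary n M) U"
proof -
  have MP: "\<And>f. f \<in> M \<Longrightarrow> f \<in> plabic_edges n SS"
    and MI: "\<And>v. v \<in> internal_vertices n SS \<Longrightarrow> \<exists>!e. e \<in> M \<and> v \<in> e"
    using M unfolding almost_perfect_matching_def by auto
  define U where "U = {e. (\<exists>P Q. adj P Q \<and> e \<in> poly_edges P \<inter> poly_edges Q \<and> {Region P, Region Q} \<in> M) \<or>
    (\<exists>i P. S.at_side i P \<and> e = S.side i \<and> ({Boundary i, Region P} \<in> M \<or> {Bivalent i, Region P} \<in> M))}"
  have rep: "(\<exists>Q. adj P Q \<and> e \<in> poly_edges P \<inter> poly_edges Q \<and> {Region P, Region Q} \<in> M) \<or>
      (\<exists>i. S.at_side i P \<and> e = S.side i \<and> ({Boundary i, Region P} \<in> M \<or> {Bivalent i, Region P} \<in> M))"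
    if e: "e \<in> U" "e \<in> poly_edges P" and P: "P \<in> faces n D0" for e P
    using e(1) unfolding U_def mem_Collect_eq
  proof (elim disjE exE conjE)
    fix P' Q assume a: "adj P' Q" "e \<in> poly_edges P' \<inter> poly_edges Q" "{Region P', Region Q} \<in> M"
    then have "P = P' \<or> P = Q" using S.edge_two_faces[of P' Q P e] P e(2) unfolding adj_def by blast
    then show ?thesis
    proof
      assume "P = Q"
      moreover have "adj Q P'" using a(1) unfolding adj_def by blast
      moreover have "{Region Q, Region P'} \<in> M" using a(3) by (simp add: insert_commute)
      ultimately show ?thesis using a(2) by blast
    qed (use a in blast)
  next
    fix i P' assume a: "S.at_side i P'" "e = S.side i" "{Boundary i, Region P'} \<in> M"
    then have "S.at_side i P" using e(2) P unfolding S.at_side_def by blast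
    then have "P' = P" using S.at_side_unique a(1) by blast
    then show ?thesis using a by blast
  next
    fix i P' assume a: "S.at_side i P'" "e = S.side i" "{Bivalent i, Region P'} \<in> M"
    then have "S.at_side i P" using e(2) P unfolding S.at_side_def by blast
    then have "P' = P" using S.at_side_unique a(1) by blast
    then show ?thesis using a by blast
  qed
  have "S.exact U" unfolding S.exact_def
  proof
    fix P assume P: "P \<in> faces n D0"
    obtain f where f: "f \<in> M" "Region P \<in> f" and fu: "\<And>g. g \<in> M \<Longrightarrow> Region P \<in> g \<Longrightarrow> g = f"
      using MI[of "Region P"] P internal_vertices_iff by blast
    have "\<exists>e. e \<in> U \<and> e \<in> poly_edges P"
      using MP[OF f(1)] unfolding plabic_edges_iff
    proof (elim disjE exE conjE)
      fix P' Q assume a: "f = {Region P', Region Q}" "adj P' Q"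
      then obtain e where "e \<in> poly_edges P' \<inter> poly_edges Q" unfolding adj_def by blast
      then have "e \<in> U" "e \<in> poly_edges P" using a f unfolding U_def by auto
      then show ?thesis by blast
    next
      fix i P' assume a: "f = {Boundary i, Region P'}" "S.at_side i P'"
      then have "S.side i \<in> U" "S.side i \<in> poly_edges P" using f unfolding U_def S.at_side_def by auto
      then show ?thesis by blast
    next
      fix i P' assume a: "S.at_side i P'" "f = {Bivalent i, Region P'}"
      then have "S.side i \<in> U" "S.side i \<in> poly_edges P" using f unfolding U_def S.at_side_def by auto
      then show ?thesis by blast
    qed (use f in auto)
    moreover have "e = e'" if e: "e \<in> U" "e \<in> poly_edges P" and e': "e' \<in> U" "e' \<in> poly_edges P" for e e'
    proof -
      have r: "(\<exists>Q. adj P Q \<and> e \<in> poly_edges P \<inter> poly_edges Q \<and> f = {Region P, Region Q}) \<or>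
        (\<exists>i. S.at_side i P \<and> e = S.side i \<and> (f = {Boundary i, Region P} \<or> f = {Bivalent i, Region P}))"
        if "e \<in> U" "e \<in> poly_edges P" for e
        using rep[OF that P] fu by blast
      from r[OF e] show ?thesis
      proof (elim disjE exE conjE)
        fix Q assume a: "adj P Q" "e \<in> poly_edges P \<inter> poly_edges Q" "f = {Region P, Region Q}"
        from r[OF e'] obtain Q' where q: "adj P Q'" "e' \<in> poly_edges P \<inter> poly_edges Q'" "{Region P, Region Q'} = f"
          using a(3) by (auto simp: doubleton_eq_iff)
        then have "Q' = Q" using a(3) by (auto simp: doubleton_eq_iff)
        then show ?thesis using S.faces_share_one_edge[of P Q e e'] a q(2) unfolding adj_def by blast
      next
        fix i assume a: "e = S.side i" "f = {Boundary i, Region P}"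
        then show ?thesis using r[OF e'] by (auto simp: doubleton_eq_iff)
      next
        fix i assume a: "e = S.side i" "f = {Bivalent i, Region P}"
        then show ?thesis using r[OF e'] by (auto simp: doubleton_eq_iff)
      qed
    qed
    ultimately show "\<exists>!e. e \<in> U \<and> e \<in> poly_edges P" by blast
  qed
  moreover have "boundary_rel (matching_boundary n M) U"
    unfolding boundary_rel_def
  proof (intro conjI allI impI)
    show "matching_boundary n M \<subseteq> {0..<n}" unfolding matching_boundary_def by auto
    fix i P assume iP: "S.at_side i P"
    then have i: "i < n" and P: "P \<in> faces n D0" "S.side i \<in> poly_edges P" unfolding S.at_side_def by auto
    have U: "S.side i \<in> U \<longleftrightarrow> {Boundary i, Region P} \<in> M \<or> {Bivalent i, Region P} \<in> M"
    proof
      assume "S.side i \<in> U"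
      from rep[OF this P(2,1)] show "{Boundary i, Region P} \<in> M \<or> {Bivalent i, Region P} \<in> M"
      proof (elim disjE exE conjE)
        fix Q assume "adj P Q" "S.side i \<in> poly_edges P \<inter> poly_edges Q"
        then have "S.at_side i Q" "P \<noteq> Q" using i unfolding adj_def S.at_side_def by auto
        then show ?thesis using S.at_side_unique iP by blast
      next
        fix i' assume a: "S.at_side i' P" "S.side i = S.side i'" "{Boundary i', Region P} \<in> M"
        then have "i' = i" using S.side_inj i unfolding S.at_side_def by metis
        then show ?thesis using a by blast
      next
        fix i' assume a: "S.at_side i' P" "S.side i = S.side i'" "{Bivalent i', Region P} \<in> M"
        then have "i' = i" using S.side_inj i unfolding S.at_side_def by metis
        then show ?thesis using a by blast
      qed
    qed (use iP in \<open>auto simp: U_def\<close>)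
    have bd: "f = {Boundary i, Region P} \<and> \<not> black P \<or> f = {Boundary i, Bivalent i} \<and> black P"
      if "f \<in> M" "Boundary i \<in> f" for f
      using MP[OF that(1)] that(2) S.at_side_unique[OF iP] unfolding plabic_edges_iff by auto
    show "(i \<in> matching_boundary n M) = ((S.side i \<in> U) \<noteq> black P)"
    proof (cases "black P")
      case False
      have "{Bivalent i, Region P} \<notin> M"
      proof
        assume "{Bivalent i, Region P} \<in> M"
        from MP[OF this] show False using False unfolding plabic_edges_iff by (auto simp: doubleton_eq_iff)
      qed
      then have "S.side i \<in> U \<longleftrightarrow> {Boundary i, Region P} \<in> M" using U by blast
      also have "\<dots> \<longleftrightarrow> i \<in> matching_boundary n M"
        using bd False i unfolding matching_boundary_def by blast
      finally show ?thesis using False by blast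
    next
      case True
      have "{Boundary i, Region P} \<notin> M"
      proof
        assume "{Boundary i, Region P} \<in> M"
        from MP[OF this] show False using True unfolding plabic_edges_iff by (auto simp: doubleton_eq_iff)
      qed
      then have u: "S.side i \<in> U \<longleftrightarrow> {Bivalent i, Region P} \<in> M" using U by blast
      have "Bivalent i \<in> internal_vertices n SS" using internal_vertices_iff iP True by blast
      then obtain g where g: "g \<in> M" "Bivalent i \<in> g" "\<And>g'. g' \<in> M \<Longrightarrow> Bivalent i \<in> g' \<Longrightarrow> g' = g"
        using MI by metis
      have "g = {Boundary i, Bivalent i} \<or> g = {Bivalent i, Region P}"
        using MP[OF g(1)] g(2) S.at_side_unique[OF iP] unfolding plabic_edges_iff by auto
      moreover have "{Boundary i, Bivalent i} \<noteq> {Bivalent i, Region P}" by (auto simp: doubleton_eq_iff)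
      ultimately have "{Boundary i, Bivalent i} \<in> M \<longleftrightarrow> {Bivalent i, Region P} \<notin> M" using g by (metis insertI1 insertI2)
      moreover have "i \<in> matching_boundary n M \<longleftrightarrow> {Boundary i, Bivalent i} \<in> M"
        using bd True i unfolding matching_boundary_def by blast
      ultimately show ?thesis using u True by blast
    qed
  qed
  ultimately show ?thesis using that by blast
qed

lemma edges_give_matching:
  assumes U: "S.exact U" and I: "boundary_rel I U"
  shows "I \<in> matching_positroid n SS"
proof -
  define M where "M = {f. (\<exists>P Q. f = {Region P, Region Q} \<and> adj P Q \<and> (\<exists>e\<in>U. e \<in> poly_edges P \<inter> poly_edges Q)) \<or>
     (\<exists>i P. f = {Boundary i, Region P} \<and> S.at_side i P \<and> \<not> black P \<and> S.side i \<in> U) \<or>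
     (\<exists>i P. f = {Bivalent i, Region P} \<and> S.at_side i P \<and> black P \<and> S.side i \<in> U) \<or>
     (\<exists>i P. f = {Boundary i, Bivalent i} \<and> S.at_side i P \<and> black P \<and> S.side i \<notin> U)}"
  have MR: "{Region P, Region Q} \<in> M" if "adj P Q" "e \<in> U" "e \<in> poly_edges P" "e \<in> poly_edges Q" for P Q e
    unfolding M_def using that by (intro CollectI disjI1 exI[of _ P] exI[of _ Q] conjI bexI[of _ e]) auto
  have MB: "{Boundary i, Region P} \<in> M" if "S.at_side i P" "\<not> black P" "S.side i \<in> U" for i P
    unfolding M_def using that by (intro CollectI disjI2[OF disjI1] exI[of _ P] exI[of _ i] conjI) auto
  have MV: "{Bivalent i, Region P} \<in> M" if "S.at_side i P" "black P" "S.side i \<in> U" for i P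
    unfolding M_def using that by (intro CollectI disjI2[OF disjI2[OF disjI1]] exI[of _ P] exI[of _ i] conjI) auto
  have MW: "{Boundary i, Bivalent i} \<in> M" if "S.at_side i P" "black P" "S.side i \<notin> U" for i P
    unfolding M_def using that by (intro CollectI disjI2[OF disjI2[OF disjI2]] exI[of _ P] exI[of _ i] conjI) auto
  have ME: thesis if "f \<in> M"
    "\<And>P Q e. f = {Region P, Region Q} \<Longrightarrow> adj P Q \<Longrightarrow> e \<in> U \<Longrightarrow> e \<in> poly_edges P \<Longrightarrow> e \<in> poly_edges Q \<Longrightarrow> thesis"
    "\<And>i P. f = {Boundary i, Region P} \<Longrightarrow> S.at_side i P \<Longrightarrow> \<not> black P \<Longrightarrow> S.side i \<in> U \<Longrightarrow> thesis"
    "\<And>i P. f = {Bivalent i, Region P} \<Longrightarrow> S.at_side i P \<Longrightarrow> black P \<Longrightarrow> S.side i \<in> U \<Longrightarrow> thesis"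
    "\<And>i P. f = {Boundary i, Bivalent i} \<Longrightarrow> S.at_side i P \<Longrightarrow> black P \<Longrightarrow> S.side i \<notin> U \<Longrightarrow> thesis" for f thesis
    using that(1) unfolding M_def mem_Collect_eq by (elim disjE exE conjE bexE IntE) (rule that(2-5); assumption)+
  have "M \<subseteq> plabic_edges n SS"
  proof
    fix f assume "f \<in> M"
    then show "f \<in> plabic_edges n SS" unfolding plabic_edges_iff by (rule ME) blast+
  qed
  moreover have MI1: "\<exists>!f. f \<in> M \<and> Region P \<in> f" if P: "P \<in> faces n D0" for P
  proof -
    have ex: "\<exists>!e. e \<in> U \<and> e \<in> poly_edges P" by (rule S.exactD[OF U P])
    then obtain e where e0: "e \<in> U \<and> e \<in> poly_edges P" and eu0: "\<forall>e'. e' \<in> U \<and> e' \<in> poly_edges P \<longrightarrow> e' = e"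
      by (rule ex1E)
    have e: "e \<in> U" "e \<in> poly_edges P" and eu: "\<And>e'. e' \<in> U \<Longrightarrow> e' \<in> poly_edges P \<Longrightarrow> e' = e"
      using e0 eu0 by blast+
    have uses: "(\<exists>Q. f = {Region P, Region Q} \<and> adj P Q \<and> e \<in> poly_edges Q) \<or>
       (\<exists>i. S.at_side i P \<and> S.side i = e \<and> f = (if black P then {Bivalent i, Region P} else {Boundary i, Region P}))"
      if f: "f \<in> M" "Region P \<in> f" for f
    proof (rule ME[OF f(1)])
      fix P' Q e' assume a: "f = {Region P', Region Q}" "adj P' Q" "e' \<in> U" "e' \<in> poly_edges P'" "e' \<in> poly_edges Q"
      have pq: "P = P' \<or> P = Q" using a(1) f(2) by auto
      then have "e' = e" using eu[of e'] a(3-5) by auto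
      then show ?thesis
      proof (cases "P = P'")
        case False
        then have "P = Q" using pq by simp
        moreover have "adj Q P'" using a(2) unfolding adj_def by blast
        moreover have "f = {Region Q, Region P'}" using a(1) by (simp add: insert_commute)
        ultimately show ?thesis using a(4) \<open>e' = e\<close> by blast
      qed (use a \<open>e' = e\<close> in blast)
    next
      fix i P' assume a: "f = {Boundary i, Region P'}" "S.at_side i P'" "\<not> black P'" "S.side i \<in> U"
      then have p: "P' = P" using f(2) by auto
      have "S.side i = e" using eu[OF a(4)] a(2) p unfolding S.at_side_def by blast
      then show ?thesis using a p by auto
    next
      fix i P' assume a: "f = {Bivalent i, Region P'}" "S.at_side i P'" "black P'" "S.side i \<in> U"
      then have p: "P' = P" using f(2) by auto
      have "S.side i = e" using eu[OF a(4)] a(2) p unfolding S.at_side_def by blast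
      then show ?thesis using a p by auto
    next
      fix i P' assume "f = {Boundary i, Bivalent i}"
      then show ?thesis using f(2) by auto
    qed
    show ?thesis
    proof (rule S.edge_cases[OF P e(2)])
      fix i assume side: "S.at_side i P" "e = S.side i"
      show ?thesis
      proof (rule ex1I[of _ "if black P then {Bivalent i, Region P} else {Boundary i, Region P}"])
        show "(if black P then {Bivalent i, Region P} else {Boundary i, Region P}) \<in> M \<and>
            Region P \<in> (if black P then {Bivalent i, Region P} else {Boundary i, Region P})"
          using MB[OF side(1)] MV[OF side(1)] e(1) side(2) by auto
        fix g assume g: "g \<in> M \<and> Region P \<in> g"
        from uses[OF conjunct1[OF g] conjunct2[OF g]] show "g = (if black P then {Bivalent i, Region P} else {Boundary i, Region P})"
        proof (elim disjE exE conjE)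
          fix Q assume "adj P Q" "e \<in> poly_edges Q"
          then have "S.at_side i Q" "Q \<noteq> P" using side unfolding S.at_side_def adj_def by auto
          then show ?thesis using S.at_side_unique side(1) by blast
        next
          fix i' assume a: "S.at_side i' P" "S.side i' = e"
            "g = (if black P then {Bivalent i', Region P} else {Boundary i', Region P})"
          then have "i' = i" using S.side_inj side unfolding S.at_side_def by metis
          then show ?thesis using a(3) by simp
        qed
      qed
    next
      fix Q assume inner: "Q \<in> faces n D0" "Q \<noteq> P" "e \<in> poly_edges Q"
      have aPQ: "adj P Q" using inner P e unfolding adj_def by blast
      show ?thesis
      proof (rule ex1I[of _ "{Region P, Region Q}"])
        show "{Region P, Region Q} \<in> M \<and> Region P \<in> {Region P, Region Q}" using MR[OF aPQ e inner(3)] by simp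
        fix g assume g: "g \<in> M \<and> Region P \<in> g"
        from uses[OF conjunct1[OF g] conjunct2[OF g]] show "g = {Region P, Region Q}"
        proof (elim disjE exE conjE)
          fix Q' assume a: "g = {Region P, Region Q'}" "adj P Q'" "e \<in> poly_edges Q'"
          then have "Q' = P \<or> Q' = Q" using S.edge_two_faces[of P Q Q' e] inner P e(2) unfolding adj_def by blast
          then show ?thesis using a(1,2) unfolding adj_def by blast
        next
          fix i assume a: "S.at_side i P" "S.side i = e"
          then have "S.at_side i Q" using inner unfolding S.at_side_def by blast
          then show ?thesis using S.at_side_unique a inner by blast
        qed
      qed
    qed
  qed
  moreover have MI2: "\<exists>!f. f \<in> M \<and> Bivalent i \<in> f" if iP: "S.at_side i P" "black P" for i P
  proof (rule ex1I[of _ "if S.side i \<in> U then {Bivalent i, Region P} else {Boundary i, Bivalent i}"])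
    show "(if S.side i \<in> U then {Bivalent i, Region P} else {Boundary i, Bivalent i}) \<in> M \<and>
        Bivalent i \<in> (if S.side i \<in> U then {Bivalent i, Region P} else {Boundary i, Bivalent i})"
      using MV[OF iP] MW[OF iP] by auto
    fix g assume g: "g \<in> M \<and> Bivalent i \<in> g"
    show "g = (if S.side i \<in> U then {Bivalent i, Region P} else {Boundary i, Bivalent i})"
    proof (rule ME[OF conjunct1[OF g]])
      fix i' P' assume a: "g = {Bivalent i', Region P'}" "S.at_side i' P'" "S.side i' \<in> U"
      then have i: "i' = i" using g by auto
      then have "P' = P" using S.at_side_unique[OF iP(1)] a(2) by simp
      then show ?thesis using a i by simp
    qed (use g in auto)
  qed
  ultimately have "almost_perfect_matching n SS M"
    unfolding almost_perfect_matching_def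
  proof (intro conjI ballI allI impI)
    fix v assume "v \<in> internal_vertices n SS"
    then show "\<exists>!f. f \<in> M \<and> v \<in> f"
      unfolding internal_vertices_iff using MI1 MI2 by (elim disjE exE bexE conjE) simp_all
  next
    fix i f g assume "i < n" and fg: "f \<in> M" "g \<in> M" "Boundary i \<in> f \<and> Boundary i \<in> g"
    obtain P where P: "S.at_side i P" using S.at_side_exists[OF \<open>i < n\<close>] .
    have c: "f = {Boundary i, if black P then Bivalent i else Region P}" if f: "f \<in> M" "Boundary i \<in> f" for f
    proof (rule ME[OF f(1)])
      fix i' P' assume a: "f = {Boundary i', Region P'}" "S.at_side i' P'" "\<not> black P'"
      then have i: "i' = i" using f by auto
      then have "P' = P" using S.at_side_unique[OF P] a(2) by simp
      then show ?thesis using a i by simp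
    next
      fix i' P' assume a: "f = {Boundary i', Bivalent i'}" "S.at_side i' P'" "black P'"
      then have i: "i' = i" using f by auto
      then have "P' = P" using S.at_side_unique[OF P] a(2) by simp
      then show ?thesis using a i by simp
    qed (use f in auto)
    show "f = g" using c[of f] c[of g] fg by simp
  qed
  moreover have "matching_boundary n M = I"
  proof
    show "matching_boundary n M \<subseteq> I"
    proof
      fix i assume "i \<in> matching_boundary n M"
      then obtain f where f: "i < n" "f \<in> M" "Boundary i \<in> f" unfolding matching_boundary_def by blast
      have "\<exists>P. S.at_side i P \<and> (S.side i \<in> U) \<noteq> black P"
        by (rule ME[OF f(2)]) (use f(3) in auto)
      then show "i \<in> I" using I unfolding boundary_rel_def by blast
    qed
    show "I \<subseteq> matching_boundary n M"
    proof
      fix i assume i: "i \<in> I"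
      then have "i < n" using I unfolding boundary_rel_def by auto
      obtain P where P: "S.at_side i P" using S.at_side_exists[OF \<open>i < n\<close>] .
      then have "(S.side i \<in> U) \<noteq> black P" using I i unfolding boundary_rel_def by blast
      then have "{Boundary i, if black P then Bivalent i else Region P} \<in> M"
        using MB[OF P] MW[OF P] by (cases "black P") auto
      then show "i \<in> matching_boundary n M" unfolding matching_boundary_def using \<open>i < n\<close> by blast
    qed
  qed
  ultimately show ?thesis unfolding matching_positroid_def by blast
qed

section \<open>The matching positroid in terms of areas\<close>

definition used :: "nat set set \<Rightarrow> nat \<Rightarrow> nat \<Rightarrow> nat \<Rightarrow> nat \<Rightarrow> nat" where
  "used U a c h j = card {(p, q). S.lower_edge a c p q \<and> {p, q} \<in> U \<and> h \<le> p \<and> q \<le> j}"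

lemma finite_used: "finite {(p, q). S.lower_edge a c p q \<and> {p, q} \<in> U \<and> h \<le> p \<and> q \<le> j}"
proof (rule finite_subset)
  show "{(p, q). S.lower_edge a c p q \<and> {p, q} \<in> U \<and> h \<le> p \<and> q \<le> j} \<subseteq> {..j} \<times> {..j}"
    using S.lower_edgeD(6) by force
qed simp

lemma exact_iff:
  assumes ac: "S.arc a c" "a + 1 < c"
  shows "(\<exists>!e. e \<in> U \<and> e \<in> poly_edges (S.below a c)) \<longleftrightarrow> used U a c a c + of_bool ({a, c} \<in> U) = 1"
proof -
  let ?Q = "{(p, q). S.lower_edge a c p q \<and> {p, q} \<in> U \<and> a \<le> p \<and> q \<le> c}"
  let ?E = "{e. e \<in> U \<and> e \<in> poly_edges (S.below a c)}"
  let ?f = "\<lambda>(p, q). {p, q :: nat}"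
  have lt: "p < q" if "(p, q) \<in> ?Q" for p q using that S.lower_edgeD(6) by blast
  have E: "?E = ?f ` ?Q \<union> (if {a, c} \<in> U then {{a, c}} else {})"
  proof
    show "?E \<subseteq> ?f ` ?Q \<union> (if {a, c} \<in> U then {{a, c}} else {})"
    proof
      fix e assume e: "e \<in> ?E"
      then obtain p q where pq: "e = {p, q}" "p < q" using poly_edgesE by blast
      then have "(p, q) = (a, c) \<or> S.lower_edge a c p q" using e S.poly_edges_below[OF ac pq(2)] by simp
      then show "e \<in> ?f ` ?Q \<union> (if {a, c} \<in> U then {{a, c}} else {})"
      proof
        assume "(p, q) = (a, c)" then show ?thesis using pq e by auto
      next
        assume l: "S.lower_edge a c p q"
        then have "(p, q) \<in> ?Q" using S.lower_edgeD[OF l] pq e by auto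
        then show ?thesis using pq by force
      qed
    qed
    show "?f ` ?Q \<union> (if {a, c} \<in> U then {{a, c}} else {}) \<subseteq> ?E"
      using S.lower_edge_poly_edge S.below_edge_top[OF ac] by auto
  qed
  have "inj_on ?f ?Q"
  proof (rule inj_onI)
    fix x y assume xy: "x \<in> ?Q" "y \<in> ?Q" "?f x = ?f y"
    obtain p q p' q' where "x = (p, q)" "y = (p', q')" by fastforce
    then show "x = y" using xy lt[of p q] lt[of p' q'] doubleton_eq_less[of p q p' q'] by auto
  qed
  then have c1: "card (?f ` ?Q) = used U a c a c" unfolding used_def by (rule card_image)
  have "{a, c} \<notin> ?f ` ?Q"
  proof
    assume "{a, c} \<in> ?f ` ?Q"
    then obtain p q where "{a, c} = {p, q}" "S.lower_edge a c p q" by auto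
    then show False using S.lower_edgeD(6,7)[of a c p q] doubleton_eq_less[of a c p q] ac by auto
  qed
  moreover have "finite (?f ` ?Q)" using finite_used by blast
  ultimately have cE: "card ?E = used U a c a c + of_bool ({a, c} \<in> U)"
    unfolding E c1[symmetric] by (auto simp: card_insert_if)
  have "(\<exists>!e. e \<in> U \<and> e \<in> poly_edges (S.below a c)) \<longleftrightarrow> card ?E = 1"
  proof
    assume "\<exists>!e. e \<in> U \<and> e \<in> poly_edges (S.below a c)"
    then obtain e where "?E = {e}" by blast
    then show "card ?E = 1" by simp
  next
    assume "card ?E = 1"
    then obtain e where "?E = {e}" by (rule card_1_singletonE)
    then show "\<exists>!e. e \<in> U \<and> e \<in> poly_edges (S.below a c)" by blast
  qed
  then show ?thesis unfolding cE .
qed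

text \<open>The excess of \<open>I\<close> over the area, as an integer since \<open>I\<close> is arbitrary here.\<close>

definition over :: "nat set \<Rightarrow> nat \<Rightarrow> nat \<Rightarrow> int" where
  "over I h j = int (card (I \<inter> {h..<j})) - int (count_in B h j)"

lemma over_tri:
  assumes "tri h b j"
  shows "over I h j = over I h b + over I b j - of_bool ({h, b, j} \<in> B)"
proof -
  have "I \<inter> {h..<j} = (I \<inter> {h..<b}) \<union> (I \<inter> {b..<j})" using triD[OF assms] by auto
  then have "card (I \<inter> {h..<j}) = card (I \<inter> {h..<b}) + card (I \<inter> {b..<j})"
    by (simp add: card_Un_disjoint disjoint_iff)
  then show ?thesis unfolding over_def count_in_tri[OF B_faces assms] by simp
qed

lemma over_side: "over I i (i + 1) = of_bool (i \<in> I)"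
proof -
  have "I \<inter> {i..<i + 1} = (if i \<in> I then {i} else {})" by auto
  then show ?thesis unfolding over_def count_in_Suc[OF B_faces] by simp
qed

text \<open>Both sides obey the same recursion along the triangles of the face: the excess is additive up to
  the colour, and a used lower edge lies under one of the two arcs at the apex.\<close>

lemma over_in_face:
  assumes ac: "S.arc a c" "a + 1 < c"
    and low: "\<And>p q. S.lower_edge a c p q \<Longrightarrow>
      over I p q = (if black (S.below a c) then 1 - of_bool ({p, q} \<in> U) else of_bool ({p, q} \<in> U))"
    and hj: "arc h j" "h \<in> S.below a c" "j \<in> S.below a c"
  shows "over I h j = (if black (S.below a c) then 1 - int (used U a c h j) else int (used U a c h j))"
  using hj
proof (induction "j - h" arbitrary: h j rule: less_induct)
  case less
  let ?P = "S.below a c"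
  note lt = arc_less[OF less.prems(1)]
  have Pf: "?P \<in> faces n D0" by (rule S.below_face[OF ac])
  show ?case
  proof (cases "?P \<inter> {h<..<j} = {}")
    case True
    have "(h, j) \<noteq> (a, c)" using True S.below_interior[OF ac] by (metis IntI Pair_inject empty_iff greaterThanLessThan_iff)
    then have l: "S.lower_edge a c h j" unfolding S.lower_edge_def using ac lt less.prems True by blast
    have "{(p, q). S.lower_edge a c p q \<and> {p, q} \<in> U \<and> h \<le> p \<and> q \<le> j} = (if {h, j} \<in> U then {(h, j)} else {})"
    proof -
      have "p = h \<and> q = j" if "S.lower_edge a c p q" "h \<le> p" "q \<le> j" for p q
      proof -
        have d: "p < q" "p \<in> ?P" "q \<in> ?P" using S.lower_edgeD[OF that(1)] by auto
        have "\<not> (h < p \<and> p < j)" "\<not> (h < q \<and> q < j)" using True d by auto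
        then show ?thesis using d that by linarith
      qed
      then show ?thesis using l by auto
    qed
    then have "used U a c h j = of_bool ({h, j} \<in> U)" unfolding used_def by simp
    then show ?thesis using low[OF l] by simp
  next
    case False
    then have "h + 1 < j" by auto
    then obtain b where t: "tri h b j" using triE less.prems by blast
    note d = triD[OF t]
    have bP: "b \<in> ?P" using apex_in_face[OF Pf t less.prems(2,3) False] by blast
    have col: "{h, b, j} \<in> B \<longleftrightarrow> black ?P" by (rule color_tri[OF Pf t less.prems(2,3) False])
    let ?Q = "\<lambda>h j. {(p, q). S.lower_edge a c p q \<and> {p, q} \<in> U \<and> h \<le> p \<and> q \<le> j}"
    have split: "q \<le> b \<or> b \<le> p" if "S.lower_edge a c p q" for p q
    proof (rule ccontr)
      assume "\<not> (q \<le> b \<or> b \<le> p)"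
      then have "b \<in> ?P \<inter> {p<..<q}" using bP by auto
      then show False using that unfolding S.lower_edge_def by blast
    qed
    have "?Q h j = ?Q h b \<union> ?Q b j" using split d by force
    moreover have "?Q h b \<inter> ?Q b j = {}" using S.lower_edgeD(6) by force
    ultimately have "used U a c h j = used U a c h b + used U a c b j"
      unfolding used_def using finite_used by (simp add: card_Un_disjoint)
    moreover have "over I h b = (if black ?P then 1 - int (used U a c h b) else int (used U a c h b))"
      using d less.prems bP by (intro less.hyps) auto
    moreover have "over I b j = (if black ?P then 1 - int (used U a c b j) else int (used U a c b j))"
      using d less.prems bP by (intro less.hyps) auto
    ultimately show ?thesis unfolding over_tri[OF t] col by simp
  qed
qed

lemma card_over_root:
  assumes "I \<subseteq> {0..<n}"
  shows "int (card I) = int (card B) + over I 0 (n - 1) + of_bool (n - 1 \<in> I)"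
proof -
  have N: "{0..<n} = insert (n - 1) {0..<n - 1}" using n3 by auto
  have "card I = card (I \<inter> {0..<n - 1}) + of_bool (n - 1 \<in> I)"
  proof (cases "n - 1 \<in> I")
    case True
    then have "I = insert (n - 1) (I \<inter> {0..<n - 1})" using assms unfolding N by blast
    moreover have "card (insert (n - 1) (I \<inter> {0..<n - 1})) = card (I \<inter> {0..<n - 1}) + 1" by simp
    ultimately show ?thesis using True by simp
  next
    case False
    then have "I = I \<inter> {0..<n - 1}" using assms unfolding N by blast
    then show ?thesis using False by simp
  qed
  then show ?thesis unfolding over_def count_in_root[OF B_faces] by simp
qed

lemma full_states_over:
  "I \<in> full_states B \<longleftrightarrow> I \<subseteq> {0..<n} \<and> over I 0 (n - 1) + of_bool (n - 1 \<in> I) = 1 \<and>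
     (\<forall>h j. arc h j \<longrightarrow> over I h j \<in> {0, 1})"
proof -
  have "over I h j \<in> {0, 1} \<longleftrightarrow> count_in B h j \<le> card (I \<inter> {h..<j}) \<and> card (I \<inter> {h..<j}) \<le> count_in B h j + 1" for h j
    unfolding over_def by auto
  moreover have "card I = card B + 1 \<longleftrightarrow> over I 0 (n - 1) + of_bool (n - 1 \<in> I) = 1" if "I \<subseteq> {0..<n}"
    using card_over_root[OF that] by linarith
  ultimately show ?thesis unfolding full_states_def[OF B_faces] by auto
qed

text \<open>By induction on the length of the arcs of the subdivision, the selected edges determine the excess:
  a face below an arc uses exactly one edge, either the arc itself or one of its lower edges, and the
  opposite colours of the faces on both sides of an edge make their readings of it agree.\<close>

lemma edges_give_states:
  assumes U: "S.exact U" and I: "boundary_rel I U"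
  shows "I \<in> full_states B"
proof -
  have rel: "i \<in> I \<longleftrightarrow> (S.side i \<in> U) \<noteq> black P" if "S.at_side i P" for i P
    using I that unfolding boundary_rel_def by blast
  have one: "used U a c a c + of_bool ({a, c} \<in> U) = 1" if "S.arc a c" "a + 1 < c" for a c
    using exact_iff[OF that, of U] S.exactD[OF U S.below_face[OF that]] by (rule iffD1)
  have low: "over I p q = (if black (S.below a c) then 1 - of_bool ({p, q} \<in> U) else of_bool ({p, q} \<in> U))"
    if l: "S.lower_edge a c p q"
      and rec: "p + 1 < q \<Longrightarrow> over I p q = (if black (S.below p q) then of_bool ({p, q} \<in> U) else 1 - of_bool ({p, q} \<in> U))"
    for a c p q
  proof (cases "p + 1 < q")
    case True
    then show ?thesis using rec opposite_colors[OF l True] by simp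
  next
    case False
    then have q: "q = p + 1" using S.lower_edgeD(6)[OF l] by simp
    then have pn: "p + 1 < n" using S.lower_edgeD(3)[OF l] S.arc_bound by blast
    have "S.at_side p (S.below a c)" using S.at_side_inner[OF pn] l q by blast
    then have "p \<in> I \<longleftrightarrow> ({p, q} \<in> U) \<noteq> black (S.below a c)" using rel S.side_simps(1)[OF pn] q by simp
    then show ?thesis unfolding q over_side by auto
  qed
  have top: "over I a c = (if black (S.below a c) then of_bool ({a, c} \<in> U) else 1 - of_bool ({a, c} \<in> U))"
    if "S.arc a c" "a + 1 < c" for a c
    using that
  proof (induction "c - a" arbitrary: a c rule: less_induct)
    case less
    have "over I p q = (if black (S.below a c) then 1 - of_bool ({p, q} \<in> U) else of_bool ({p, q} \<in> U))"
      if l: "S.lower_edge a c p q" for p q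
    proof (rule low[OF l])
      assume "p + 1 < q"
      moreover have "q - p < c - a" using S.lower_edgeD[OF l] by auto
      ultimately show "over I p q = (if black (S.below p q) then of_bool ({p, q} \<in> U) else 1 - of_bool ({p, q} \<in> U))"
        using less.hyps S.lower_edgeD(3)[OF l] by blast
    qed
    then have "over I a c = (if black (S.below a c) then 1 - int (used U a c a c) else int (used U a c a c))"
      using S.below_ends[of a c] less.prems S_arc by (intro over_in_face) auto
    moreover have "int (used U a c a c) = 1 - of_bool ({a, c} \<in> U)" using one[OF less.prems] by (simp add: of_bool_def split: if_splits)
    ultimately show ?case by simp
  qed
  have "over I h j \<in> {0, 1}" if hj: "arc h j" for h j
  proof (cases "h + 1 < j")
    case False
    then have "j = h + 1" using arc_less[OF hj] by simp
    then show ?thesis using over_side by simp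
  next
    case True
    obtain b where t: "tri h b j" using triE[OF hj True] .
    obtain P where P: "P \<in> faces n D0" "{h, b, j} \<subseteq> P" by (rule parent_face[OF tri_face[OF t]])
    obtain a c where ac: "S.arc a c" "a + 1 < c" "P = S.below a c" by (rule S.faceE[OF P(1)])
    have "over I h j = (if black (S.below a c) then 1 - int (used U a c h j) else int (used U a c h j))"
    proof (rule over_in_face[OF ac(1,2) _ hj])
      show "over I p q = (if black (S.below a c) then 1 - of_bool ({p, q} \<in> U) else of_bool ({p, q} \<in> U))"
        if l: "S.lower_edge a c p q" for p q
        using low[OF l] top S.lower_edgeD(3)[OF l] by blast
    qed (use P ac in auto)
    moreover have "used U a c h j \<le> used U a c a c" unfolding used_def
      using P ac S.lower_edgeD by (intro card_mono finite_used) auto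
    then have "used U a c h j \<le> 1" using one[OF ac(1,2)] by linarith
    ultimately show ?thesis by auto
  qed
  moreover have "over I 0 (n - 1) + of_bool (n - 1 \<in> I) = 1"
  proof -
    have "n - 1 \<in> I \<longleftrightarrow> ({0, n - 1} \<in> U) \<noteq> black (S.below 0 (n - 1))"
      using rel[of "n - 1"] S.at_side_last S.side_simps(2) by metis
    moreover have "0 + 1 < n - 1" using n3 by simp
    ultimately show ?thesis using top[OF S.arc_root] by simp
  qed
  moreover have "I \<subseteq> {0..<n}" using I unfolding boundary_rel_def by blast
  ultimately show ?thesis unfolding full_states_over by blast
qed

text \<open>Select an edge by reading off, from the excess over it, whether the face below it has to use it. The
  excess of the top edge of a face being \<open>0\<close> or \<open>1\<close> then says that exactly one edge is selected.\<close>

lemma states_give_edges: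
  assumes I: "I \<in> full_states B"
  obtains U where "S.exact U" "boundary_rel I U"
proof -
  have sub: "I \<subseteq> {0..<n}" and root: "over I 0 (n - 1) + of_bool (n - 1 \<in> I) = 1"
    and o01: "\<And>h j. arc h j \<Longrightarrow> over I h j = 0 \<or> over I h j = 1"
    using I unfolding full_states_over by auto
  define U where "U = {e. \<exists>h j. e = {h, j} \<and> h < j \<and>
     (if j = h + 1 then \<exists>P. S.at_side h P \<and> (h \<in> I) \<noteq> black P else (over I h j = 0) \<noteq> black (S.below h j))}"
  have mU: "{h, j} \<in> U \<longleftrightarrow> (if j = h + 1 then \<exists>P. S.at_side h P \<and> (h \<in> I) \<noteq> black P
      else (over I h j = 0) \<noteq> black (S.below h j))" if "h < j" for h j
    unfolding U_def using that by (auto simp: doubleton_eq_less)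
  have low: "over I p q = (if black (S.below a c) then 1 - of_bool ({p, q} \<in> U) else of_bool ({p, q} \<in> U))"
    if l: "S.lower_edge a c p q" for a c p q
  proof (cases "p + 1 < q")
    case True
    have "over I p q = 0 \<or> over I p q = 1" using o01 S_arc S.lower_edgeD(3)[OF l] by blast
    then show ?thesis using mU[of p q] True opposite_colors[OF l True] by auto
  next
    case False
    then have q: "q = p + 1" using S.lower_edgeD(6)[OF l] by simp
    then have pn: "p + 1 < n" using S.lower_edgeD(3)[OF l] S.arc_bound by blast
    have "S.at_side p (S.below a c)" using S.at_side_inner[OF pn] l q by blast
    then have "{p, q} \<in> U \<longleftrightarrow> (p \<in> I) \<noteq> black (S.below a c)" using mU[of p q] q S.at_side_unique by auto
    then show ?thesis unfolding q over_side by auto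
  qed
  have "S.exact U" unfolding S.exact_def
  proof
    fix P assume "P \<in> faces n D0"
    then obtain a c where ac: "S.arc a c" "a + 1 < c" "P = S.below a c" by (rule S.faceE)
    have e: "over I a c = (if black (S.below a c) then 1 - int (used U a c a c) else int (used U a c a c))"
      using S.below_ends[of a c] ac S_arc low by (intro over_in_face) auto
    have "{a, c} \<in> U \<longleftrightarrow> (over I a c = 0) \<noteq> black (S.below a c)" using mU[of a c] ac by auto
    then have "used U a c a c + of_bool ({a, c} \<in> U) = 1"
      using e o01[OF S_arc[OF ac(1)]] by (auto split: if_splits)
    then show "\<exists>!e. e \<in> U \<and> e \<in> poly_edges P" unfolding ac(3) exact_iff[OF ac(1,2)] .
  qed
  moreover have "boundary_rel I U" unfolding boundary_rel_def
  proof (intro conjI allI impI sub)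
    fix i P assume iP: "S.at_side i P"
    then have "i < n" unfolding S.at_side_def by blast
    then show "(i \<in> I) = ((S.side i \<in> U) \<noteq> black P)"
    proof (cases rule: S.side_cases)
      case 1
      then show ?thesis using mU[of i "i + 1"] iP S.at_side_unique by auto
    next
      case 2
      then have P: "P = S.below 0 (n - 1)" using iP S.at_side_last by simp
      have "S.side i \<in> U \<longleftrightarrow> (over I 0 (n - 1) = 0) \<noteq> black P" using mU[of 0 "n - 1"] 2 P n3 by auto
      moreover have "i \<in> I \<longleftrightarrow> over I 0 (n - 1) = 0" using root 2 by auto
      ultimately show ?thesis by blast
    qed
  qed
  ultimately show ?thesis using that by blast
qed

theorem matching_positroid_eq: "matching_positroid n SS = full_states B"
proof
  show "matching_positroid n SS \<subseteq> full_states B"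
  proof
    fix I assume "I \<in> matching_positroid n SS"
    then obtain M where M: "I = matching_boundary n M" "almost_perfect_matching n SS M"
      unfolding matching_positroid_def by blast
    obtain U where "S.exact U" "boundary_rel (matching_boundary n M) U"
      by (rule matching_gives_edges[OF M(2)])
    then show "I \<in> full_states B" unfolding M(1) by (rule edges_give_states)
  qed
  show "full_states B \<subseteq> matching_positroid n SS"
  proof
    fix I assume "I \<in> full_states B"
    then obtain U where "S.exact U" "boundary_rel I U" by (rule states_give_edges)
    then show "I \<in> matching_positroid n SS" by (rule edges_give_matching)
  qed
qed

end

section \<open>The moment map image\<close>

lemma sum_over_interval:
  fixes w :: "nat set \<Rightarrow> real"
  assumes "finite M"
  shows "(\<Sum>i\<in>{h..<j}. (\<Sum>I\<in>M. w I * of_bool (i \<in> I)) / W) = (\<Sum>I\<in>M. w I * real (card (I \<inter> {h..<j}))) / W"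
proof -
  have c: "(\<Sum>i\<in>{h..<j}. of_bool (i \<in> I)) = real (card (I \<inter> {h..<j}))" for I
  proof -
    have "I \<inter> {h..<j} = {i \<in> {h..<j}. i \<in> I}" by blast
    then show ?thesis by (simp add: of_bool_def sum.If_cases Int_def)
  qed
  have "(\<Sum>i\<in>{h..<j}. \<Sum>I\<in>M. w I * of_bool (i \<in> I)) = (\<Sum>I\<in>M. \<Sum>i\<in>{h..<j}. w I * of_bool (i \<in> I))"
    by (rule sum.swap)
  also have "\<dots> = (\<Sum>I\<in>M. w I * real (card (I \<inter> {h..<j})))" by (simp add: sum_distrib_left[symmetric] c)
  finally show ?thesis by (simp add: sum_divide_distrib[symmetric])
qed

lemma mean_strict:
  fixes w :: "'a \<Rightarrow> real" and v :: "'a \<Rightarrow> nat"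
  assumes M: "finite M" "\<And>I. I \<in> M \<Longrightarrow> w I > 0" "\<And>I. I \<in> M \<Longrightarrow> a \<le> v I \<and> v I \<le> a + 1"
    and I: "I0 \<in> M" "v I0 = a" "I1 \<in> M" "v I1 = a + 1"
  shows "real a < (\<Sum>I\<in>M. w I * real (v I)) / sum w M \<and> (\<Sum>I\<in>M. w I * real (v I)) / sum w M < real a + 1"
proof -
  have W: "sum w M > 0" using M I by (intro sum_pos) auto
  have "(\<Sum>I\<in>M. w I * real a) < (\<Sum>I\<in>M. w I * real (v I))"
    using M I by (intro sum_strict_mono_ex1) (auto intro!: mult_left_mono bexI[of _ I1] simp: less_imp_le)
  moreover have "(\<Sum>I\<in>M. w I * real (v I)) < (\<Sum>I\<in>M. w I * (real a + 1))"
    using M I by (intro sum_strict_mono_ex1) (fastforce intro!: mult_left_mono bexI[of _ I0] simp: less_imp_le)+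
  moreover have "(\<Sum>I\<in>M. w I * real a) = real a * sum w M" "(\<Sum>I\<in>M. w I * (real a + 1)) = (real a + 1) * sum w M"
    unfolding sum_distrib_left by (simp_all only: mult.commute)
  ultimately show ?thesis using W by (simp add: pos_less_divide_eq pos_divide_less_eq)
qed

lemma mean_attains:
  fixes w :: "'a \<Rightarrow> real" and v :: "'a \<Rightarrow> nat"
  assumes M: "finite M" "\<And>I. I \<in> M \<Longrightarrow> w I > 0" "\<And>I. I \<in> M \<Longrightarrow> a \<le> v I \<and> v I \<le> a + 1"
    and ne: "sum w M > 0"
    and mean: "real a < (\<Sum>I\<in>M. w I * real (v I)) / sum w M" "(\<Sum>I\<in>M. w I * real (v I)) / sum w M < real a + 1"
  obtains I0 I1 where "I0 \<in> M" "v I0 = a" "I1 \<in> M" "v I1 = a + 1"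
proof -
  have "\<exists>I0\<in>M. v I0 = a"
  proof (rule ccontr)
    assume "\<not> ?thesis"
    then have e: "v I = a + 1" if "I \<in> M" for I using M(3)[OF that] that by (metis le_antisym Suc_eq_plus1 le_SucE)
    have "(\<Sum>I\<in>M. w I * real (v I)) = sum w M * (real a + 1)"
      unfolding sum_distrib_right by (intro sum.cong) (simp_all add: e)
    then show False using mean(2) ne by simp
  qed
  moreover have "\<exists>I1\<in>M. v I1 = a + 1"
  proof (rule ccontr)
    assume "\<not> ?thesis"
    then have e: "v I = a" if "I \<in> M" for I using M(3)[OF that] that by (metis le_antisym Suc_eq_plus1 le_SucE)
    have "(\<Sum>I\<in>M. w I * real (v I)) = sum w M * real a"
      unfolding sum_distrib_right by (intro sum.cong) (simp_all add: e)
    then show False using mean(1) ne by simp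
  qed
  ultimately show ?thesis using that by blast
qed

context triangulated
begin

context
  fixes B :: "nat set set" and k :: nat
  assumes B: "B \<subseteq> faces n D" and k: "card B = k"
begin

lemma full_states_range:
  assumes "I \<in> full_states B" "arc h j"
  shows "count_in B h j \<le> card (I \<inter> {h..<j}) \<and> card (I \<inter> {h..<j}) \<le> count_in B h j + 1"
  using assms unfolding full_states_def[OF B] by blast

lemma full_states_ksubsets: "full_states B \<subseteq> ksubsets (k + 1) n"
  unfolding full_states_def[OF B] ksubsets_def k by blast

text \<open>There is a point with all excesses strictly between \<open>0\<close> and \<open>1\<close>, and it is a mean of states; so
  neither value can be missing.\<close>

lemma full_states_both_values:
  assumes hj: "arc h j"
  obtains I0 I1 where "I0 \<in> full_states B" "card (I0 \<inter> {h..<j}) = count_in B h j"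
    "I1 \<in> full_states B" "card (I1 \<inter> {h..<j}) = count_in B h j + 1"
proof -
  obtain x where x: "interior_point B x 0 (n - 1)" "(\<Sum>i=0..<n. x i) = real (card B) + 1"
    by (rule full_interior_point_exists[OF B])
  obtain \<tau> where \<tau>: "\<And>i. \<tau> i > 0" "(\<Sum>I\<in>full_states B. \<Prod>i\<in>I. \<tau> i) > 0"
    "\<And>i. i < n \<Longrightarrow> (\<Sum>I\<in>full_states B. (\<Prod>i\<in>I. \<tau> i) * of_bool (i \<in> I)) / (\<Sum>I\<in>full_states B. \<Prod>i\<in>I. \<tau> i) = x i"
    using realize_full[OF B x] by metis
  let ?w = "\<lambda>I. \<Prod>i\<in>I. \<tau> i"
  have jn: "j < n" using arc_bound[OF hj] .
  have "(\<Sum>i=h..<j. x i) = (\<Sum>i\<in>{h..<j}. (\<Sum>I\<in>full_states B. ?w I * of_bool (i \<in> I)) / sum ?w (full_states B))"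
    using \<tau>(3) jn by (intro sum.cong) auto
  also have "\<dots> = (\<Sum>I\<in>full_states B. ?w I * real (card (I \<inter> {h..<j}))) / sum ?w (full_states B)"
    by (rule sum_over_interval[OF finite_full_states[OF B]])
  finally have m: "(\<Sum>i=h..<j. x i) = (\<Sum>I\<in>full_states B. ?w I * real (card (I \<inter> {h..<j}))) / sum ?w (full_states B)" .
  have e: "0 < excess B x h j \<and> excess B x h j < 1"
    using x(1) hj jn unfolding interior_point_def[OF B] by auto
  have lo: "real (count_in B h j) < (\<Sum>I\<in>full_states B. ?w I * real (card (I \<inter> {h..<j}))) / sum ?w (full_states B)"
    and hi: "(\<Sum>I\<in>full_states B. ?w I * real (card (I \<inter> {h..<j}))) / sum ?w (full_states B) < real (count_in B h j) + 1"
    unfolding m[symmetric] using e unfolding excess_def[OF B] by linarith+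
  show ?thesis
    by (rule mean_attains[OF finite_full_states[OF B] _ full_states_range[OF _ hj] \<tau>(2) lo hi])
      (use \<tau>(1) that in \<open>auto intro: prod_pos\<close>)
qed

text \<open>The point \<open>x\<close> is the mean of the \<open>e\<^sub>I\<close> over all states \<open>I\<close>, with positive weights; the inequalities
  are strict because both admissible values of \<open>card (I \<inter> {h..<j})\<close> occur.\<close>

lemma moment_image_inequalities:
  assumes V: "V \<in> positroid_cell (k + 1) n (full_states B)"
  defines "x \<equiv> moment_map (k + 1) n V"
  shows "coord_sum x {0..<n} = real (k + 1)"
    and "arc h j \<Longrightarrow> real (count_in B h j) < coord_sum x {h..<j} \<and> coord_sum x {h..<j} < real (count_in B h j) + 1"
proof -
  obtain A where A: "represents (k + 1) n A V"
    and p: "\<And>I. I \<in> ksubsets (k + 1) n \<Longrightarrow> if I \<in> full_states B then plucker A I > 0 else plucker A I = 0"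
    using V unfolding positroid_cell_def by blast
  let ?M = "full_states B" and ?w = "\<lambda>I. (plucker A I)\<^sup>2"
  have pos: "?w I > 0" if "I \<in> ?M" for I using p[of I] full_states_ksubsets that by force
  obtain I0 I1 where I0: "I0 \<in> ?M" using full_states_both_values[OF arc_root] by metis
  then have "I0 \<in> ksubsets (k + 1) n" "plucker A I0 \<noteq> 0" using full_states_ksubsets pos by force+
  from moment_map_eq[OF A this] have xe: "x = vec n (\<lambda>i. (\<Sum>I\<in>ksubsets (k + 1) n. ?w I * of_bool (i \<in> I)) /
      (\<Sum>I\<in>ksubsets (k + 1) n. ?w I))" unfolding x_def .
  have res: "(\<Sum>I\<in>ksubsets (k + 1) n. ?w I * f I) = (\<Sum>I\<in>?M. ?w I * f I)" for f
    using p full_states_ksubsets finite_ksubsets by (intro sum.mono_neutral_right) auto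
  have W: "(\<Sum>I\<in>ksubsets (k + 1) n. ?w I) = sum ?w ?M" using res[of "\<lambda>_. 1"] by simp
  have cs: "coord_sum x {h..<j} = (\<Sum>I\<in>?M. ?w I * real (card (I \<inter> {h..<j}))) / sum ?w ?M" if "j \<le> n" for h j
  proof -
    have "coord_sum x {h..<j} = (\<Sum>i\<in>{h..<j}. (\<Sum>I\<in>?M. ?w I * of_bool (i \<in> I)) / sum ?w ?M)"
      unfolding coord_sum_def xe res W using that by (intro sum.cong) auto
    also have "\<dots> = (\<Sum>I\<in>?M. ?w I * real (card (I \<inter> {h..<j}))) / sum ?w ?M"
      by (rule sum_over_interval[OF finite_full_states[OF B]])
    finally show ?thesis .
  qed
  have Wp: "sum ?w ?M > 0" using finite_full_states[OF B] I0 pos by (intro sum_pos) auto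
  have "card (I \<inter> {0..<n}) = k + 1" if "I \<in> ?M" for I
  proof -
    have "I \<subseteq> {0..<n}" "card I = k + 1" using that full_states_ksubsets unfolding ksubsets_def by auto
    then show ?thesis by (simp add: Int_absorb2)
  qed
  then have "(\<Sum>I\<in>?M. ?w I * real (card (I \<inter> {0..<n}))) = sum ?w ?M * real (k + 1)"
    unfolding sum_distrib_right by (intro sum.cong) auto
  then show "coord_sum x {0..<n} = real (k + 1)" using cs[of n 0] Wp by simp
  show "real (count_in B h j) < coord_sum x {h..<j} \<and> coord_sum x {h..<j} < real (count_in B h j) + 1" if hj: "arc h j"
  proof -
    obtain I0 I1 where I: "I0 \<in> ?M" "card (I0 \<inter> {h..<j}) = count_in B h j"
      "I1 \<in> ?M" "card (I1 \<inter> {h..<j}) = count_in B h j + 1" by (rule full_states_both_values[OF hj])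
    have "j \<le> n" using arc_bound[OF hj] by simp
    then show ?thesis unfolding cs[OF \<open>j \<le> n\<close>]
      using mean_strict[where w = ?w and v = "\<lambda>I. card (I \<inter> {h..<j})", OF finite_full_states[OF B] pos full_states_range[OF _ hj] I] by blast
  qed
qed

text \<open>Scale the columns of the matrix with \<open>0/1\<close> minors by the square roots of weights with marginals \<open>x\<close>;
  the moment map squares them.\<close>

lemma moment_image_surjective:
  assumes x: "x \<in> carrier_vec n" "coord_sum x {0..<n} = real (k + 1)"
    and ineq: "\<And>h j. arc h j \<Longrightarrow> real (count_in B h j) < coord_sum x {h..<j} \<and> coord_sum x {h..<j} < real (count_in B h j) + 1"
  shows "x \<in> moment_map (k + 1) n ` positroid_cell (k + 1) n (full_states B)"
proof -
  let ?M = "full_states B"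
  have int: "interior_point B (\<lambda>i. x $ i) 0 (n - 1)"
    unfolding interior_point_def[OF B] excess_def[OF B] using ineq unfolding coord_sum_def by fastforce
  have s: "(\<Sum>i=0..<n. x $ i) = real (card B) + 1" using x(2) k unfolding coord_sum_def by simp
  obtain \<tau> where \<tau>: "\<And>i. \<tau> i > 0" "(\<Sum>I\<in>?M. \<Prod>i\<in>I. \<tau> i) > 0"
    "\<And>i. i < n \<Longrightarrow> (\<Sum>I\<in>?M. (\<Prod>i\<in>I. \<tau> i) * of_bool (i \<in> I)) / (\<Sum>I\<in>?M. \<Prod>i\<in>I. \<tau> i) = x $ i"
    using realize_full[OF B int s] by metis
  obtain R where R: "length R = card B + 1" "\<And>w i. w \<in> set R \<Longrightarrow> i \<ge> n \<Longrightarrow> w i = 0"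
    "\<And>I. I \<subseteq> {0..<n} \<Longrightarrow> minor R I = of_bool (I \<in> ?M)" using full_states_matrix[OF B] by metis
  define A where "A = mat (k + 1) n (\<lambda>(r, i). (R ! r) i * sqrt (\<tau> i))"
  have A: "A \<in> carrier_mat (k + 1) n" unfolding A_def by simp
  have rows: "row_fns A = map (\<lambda>w i. w i * sqrt (\<tau> i)) R"
  proof (rule nth_equalityI)
    fix r assume "r < length (row_fns A)"
    then have r: "r < k + 1" "r < length R" using A R k by (auto simp: length_row_fns)
    then show "row_fns A ! r = map (\<lambda>w i. w i * sqrt (\<tau> i)) R ! r"
      using R(2)[of "R ! r"] unfolding row_fns_def A_def by (auto simp: fun_eq_iff not_less simp del: upt_Suc)
  qed (use A R k in \<open>simp add: length_row_fns\<close>)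
  have pl: "plucker A I = (\<Prod>i\<in>I. sqrt (\<tau> i)) * of_bool (I \<in> ?M)" if "I \<in> ksubsets (k + 1) n" for I
    unfolding plucker_eq_minor[OF A that] rows
    using minor_scale_columns[OF ksubsets_finite[OF that]] R(3)[of I] that by (simp add: ksubsets_def)
  have sp: "(\<Prod>i\<in>I. sqrt (\<tau> i)) > 0" for I using \<tau>(1) by (intro prod_pos) simp
  obtain I0 where I0: "I0 \<in> ?M" using full_states_both_values[OF arc_root] by metis
  then have I0': "I0 \<in> ksubsets (k + 1) n" "plucker A I0 \<noteq> 0" using full_states_ksubsets pl[of I0] sp[of I0] by auto
  define V where "V = vec_space.row_space n A"
  have rep: "represents (k + 1) n A V" unfolding represents_def V_def using A rank_from_plucker[OF A I0'] by simp
  have cell: "\<forall>I\<in>ksubsets (k + 1) n. if I \<in> ?M then plucker A I > 0 else plucker A I = 0"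
    using pl sp by simp
  then have "V \<in> Gr_nonneg (k + 1) n"
    unfolding Gr_nonneg_def using rep by (auto intro!: exI[of _ A] split: if_splits)
  then have "V \<in> positroid_cell (k + 1) n ?M" unfolding positroid_cell_def using rep cell by blast
  moreover have "moment_map (k + 1) n V = x"
  proof (rule eq_vecI)
    fix i assume "i < dim_vec x"
    then have i: "i < n" using x by simp
    have sq: "(plucker A I)\<^sup>2 = (\<Prod>i\<in>I. \<tau> i) * of_bool (I \<in> ?M)" if "I \<in> ksubsets (k + 1) n" for I
      unfolding pl[OF that] using \<tau>(1) by (simp add: power_mult_distrib prod_power_distrib less_imp_le)
    have res: "(\<Sum>I\<in>ksubsets (k + 1) n. (plucker A I)\<^sup>2 * f I) = (\<Sum>I\<in>?M. (\<Prod>i\<in>I. \<tau> i) * f I)" for f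
    proof -
      have "(\<Sum>I\<in>ksubsets (k + 1) n. (plucker A I)\<^sup>2 * f I) = (\<Sum>I\<in>?M. (plucker A I)\<^sup>2 * f I)"
        using sq full_states_ksubsets finite_ksubsets by (intro sum.mono_neutral_right) auto
      also have "\<dots> = (\<Sum>I\<in>?M. (\<Prod>i\<in>I. \<tau> i) * f I)"
        using sq full_states_ksubsets by (intro sum.cong) auto
      finally show ?thesis .
    qed
    have W: "(\<Sum>I\<in>ksubsets (k + 1) n. (plucker A I)\<^sup>2) = (\<Sum>I\<in>?M. \<Prod>i\<in>I. \<tau> i)" using res[of "\<lambda>_. 1"] by simp
    show "moment_map (k + 1) n V $ i = x $ i"
      unfolding moment_map_eq[OF rep I0'] res W using i \<tau>(3)[OF i] by simp
  qed (use x in \<open>simp add: moment_map_def Let_def\<close>)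
  ultimately show ?thesis by blast
qed

lemma moment_image_eq:
  "moment_map (k + 1) n ` positroid_cell (k + 1) n (full_states B) =
    {x \<in> carrier_vec n. coord_sum x {0..<n} = real (k + 1) \<and>
      (\<forall>h j. arc h j \<longrightarrow> real (count_in B h j) + 1 > coord_sum x {h..<j} \<and> coord_sum x {h..<j} > real (count_in B h j))}"
  (is "?L = ?R")
proof
  show "?L \<subseteq> ?R" using moment_image_inequalities moment_map_carrier by auto
  show "?R \<subseteq> ?L" using moment_image_surjective by blast
qed

end

end

section \<open>Both images and the area\<close>

lemma tdual_positroid_eq: "tdual_positroid k n T = {I \<in> ksubsets k n. transversal I (blacks T)}"
  unfolding tdual_positroid_def transversal_def ..

lemma (in triangulated) Z_image_point:
  assumes B: "B \<subseteq> faces n D" "card B = k" and Z: "Z \<in> Mat_pos n (k + 2)"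
    and V: "V \<in> positroid_cell k n {I \<in> ksubsets k n. transversal I B}"
  obtains C where "C \<in> carrier_mat k n"
    "\<And>I. I \<in> ksubsets k n \<Longrightarrow> if transversal I B then plucker C I > 0 else plucker C I = 0"
    "represents k (k + 2) (C * Z) (Z_tilde k n Z V)"
proof -
  obtain C where C: "represents k n C V"
    and p: "\<forall>I\<in>ksubsets k n. if I \<in> {I \<in> ksubsets k n. transversal I B} then plucker C I > 0 else plucker C I = 0"
    using V unfolding positroid_cell_def by blast
  have p': "if transversal I B then plucker C I > 0 else plucker C I = 0" if "I \<in> ksubsets k n" for I
    using p that by (auto split: if_splits)
  have c: "C \<in> carrier_mat k n" using C unfolding represents_def by auto
  have Zc: "Z \<in> carrier_mat n (k + 2)" using Z unfolding Mat_pos_def by auto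
  obtain I0 where I0: "I0 \<subseteq> {0..<n}" "transversal I0 B" using transversal_avoiding[OF B(1) arc_root] by metis
  then have I0k: "I0 \<in> ksubsets k n" using transversal_card B(2) unfolding ksubsets_def by auto
  then have "plucker C I0 \<noteq> 0" using p' I0(2) by force
  then have Zt: "Z_tilde k n Z V = vec_space.row_space (k + 2) (C * Z)" by (rule Z_tilde_eq[OF C I0k _ Zc])
  have "sgn (twistor Z (C * Z) 0 (n - 1)) = (-1) ^ count_in B 0 (n - 1)"
    by (rule twistor_signs[OF B c Z p' arc_root])
  then have "twistor Z (C * Z) 0 (n - 1) \<noteq> 0" by (metis power_not_zero sgn_0 zero_neq_neg_one)
  moreover have CZ: "C * Z \<in> carrier_mat k (k + 2)" using c Zc by simp
  ultimately obtain X where "X \<in> carrier_mat (k + 2) k" "C * Z * X = 1\<^sub>m k"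
    using right_inverse_from_twistor[where A = "C * Z" and i = 0 and j = "n - 1", OF _ Zc] n3 by auto
  then have "vec_space.rank k (C * Z) = k" by (rule rank_from_right_inverse[OF CZ])
  then have "represents k (k + 2) (C * Z) (Z_tilde k n Z V)" unfolding represents_def Zt using CZ by simp
  with c p' that show ?thesis by blast
qed

lemma (in triangulated) Z_image_eq:
  assumes B: "B \<subseteq> faces n D" "card B = k" and Z: "Z \<in> Mat_pos n (k + 2)"
  shows "Z_tilde k n Z ` positroid_cell k n {I \<in> ksubsets k n. transversal I B} =
    {Y \<in> Gr k (k + 2). \<exists>A. represents k (k + 2) A Y \<and> (\<forall>h j. arc h j \<longrightarrow> sgn (twistor Z A h j) = (-1) ^ count_in B h j)}"
    (is "?L = ?R")
proof
  show "?L \<subseteq> ?R"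
  proof
    fix Y assume "Y \<in> ?L"
    then obtain V where V: "V \<in> positroid_cell k n {I \<in> ksubsets k n. transversal I B}" "Y = Z_tilde k n Z V" by blast
    obtain C where C: "C \<in> carrier_mat k n"
      "\<And>I. I \<in> ksubsets k n \<Longrightarrow> if transversal I B then plucker C I > 0 else plucker C I = 0"
      "represents k (k + 2) (C * Z) Y" using Z_image_point[OF B Z V(1)] V(2) by blast
    then show "Y \<in> ?R" unfolding Gr_def using twistor_signs[OF B C(1) Z C(2)] by blast
  qed
  show "?R \<subseteq> ?L"
  proof
    fix Y assume "Y \<in> ?R"
    then obtain A where A: "represents k (k + 2) A Y"
      and sg: "\<And>h j. arc h j \<Longrightarrow> sgn (twistor Z A h j) = (-1) ^ count_in B h j" by blast
    have cA: "A \<in> carrier_mat k (k + 2)" and rA: "vec_space.row_space (k + 2) A = Y"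
      using A unfolding represents_def by auto
    obtain C where C: "C \<in> carrier_mat k n"
      "\<And>I. I \<in> ksubsets k n \<Longrightarrow> if transversal I B then plucker C I > 0 else plucker C I = 0"
      "vec_space.row_space (k + 2) (C * Z) = vec_space.row_space (k + 2) A"
      using amplituhedron_converse[OF B cA Z sg] by metis
    obtain I0 where I0: "I0 \<subseteq> {0..<n}" "transversal I0 B" using transversal_avoiding[OF B(1) arc_root] by metis
    then have I0k: "I0 \<in> ksubsets k n" using transversal_card B(2) unfolding ksubsets_def by auto
    then have nz: "plucker C I0 \<noteq> 0" using C(2) I0(2) by force
    define V where "V = vec_space.row_space n C"
    have rep: "represents k n C V" unfolding represents_def V_def using C(1) rank_from_plucker[OF C(1) I0k nz] by simp
    have "plucker C I \<ge> 0" if "I \<in> ksubsets k n" for I using C(2)[OF that] by (auto split: if_splits)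
    then have "V \<in> positroid_cell k n {I \<in> ksubsets k n. transversal I B}"
      unfolding positroid_cell_def Gr_nonneg_def using rep C(2) by (auto intro!: exI[of _ C])
    moreover have "Z \<in> carrier_mat n (k + 2)" using Z unfolding Mat_pos_def by auto
    then have "Z_tilde k n Z V = Y" using Z_tilde_eq[OF rep I0k nz] C(3) rA by simp
    ultimately show "Y \<in> ?L" by blast
  qed
qed

lemma (in colored) matching_positroid_subdivision:
  assumes "S = subdivision_of n T" "D = diags T" "D0 = diags S" "B = blacks T"
  shows "matching_positroid n S = full_states B"
proof -
  have "blacks S = {P \<in> faces n (diags S). \<exists>t\<in>blacks T. t \<subseteq> P}"
    unfolding assms(1) by (simp add: subdivision_of_def Let_def)
  then have "blacks S = {P \<in> faces n D0. black P}" using assms(3,4) unfolding black_def by simp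
  then have "S = SS" using assms(3) by simp
  then show ?thesis using matching_positroid_eq by simp
qed

text \<open>The count does not depend on the triangulation because it can be read off from the matching
  positroid, which only depends on the subdivision: it is the smaller of the two values of
  \<open>card (I \<inter> {h..<j})\<close>.\<close>

lemma area_eq_count:
  assumes T: "represented_by n S T" and n: "3 \<le> n" and hj: "h < j" "{h, j} \<in> sides n \<union> diags T"
  shows "area n S h j = count_in (blacks T) h j"
proof -
  have col: "colored n (diags T') (diags S) (blacks T') \<and> matching_positroid n S = triangulated.full_states n (diags T') (blacks T')"
    if r: "represented_by n S T'" for T'
  proof -
    have r': "bicolored_triangulation (card (blacks T')) n T'" "S = subdivision_of n T'"
      using r unfolding represented_by_def by auto
    interpret c: colored n "diags T'" "diags S" "blacks T'" by (rule colored_of_bicolored[OF r'(1) n r'(2)])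
    show ?thesis using c.matching_positroid_subdivision[OF r'(2)] c.colored_axioms by simp
  qed
  interpret c: colored n "diags T" "diags S" "blacks T" using col[OF T] by blast
  have uniq: "card {t \<in> blacks T'. t \<subseteq> cyclic_interval n h j} = count_in (blacks T) h j"
    if r: "represented_by n S T'" "{h, j} \<in> sides n \<union> diags T'" for T'
  proof -
    interpret c': colored n "diags T'" "diags S" "blacks T'" using col[OF r(1)] by blast
    have arc: "c.arc h j" "c'.arc h j" using hj r(2) unfolding c.arc_def c'.arc_def by auto
    have M: "c'.full_states (blacks T') = c.full_states (blacks T)" using col[OF T] col[OF r(1)] by simp
    obtain I0 I1 where I: "I0 \<in> c.full_states (blacks T)" "card (I0 \<inter> {h..<j}) = count_in (blacks T) h j"
      "I1 \<in> c.full_states (blacks T)" "card (I1 \<inter> {h..<j}) = count_in (blacks T) h j + 1"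
      by (rule c.full_states_both_values[OF c.B_faces refl arc(1)])
    have "count_in (blacks T') h j = count_in (blacks T) h j"
      using c'.full_states_range[OF c'.B_faces refl _ arc(2), of I0] c'.full_states_range[OF c'.B_faces refl _ arc(2), of I1]
        I unfolding M by linarith
    then show ?thesis using hj(1) unfolding count_in_def cyclic_interval_def by simp
  qed
  show ?thesis unfolding area_def
  proof (rule the_equality)
    show "\<exists>T'. represented_by n S T' \<and> {h, j} \<in> sides n \<union> diags T' \<and>
        count_in (blacks T) h j = card {t \<in> blacks T'. t \<subseteq> cyclic_interval n h j}"
      using T hj(2) uniq by metis
  qed (use uniq in auto)
qed

theorem theorem9p2:
  fixes k n :: nat and Z :: "real mat" and T S :: bicolored
  assumes "k > 0" and "n > 0" and "k + 2 \<le> n"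
    and "Z \<in> Mat_pos n (k + 2)"
    and "bicolored_triangulation k n T"
    and "S = subdivision_of n T"
  shows
    "(\<forall>h j. h < j \<and> compatible n S h j \<longrightarrow>
        (\<forall>x\<in>Gamma_open k n S.
           real (area n S h j) + 1 > coord_sum x {h..<j} \<and>
           coord_sum x {h..<j} > real (area n S h j)))
     \<and>
     (\<forall>Y\<in>Z_open k n Z T. \<exists>A. represents k (k + 2) A Y \<and>
        (\<forall>h j. h < j \<and> compatible n S h j \<longrightarrow>
           sgn (twistor Z A h j) = (-1) ^ area n S h j))
     \<and>
     (\<forall>T'. represented_by n S T' \<longrightarrow>
        Gamma_open k n S =
          {x \<in> carrier_vec n. coord_sum x {0..<n} = real (k + 1) \<and>
             (\<forall>h j. h < j \<and> {h, j} \<in> sides n \<union> diags T' \<longrightarrow>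
                real (area n S h j) + 1 > coord_sum x {h..<j} \<and>
                coord_sum x {h..<j} > real (area n S h j))}
        \<and>
        Z_open k n Z T =
          {Y \<in> Gr k (k + 2). \<exists>A. represents k (k + 2) A Y \<and>
             (\<forall>h j. h < j \<and> {h, j} \<in> sides n \<union> diags T' \<longrightarrow>
                sgn (twistor Z A h j) = (-1) ^ area n S h j)})"
proof -
  have n: "3 \<le> n" using assms(1,3) by simp
  note Z = assms(4)
  have kT: "card (blacks T) = k" using assms(5) unfolding bicolored_triangulation_def by simp
  have T: "represented_by n S T" unfolding represented_by_def using assms(5,6) kT by simp
  interpret c: colored n "diags T" "diags S" "blacks T" by (rule colored_of_bicolored[OF assms(5) n assms(6)])
  have M: "matching_positroid n S = c.full_states (blacks T)"
    by (rule c.matching_positroid_subdivision[OF assms(6)]) simp_all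
  have facts: "colored n (diags T') (diags S) (blacks T') \<and> card (blacks T') = k \<and>
      matching_positroid n S = triangulated.full_states n (diags T') (blacks T') \<and>
      (\<forall>I. transversal I (blacks T') \<longleftrightarrow> transversal I (blacks T))"
    if r: "represented_by n S T'" for T'
  proof -
    have r': "bicolored_triangulation (card (blacks T')) n T'" "S = subdivision_of n T'"
      using r unfolding represented_by_def by auto
    interpret c': colored n "diags T'" "diags S" "blacks T'" by (rule colored_of_bicolored[OF r'(1) n r'(2)])
    have tr: "transversal I (blacks T') \<longleftrightarrow> transversal I (blacks T)" for I
      using tdual_positroid_invariant[OF r'(1) assms(5) n] r'(2) assms(6) by simp
    obtain I where "transversal I (blacks T)" using c.transversal_avoiding[OF c.B_faces c.arc_root] by metis
    then have "card (blacks T') = k" using tr transversal_card kT by metis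
    then show ?thesis using c'.matching_positroid_subdivision[OF r'(2)] c'.colored_axioms tr by simp
  qed
  have cell: "Z_open k n Z T = Z_tilde k n Z ` positroid_cell k n {I \<in> ksubsets k n. transversal I (blacks T)}"
    unfolding Z_open_def tdual_positroid_eq ..
  have Gamma: "Gamma_open k n S =
          {x \<in> carrier_vec n. coord_sum x {0..<n} = real (k + 1) \<and>
             (\<forall>h j. h < j \<and> {h, j} \<in> sides n \<union> diags T' \<longrightarrow>
                real (area n S h j) + 1 > coord_sum x {h..<j} \<and>
                coord_sum x {h..<j} > real (area n S h j))}" if r: "represented_by n S T'" for T'
  proof -
    interpret c': colored n "diags T'" "diags S" "blacks T'" using facts[OF r] by blast
    have "Gamma_open k n S = moment_map (k + 1) n ` positroid_cell (k + 1) n (c'.full_states (blacks T'))"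
      unfolding Gamma_open_def using facts[OF r] by simp
    also have "\<dots> = {x \<in> carrier_vec n. coord_sum x {0..<n} = real (k + 1) \<and>
      (\<forall>h j. c'.arc h j \<longrightarrow> real (count_in (blacks T') h j) + 1 > coord_sum x {h..<j} \<and>
        coord_sum x {h..<j} > real (count_in (blacks T') h j))}"
      using c'.moment_image_eq[OF c'.B_faces] facts[OF r] by blast
    also have "\<dots> = {x \<in> carrier_vec n. coord_sum x {0..<n} = real (k + 1) \<and>
             (\<forall>h j. h < j \<and> {h, j} \<in> sides n \<union> diags T' \<longrightarrow>
                real (area n S h j) + 1 > coord_sum x {h..<j} \<and>
                coord_sum x {h..<j} > real (area n S h j))}"
      unfolding c'.arc_def using area_eq_count[OF r n] by auto
    finally show ?thesis .
  qed
  have Zset: "Z_open k n Z T = {Y \<in> Gr k (k + 2). \<exists>A. represents k (k + 2) A Y \<and>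
             (\<forall>h j. h < j \<and> {h, j} \<in> sides n \<union> diags T' \<longrightarrow>
                sgn (twistor Z A h j) = (-1) ^ area n S h j)}" if r: "represented_by n S T'" for T'
  proof -
    interpret c': colored n "diags T'" "diags S" "blacks T'" using facts[OF r] by blast
    have "Z_open k n Z T = Z_tilde k n Z ` positroid_cell k n {I \<in> ksubsets k n. transversal I (blacks T')}"
      unfolding cell using facts[OF r] by simp
    also have "\<dots> = {Y \<in> Gr k (k + 2). \<exists>A. represents k (k + 2) A Y \<and>
        (\<forall>h j. c'.arc h j \<longrightarrow> sgn (twistor Z A h j) = (-1) ^ count_in (blacks T') h j)}"
      using c'.Z_image_eq[OF c'.B_faces _ Z] facts[OF r] by blast
    also have "\<dots> = {Y \<in> Gr k (k + 2). \<exists>A. represents k (k + 2) A Y \<and>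
             (\<forall>h j. h < j \<and> {h, j} \<in> sides n \<union> diags T' \<longrightarrow>
                sgn (twistor Z A h j) = (-1) ^ area n S h j)}"
    proof -
      have "(c'.arc h j \<longrightarrow> sgn (twistor Z A h j) = (-1) ^ count_in (blacks T') h j) \<longleftrightarrow>
        (h < j \<and> {h, j} \<in> sides n \<union> diags T' \<longrightarrow> sgn (twistor Z A h j) = (-1) ^ area n S h j)" for A h j
      proof (cases "h < j \<and> {h, j} \<in> sides n \<union> diags T'")
        case True
        then show ?thesis using area_eq_count[OF r n, of h j] unfolding c'.arc_def by simp
      next
        case False
        then show ?thesis unfolding c'.arc_def by blast
      qed
      then show ?thesis by (simp only:)
    qed
    finally show ?thesis .
  qed
  have part1: "real (area n S h j) + 1 > coord_sum x {h..<j} \<and> coord_sum x {h..<j} > real (area n S h j)"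
    if hj: "h < j" "compatible n S h j" and x: "x \<in> Gamma_open k n S" for h j x
  proof -
    obtain T' where r: "represented_by n S T'" "{h, j} \<in> sides n \<union> diags T'"
      by (rule compatible_in_triangulation[OF assms(5) n assms(6) hj(2,1)])
    then show ?thesis using x hj(1) unfolding Gamma[OF r(1)] by blast
  qed
  have part2: "\<exists>A. represents k (k + 2) A Y \<and>
        (\<forall>h j. h < j \<and> compatible n S h j \<longrightarrow> sgn (twistor Z A h j) = (-1) ^ area n S h j)"
    if Y: "Y \<in> Z_open k n Z T" for Y
  proof -
    obtain V where V: "V \<in> positroid_cell k n {I \<in> ksubsets k n. transversal I (blacks T)}" "Y = Z_tilde k n Z V"
      using Y unfolding cell by blast
    obtain C where C: "C \<in> carrier_mat k n"
      "\<And>I. I \<in> ksubsets k n \<Longrightarrow> if transversal I (blacks T) then plucker C I > 0 else plucker C I = 0"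
      "represents k (k + 2) (C * Z) Y" using c.Z_image_point[OF c.B_faces kT Z V(1)] V(2) by blast
    have "sgn (twistor Z (C * Z) h j) = (-1) ^ area n S h j" if hj: "h < j" "compatible n S h j" for h j
    proof -
      obtain T' where r: "represented_by n S T'" "{h, j} \<in> sides n \<union> diags T'"
        by (rule compatible_in_triangulation[OF assms(5) n assms(6) hj(2,1)])
      interpret c': colored n "diags T'" "diags S" "blacks T'" using facts[OF r(1)] by blast
      have "c'.arc h j" unfolding c'.arc_def using r(2) hj(1) by simp
      then have "sgn (twistor Z (C * Z) h j) = (-1) ^ count_in (blacks T') h j"
        using facts[OF r(1)] C(2) by (intro c'.twistor_signs[OF c'.B_faces _ C(1) Z]) auto
      then show ?thesis using area_eq_count[OF r(1) n hj(1) r(2)] by simp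
    qed
    then show ?thesis using C(3) by blast
  qed
  show ?thesis
  proof (intro conjI allI impI ballI, goal_cases)
    case (1 h j x) then show ?case using part1 by blast
  next
    case (2 h j x) then show ?case using part1 by blast
  next
    case (3 Y) then show ?case by (rule part2)
  next
    case (4 T') then show ?case by (rule Gamma)
  next
    case (5 T') then show ?case by (rule Zset)
  qed
qed

end
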